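(* Let $\mathbb{B}\subset\mathbb{R}^3$ be the unit ball. (ii.1) Suppose that $f$ is continuous on $\overline{\mathbb{B}}$, that $f$ is a univalent harmonic $K$-quasiconformal gradient mapping from $\mathbb{B}$ onto a convex domain $D\subset\mathbb{R}^3$, and that the partial derivatives of $f$ have continuous extensions to $\overline{\mathbb{B}}$. Then $f:\mathbb{B}\to D$ is bi-Lipschitz; in particular, $f^{-1}:D\to\mathbb{B}$ is $L$-Lipschitz for some constant $L$. (ii.2) If $f$ is an injective harmonic $K$-quasiconformal gradient mapping from $\mathbb{B}$ onto a bounded convex domain $D\subset\mathbb{R}^3$, then $f$ is co-Lipschitz.
   Context: A harmonic gradient mapping on $\mathbb{B}$ is a map of the form $f=\nabla u$, where $u$ is a real-valued harmonic function on $\mathbb{B}$. Univalent means injective. An injective $C^1$ map $f$ in $\mathbb{R}^3$ is $K$-quasiconformal if $|f'(x)|^3/K\le|J(x,f)|\le K\,\ell(f'(x))^3$ for every $x$, where $|f'(x)|=\max_{|v|=1}|f'(x)v|$, $\ell(f'(x))=\min_{|v|=1}|f'(x)v|$ and $J$ is the Jacobian determinant. The map $f$ is co-Lipschitz if there is $c>0$ with $|f(x)-f(y)|\ge c|x-y|$ for all $x,y\in\mathbb{B}$, and bi-Lipschitz if it is both Lipschitz and co-Lipschitz. *)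

theory Defs
  imports "HOL-Analysis.Analysis"
begin

(* All functions are total; only their values on the set S (resp. on the closed ball) matter.
   The sets S below are meant to be open, so that derivatives at points of S depend on the
   values on S only. *)

text \<open>The partial derivative in direction \<open>e\<^sub>i\<close>. It is the classical one whenever the function is
  differentiable at the point, which is ensured by \<open>C1_on\<close> wherever it is used.\<close>

definition partial :: "'n \<Rightarrow> (real^'n \<Rightarrow> 'b::real_normed_vector) \<Rightarrow> real^'n \<Rightarrow> 'b::real_normed_vector"
  where "partial i f x = frechet_derivative f (at x) (axis i 1)"

definition C1_on :: "(real^'n::finite) set \<Rightarrow> (real^'n \<Rightarrow> 'b::real_normed_vector) \<Rightarrow> bool"
  where "C1_on S f \<longleftrightarrow> (\<forall>x\<in>S. f differentiable (at x)) \<and> (\<forall>i. continuous_on S (partial i f))"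

definition harmonic_on :: "(real^'n::finite) set \<Rightarrow> (real^'n \<Rightarrow> real) \<Rightarrow> bool"
  where "harmonic_on S u \<longleftrightarrow>
    C1_on S u \<and> (\<forall>i. C1_on S (partial i u)) \<and>
    (\<forall>x\<in>S. (\<Sum>i\<in>UNIV. partial i (partial i u) x) = 0)"

definition harmonic_gradient_on :: "(real^'n::finite) set \<Rightarrow> (real^'n \<Rightarrow> real^'n) \<Rightarrow> bool"
  where "harmonic_gradient_on S f \<longleftrightarrow> (\<exists>u. harmonic_on S u \<and> (\<forall>x\<in>S. GDERIV u x :> f x))"

text \<open>For linear maps in finite dimension the supremum and the infimum are attained, by
  compactness of the unit sphere, so they are the maximum and the minimum.\<close>

definition max_stretch :: "(real^'n::finite \<Rightarrow> real^'n) \<Rightarrow> real"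
  where "max_stretch A = (SUP v\<in>sphere 0 1. norm (A v))"

definition min_stretch :: "(real^'n::finite \<Rightarrow> real^'n) \<Rightarrow> real"
  where "min_stretch A = (INF v\<in>sphere 0 1. norm (A v))"

definition jacobian :: "(real^'n::finite \<Rightarrow> real^'n) \<Rightarrow> real^'n \<Rightarrow> real"
  where "jacobian f x = det (matrix (frechet_derivative f (at x)))"

definition quasiconformal_on :: "real \<Rightarrow> (real^3) set \<Rightarrow> (real^3 \<Rightarrow> real^3) \<Rightarrow> bool"
  where "quasiconformal_on K S f \<longleftrightarrow>
    inj_on f S \<and> C1_on S f \<and>
    (\<forall>x\<in>S. max_stretch (frechet_derivative f (at x)) ^ 3 / K \<le> \<bar>jacobian f x\<bar> \<and>
           \<bar>jacobian f x\<bar> \<le> K * min_stretch (frechet_derivative f (at x)) ^ 3)"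

definition co_lipschitz_on :: "'a::metric_space set \<Rightarrow> ('a \<Rightarrow> 'b::metric_space) \<Rightarrow> bool"
  where "co_lipschitz_on S f \<longleftrightarrow> (\<exists>c>0. \<forall>x\<in>S. \<forall>y\<in>S. dist (f x) (f y) \<ge> c * dist x y)"

definition bi_lipschitz_on :: "'a::metric_space set \<Rightarrow> ('a \<Rightarrow> 'b::metric_space) \<Rightarrow> bool"
  where "bi_lipschitz_on S f \<longleftrightarrow> (\<exists>L. L-lipschitz_on S f) \<and> co_lipschitz_on S f"

definition partials_extend :: "(real^'n::finite) set \<Rightarrow> (real^'n \<Rightarrow> real^'m::finite) \<Rightarrow> bool"
  where "partials_extend S f \<longleftrightarrow>
    (\<forall>i. \<exists>g. continuous_on (closure S) g \<and> (\<forall>x\<in>S. g x = partial i f x))"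

end

theory Submission
  imports Defs
begin

text \<open>
  Write \<open>f = \<nabla>u\<close> with \<open>u\<close> harmonic, \<open>A\<close> for the Hessian of \<open>u\<close>, which is the derivative of \<open>f\<close>, and \<open>J = det A\<close>.
  Both parts follow from one estimate: \<open>J\<^sup>2\<close> is bounded below by a positive constant on the whole ball.
  Quasiconformality then bounds the minimal stretching of \<open>A\<close> from below, so the inverse of \<open>f\<close> has
  a bounded derivative, and it is Lipschitz because its domain \<open>D\<close> is convex. Continuous extensions of the partial
  derivatives are bounded on the compact closed ball, and this gives the remaining Lipschitz bound for \<open>f\<close>.

  The bound for \<open>J\<close> rests on three facts.

  First, \<open>ln \<bar>J\<bar>\<close> is superharmonic wherever \<open>J \<noteq> 0\<close> (Lewy, Gleason and Wolff). In an orthonormal basis that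
  diagonalizes \<open>A\<close> at a point, the Laplacian of \<open>ln \<bar>J\<bar>\<close> is a quadratic form in the third derivatives
  of \<open>u\<close>, and because \<open>A\<close> has trace \<open>0\<close> and the third derivatives form a trace-free symmetric tensor, it is minus a
  sum of three squares: \<open>lewy_quadratic_form\<close> and \<open>ln_det_hess_superharmonic\<close>.

  Second, \<open>J\<close> never vanishes: \<open>det_hess_nonzero\<close>. At a zero of \<open>J\<close> the distortion inequality makes \<open>A\<close> itself
  vanish. Injectivity excludes a zero of infinite order, and the homogeneous leading term of \<open>A\<close> cannot
  vanish in any direction, because a blow-up at such a direction would be a nonzero matrix of bounded
  distortion with a kernel. So \<open>\<bar>J\<bar>\<close> is at least a power of the distance to the zero, and the
  superharmonic function \<open>ln \<bar>J\<bar>\<close> tends to minus infinity too slowly for this to be compatible with the minimum principle.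

  Third, \<open>J\<close> is compared with the distance to the boundary as in the Ahlfors form of the Schwarz lemma. For a ball
  of radius \<open>d\<close> about \<open>f x0\<close> inside \<open>D\<close> and \<open>\<eta> x = d\<^sup>2 - \<bar>f x - f x0\<bar>\<^sup>2\<close>, look at a maximum point of
  \<open>\<eta>\<^sup>6 / (J\<^sup>2 (1 - \<bar>x\<bar>\<^sup>2)\<^sup>6)\<close>. Since \<open>- ln J\<^sup>2\<close> is subharmonic and the Laplacian of \<open>- ln (1 - \<bar>x\<bar>\<^sup>2)\<close> is at least
  \<open>4 / (1 - \<bar>x\<bar>\<^sup>2)\<^sup>2\<close>, the second derivative test at that point bounds this very quantity, and the result is
  \<open>d\<^sup>6 \<le> 4 K\<^sup>2 J(x0)\<^sup>2 (1 - \<bar>x0\<bar>\<^sup>2)\<^sup>6\<close>: \<open>Ahlfors_Schwarz_jacobian_bound\<close>. On the other hand a Hopf barrier applied to the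
  supporting half-spaces of the convex set \<open>D\<close> shows that \<open>d\<close> may be taken to be a fixed multiple of \<open>1 - \<bar>x0\<bar>\<close>:
  \<open>Hopf_boundary_distance\<close>. The powers of \<open>1 - \<bar>x0\<bar>\<close> cancel.

  Differentiating \<open>ln J\<^sup>2\<close> twice uses four derivatives of \<open>u\<close>, while the definition of harmonicity provides
  only two. Smoothness and the derivative bounds behind the finite order of zeros are derived from the
  maximum principle, by barriers and difference quotients.
\<close>

section \<open>Second-order jets on a line\<close>

text \<open>The value, first and second derivative of \<open>\<phi>\<close> at \<open>0\<close>. The Laplacian of a function at a point is the sum of the
  last components of its jets along an orthonormal frame, so all second-order computations
  reduce to the one-variable rules below, which need the second derivative at a single point only.\<close>

definition jet2 :: "(real \<Rightarrow> real) \<Rightarrow> real \<Rightarrow> real \<Rightarrow> real \<Rightarrow> bool" where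
  "jet2 \<phi> c a b \<longleftrightarrow> \<phi> 0 = c \<and> (\<exists>\<psi>. (\<forall>\<^sub>F t in nhds 0. (\<phi> has_real_derivative \<psi> t) (at t)) \<and> \<psi> 0 = a \<and>
     (\<psi> has_real_derivative b) (at 0))"

lemma jet2E:
  assumes "jet2 \<phi> c a b"
  obtains \<psi> where "\<forall>\<^sub>F t in nhds 0. (\<phi> has_real_derivative \<psi> t) (at t)" "\<psi> 0 = a"
    "(\<psi> has_real_derivative b) (at 0)"
  using assms unfolding jet2_def by blast

lemma jet2_cong: "jet2 \<phi> c a b \<Longrightarrow> c = c' \<Longrightarrow> a = a' \<Longrightarrow> b = b' \<Longrightarrow> jet2 \<phi> c' a' b'"
  by simp

lemma jet2_transform:
  assumes "jet2 \<phi> c a b" "\<forall>\<^sub>F t in nhds 0. \<phi> t = \<psi> t"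
  shows "jet2 \<psi> c a b"
proof -
  obtain p where p: "\<forall>\<^sub>F t in nhds 0. (\<phi> has_real_derivative p t) (at t)" "p 0 = a"
      "(p has_real_derivative b) (at 0)"
    using jet2E[OF assms(1)] .
  have "\<forall>\<^sub>F t in nhds 0. \<forall>\<^sub>F s in nhds t. \<phi> s = \<psi> s" using assms(2) by (simp add: eventually_eventually)
  then have "\<forall>\<^sub>F t in nhds 0. (\<psi> has_real_derivative p t) (at t)"
    using p(1) by eventually_elim (simp add: DERIV_cong_ev)
  moreover have "\<psi> 0 = c" using assms(1) eventually_nhds_x_imp_x[OF assms(2)] unfolding jet2_def by simp
  ultimately show ?thesis using p unfolding jet2_def by blast
qed

lemma jet2_const: "jet2 (\<lambda>t. c) c 0 0"
  unfolding jet2_def by (auto intro!: exI[of _ "\<lambda>_. 0"])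

lemma jet2_add:
  assumes "jet2 \<phi> c a b" "jet2 \<psi> c' a' b'"
  shows "jet2 (\<lambda>t. \<phi> t + \<psi> t) (c + c') (a + a') (b + b')"
proof -
  obtain p where p: "\<forall>\<^sub>F t in nhds 0. (\<phi> has_real_derivative p t) (at t)" "p 0 = a"
      "(p has_real_derivative b) (at 0)"
    using jet2E[OF assms(1)] .
  obtain q where q: "\<forall>\<^sub>F t in nhds 0. (\<psi> has_real_derivative q t) (at t)" "q 0 = a'"
      "(q has_real_derivative b') (at 0)"
    using jet2E[OF assms(2)] .
  have "\<forall>\<^sub>F t in nhds 0. ((\<lambda>t. \<phi> t + \<psi> t) has_real_derivative (p t + q t)) (at t)"
    using p(1) q(1) by eventually_elim (rule DERIV_add)
  moreover have "((\<lambda>t. p t + q t) has_real_derivative (b + b')) (at 0)"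
    using p(3) q(3) by (rule DERIV_add)
  ultimately show ?thesis using assms p(2) q(2) unfolding jet2_def
    by (auto intro!: exI[of _ "\<lambda>t. p t + q t"])
qed

lemma jet2_mult:
  assumes "jet2 \<phi> c a b" "jet2 \<psi> c' a' b'"
  shows "jet2 (\<lambda>t. \<phi> t * \<psi> t) (c * c') (a * c' + c * a') (b * c' + 2 * a * a' + c * b')"
proof -
  obtain p where p: "\<forall>\<^sub>F t in nhds 0. (\<phi> has_real_derivative p t) (at t)" "p 0 = a"
      "(p has_real_derivative b) (at 0)"
    using jet2E[OF assms(1)] .
  obtain q where q: "\<forall>\<^sub>F t in nhds 0. (\<psi> has_real_derivative q t) (at t)" "q 0 = a'"
      "(q has_real_derivative b') (at 0)"
    using jet2E[OF assms(2)] .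
  have v: "\<phi> 0 = c" "\<psi> 0 = c'" using assms unfolding jet2_def by auto
  have d: "(\<phi> has_real_derivative a) (at 0)" "(\<psi> has_real_derivative a') (at 0)"
    using eventually_nhds_x_imp_x[OF p(1)] eventually_nhds_x_imp_x[OF q(1)] p(2) q(2) by auto
  have "\<forall>\<^sub>F t in nhds 0. ((\<lambda>t. \<phi> t * \<psi> t) has_real_derivative (p t * \<psi> t + \<phi> t * q t)) (at t)"
    using p(1) q(1) by eventually_elim (auto intro!: derivative_eq_intros)
  moreover have "((\<lambda>t. p t * \<psi> t + \<phi> t * q t) has_real_derivative (b * c' + 2 * a * a' + c * b')) (at 0)"
    using p(3) q(3) d by (auto intro!: derivative_eq_intros simp: v p(2) q(2))
  ultimately show ?thesis using assms p(2) q(2) v unfolding jet2_def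
    by (auto intro!: exI[of _ "\<lambda>t. p t * \<psi> t + \<phi> t * q t"])
qed

lemma jet2_cmult:
  assumes "jet2 \<phi> c a b"
  shows "jet2 (\<lambda>t. k * \<phi> t) (k * c) (k * a) (k * b)"
  by (rule jet2_cong[OF jet2_mult[OF jet2_const[of k] assms]]) auto

lemma jet2_minus:
  assumes "jet2 \<phi> c a b" shows "jet2 (\<lambda>t. - \<phi> t) (- c) (- a) (- b)"
  using jet2_cmult[OF assms, of "-1"] by simp

lemma jet2_diff:
  assumes "jet2 \<phi> c a b" "jet2 \<psi> c' a' b'"
  shows "jet2 (\<lambda>t. \<phi> t - \<psi> t) (c - c') (a - a') (b - b')"
  using jet2_add[OF assms(1) jet2_minus[OF assms(2)]] by simp

lemma jet2_sum:
  assumes "finite I" "\<And>i. i \<in> I \<Longrightarrow> jet2 (\<phi> i) (c i) (a i) (b i)"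
  shows "jet2 (\<lambda>t. \<Sum>i\<in>I. \<phi> i t) (sum c I) (sum a I) (sum b I)"
  using assms by (induction I rule: finite_induct) (auto intro: jet2_add simp: jet2_const)

lemma jet2_comp:
  assumes "jet2 \<phi> c a b"
    and "\<forall>\<^sub>F y in nhds c. (F has_real_derivative F' y) (at y)" "(F' has_real_derivative k) (at c)"
  shows "jet2 (\<lambda>t. F (\<phi> t)) (F c) (F' c * a) (k * a\<^sup>2 + F' c * b)"
proof -
  obtain p where p: "\<forall>\<^sub>F t in nhds 0. (\<phi> has_real_derivative p t) (at t)" "p 0 = a"
      "(p has_real_derivative b) (at 0)"
    using jet2E[OF assms(1)] .
  have v: "\<phi> 0 = c" using assms unfolding jet2_def by auto
  have d: "(\<phi> has_real_derivative a) (at 0)"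
    using eventually_nhds_x_imp_x[OF p(1)] p(2) by auto
  have lim: "filterlim \<phi> (nhds c) (nhds 0)"
    using DERIV_isCont[OF d] by (simp only: v[symmetric] isCont_def tendsto_at_iff_tendsto_nhds)
  have "\<forall>\<^sub>F t in nhds 0. (F has_real_derivative F' (\<phi> t)) (at (\<phi> t))"
    using eventually_compose_filterlim[OF assms(2) lim] .
  with p(1) have "\<forall>\<^sub>F t in nhds 0. ((\<lambda>t. F (\<phi> t)) has_real_derivative (F' (\<phi> t) * p t)) (at t)"
    by eventually_elim (rule DERIV_chain2)
  moreover have "((\<lambda>t. F' (\<phi> t)) has_real_derivative (k * a)) (at 0)"
    by (rule DERIV_chain2[OF _ d]) (use assms(3) v in auto)
  then have "((\<lambda>t. F' (\<phi> t) * p t) has_real_derivative (k * a\<^sup>2 + F' c * b)) (at 0)"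
    using p(3) by (auto intro!: derivative_eq_intros simp: v p(2) power2_eq_square)
  ultimately show ?thesis using p(2) v unfolding jet2_def
    by (auto intro!: exI[of _ "\<lambda>t. F' (\<phi> t) * p t"])
qed

lemma jet2_ln:
  assumes "jet2 \<phi> c a b" "c > 0"
  shows "jet2 (\<lambda>t. ln (\<phi> t)) (ln c) (a / c) (b / c - a\<^sup>2 / c\<^sup>2)"
proof -
  have "\<forall>\<^sub>F y in nhds c. y > 0" using eventually_nhds_in_open[of "{0<..}" c] assms(2) by simp
  then have 1: "\<forall>\<^sub>F y in nhds c. (ln has_real_derivative (1 / y)) (at y)"
    by eventually_elim (auto intro!: derivative_eq_intros simp: divide_inverse)
  have 2: "((\<lambda>y. 1 / y) has_real_derivative (- 1 / c\<^sup>2)) (at c)"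
    using assms(2) by (auto intro!: derivative_eq_intros simp: power2_eq_square divide_inverse)
  show ?thesis
    by (rule jet2_cong[OF jet2_comp[OF assms(1) 1 2]]) (auto simp: field_simps)
qed

lemma jet2_inverse:
  assumes "jet2 \<phi> c a b" "c > 0"
  shows "jet2 (\<lambda>t. 1 / \<phi> t) (1 / c) (- a / c\<^sup>2) (2 * a\<^sup>2 / c^3 - b / c\<^sup>2)"
proof -
  have "\<forall>\<^sub>F y in nhds c. y > 0" using eventually_nhds_in_open[of "{0<..}" c] assms(2) by simp
  then have 1: "\<forall>\<^sub>F y in nhds c. ((\<lambda>y. 1 / y) has_real_derivative (- 1 / y\<^sup>2)) (at y)"
    by eventually_elim (auto intro!: derivative_eq_intros simp: power2_eq_square divide_inverse)
  have 2: "((\<lambda>y. - 1 / y\<^sup>2) has_real_derivative (2 / c^3)) (at c)"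
    using assms(2) by (auto intro!: derivative_eq_intros simp: power2_eq_square power3_eq_cube divide_inverse)
  show ?thesis
    by (rule jet2_cong[OF jet2_comp[OF assms(1) 1 2]]) (auto simp: field_simps)
qed

text \<open>Only the second derivative at the point itself is available, so this is argued with monotonicity of \<open>\<phi>\<close>
  near \<open>0\<close> and not with a Taylor expansion.\<close>

lemma jet2_local_max:
  assumes "jet2 \<phi> c a b" "\<forall>\<^sub>F t in nhds 0. \<phi> t \<le> c"
  shows "b \<le> 0"
proof (rule ccontr)
  assume "\<not> b \<le> 0" then have b: "b > 0" by simp
  obtain p where p: "\<forall>\<^sub>F t in nhds 0. (\<phi> has_real_derivative p t) (at t)" "p 0 = a"
      "(p has_real_derivative b) (at 0)"
    using jet2E[OF assms(1)] .
  have v: "\<phi> 0 = c" using assms unfolding jet2_def by auto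
  obtain r where r: "r > 0" "\<And>t. dist t 0 < r \<Longrightarrow> (\<phi> has_real_derivative p t) (at t) \<and> \<phi> t \<le> c"
    using eventually_conj[OF p(1) assms(2)] unfolding eventually_nhds_metric by blast
  have "p 0 = 0"
  proof (rule DERIV_local_max[where f = \<phi> and x = 0 and d = r])
    show "(\<phi> has_real_derivative p 0) (at 0)" using r by simp
    show "\<forall>y. \<bar>0 - y\<bar> < r \<longrightarrow> \<phi> y \<le> \<phi> 0" using r v by (auto simp: dist_real_def)
  qed (use r in auto)
  obtain d where d: "d > 0" "\<And>h. 0 < h \<Longrightarrow> h < d \<Longrightarrow> p 0 < p (0 + h)"
    using DERIV_pos_inc_right[OF p(3) b] by auto
  define t where "t = min d r / 2"
  have t: "0 < t" "t < d" "t < r" using d r unfolding t_def by auto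
  obtain z where z: "0 < z" "z < t" "\<phi> t - \<phi> 0 = (t - 0) * p z"
    using MVT2[of 0 t \<phi> p] t r by (auto simp: dist_real_def)
  have "p z > 0" using d(2)[of z] z t \<open>p 0 = 0\<close> by auto
  then have "\<phi> t > \<phi> 0" using z t by (smt (verit) mult_pos_pos)
  then show False using r(2)[of t] t v by (auto simp: dist_real_def)
qed

lemma jet2_affine: "jet2 (\<lambda>t. c + t * a) c a 0"
proof -
  have "((\<lambda>t. c + t * a) has_real_derivative a) (at t)" for t
    by (auto intro!: derivative_eq_intros)
  then show ?thesis unfolding jet2_def by (auto intro!: exI[of _ "\<lambda>_. a"])
qed

lemma jet2_norm_sq: "jet2 (\<lambda>t. (norm (x + t *\<^sub>R e))\<^sup>2) ((norm x)\<^sup>2) (2 * inner x e) (2 * (norm e)\<^sup>2)"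
proof -
  have *: "(\<lambda>t. (norm (x + t *\<^sub>R e))\<^sup>2) = (\<lambda>t. ((norm x)\<^sup>2 + t * (2 * inner x e)) + (norm e)\<^sup>2 * ((0 + t * 1) * (0 + t * 1)))"
    by (auto simp: power2_norm_eq_inner inner_add inner_commute algebra_simps)
  show ?thesis unfolding *
    by (rule jet2_cong[OF jet2_add[OF jet2_affine jet2_cmult[OF jet2_mult[OF jet2_affine jet2_affine]]]]) auto
qed

lemma has_vector_derivative_quotient_limit:
  assumes "(f has_vector_derivative d) (at 0)"
  shows "((\<lambda>k. (f k - f 0) /\<^sub>R k) \<longlongrightarrow> d) (at 0)"
proof -
  have "((\<lambda>k. norm (f k - f 0 - k *\<^sub>R d) / norm k) \<longlongrightarrow> 0) (at 0)"
    using assms unfolding has_vector_derivative_def has_derivative_iff_norm by simp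
  then have "((\<lambda>k. norm ((f k - f 0) /\<^sub>R k - d)) \<longlongrightarrow> 0) (at 0)"
  proof (rule Lim_transform_within[where d = 1])
    fix k :: real assume "0 < dist k 0"
    then have "(f k - f 0) /\<^sub>R k - d = (f k - f 0 - k *\<^sub>R d) /\<^sub>R k"
      by (simp add: scaleR_diff_right)
    then show "norm (f k - f 0 - k *\<^sub>R d) / norm k = norm ((f k - f 0) /\<^sub>R k - d)"
      by (simp add: divide_inverse mult.commute)
  qed simp
  then show ?thesis by (rule LIM_zero_cancel[OF tendsto_norm_zero_cancel])
qed

section \<open>The maximum principle\<close>

lemma eventually_line_in_open:
  fixes x e :: "'a::real_normed_vector"
  assumes "open S" "x \<in> S"
  shows "\<forall>\<^sub>F t::real in nhds 0. x + t *\<^sub>R e \<in> S"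
proof -
  have "open ((\<lambda>t::real. x + t *\<^sub>R e) -` S)"
    using assms(1) by (intro open_vimage continuous_intros)
  from eventually_nhds_in_open[OF this, of 0] show ?thesis using assms(2) by simp
qed

text \<open>Subharmonicity at a single point, witnessed by one frame of unit vectors. The frame may depend on the point; this is
  what allows frames that diagonalize the Hessian.\<close>

definition subharmonic_at :: "(real^'n \<Rightarrow> real) \<Rightarrow> real^'n \<Rightarrow> bool" where
  "subharmonic_at v x \<longleftrightarrow> (\<exists>e::'n \<Rightarrow> real^'n. \<exists>a b. (\<forall>i. norm (e i) = 1 \<and>
     jet2 (\<lambda>t. v (x + t *\<^sub>R e i)) (v x) (a i) (b i)) \<and> (\<Sum>i\<in>UNIV. b i) \<ge> 0)"

lemma subharmonic_atI:
  fixes e :: "'n \<Rightarrow> real^'n"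
  assumes "\<And>i. norm (e i) = 1" "\<And>i. jet2 (\<lambda>t. v (x + t *\<^sub>R e i)) (v x) (a i) (b i)" "(\<Sum>i\<in>UNIV. b i) \<ge> 0"
  shows "subharmonic_at v x"
  using assms unfolding subharmonic_at_def by blast

text \<open>Adding \<open>\<epsilon> \<bar>y\<bar>\<^sup>2\<close> makes every sum of second derivatives positive, which the second derivative
  test forbids at an interior maximum.\<close>

lemma maximum_principle:
  fixes v :: "real^'n \<Rightarrow> real"
  assumes "compact K" "open U" "U \<subseteq> K" "continuous_on K v"
    and sub: "\<And>x. x \<in> U \<Longrightarrow> subharmonic_at v x"
    and bd: "\<And>x. x \<in> K - U \<Longrightarrow> v x \<le> M"
    and x: "x \<in> K"
  shows "v x \<le> M"
proof (rule field_le_epsilon)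
  fix \<epsilon>' :: real assume "\<epsilon>' > 0"
  obtain B where B: "B > 0" "\<And>y. y \<in> K \<Longrightarrow> norm y \<le> B"
    using compact_imp_bounded[OF \<open>compact K\<close>] bounded_pos by metis
  define \<epsilon> where "\<epsilon> = \<epsilon>' / B\<^sup>2"
  have \<epsilon>: "\<epsilon> > 0" using \<open>\<epsilon>' > 0\<close> B by (simp add: \<epsilon>_def)
  define w where "w = (\<lambda>y. v y + \<epsilon> * (norm y)\<^sup>2)"
  have "continuous_on K w" unfolding w_def using assms(4) by (intro continuous_intros)
  then obtain z where z: "z \<in> K" "\<And>y. y \<in> K \<Longrightarrow> w y \<le> w z"
    using continuous_attains_sup[OF \<open>compact K\<close>] x by blast
  have "z \<notin> U"
  proof
    assume "z \<in> U"
    then obtain e :: "'n \<Rightarrow> real^'n" and a b where e: "\<And>i. norm (e i) = 1"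
       "\<And>i. jet2 (\<lambda>t. v (z + t *\<^sub>R e i)) (v z) (a i) (b i)" "(\<Sum>i\<in>UNIV. b i) \<ge> 0"
      using sub[of z] unfolding subharmonic_at_def by blast
    have "b i + \<epsilon> * 2 \<le> 0" for i
    proof (rule jet2_local_max)
      show "jet2 (\<lambda>t. w (z + t *\<^sub>R e i)) (w z) (a i + \<epsilon> * (2 * inner z (e i))) (b i + \<epsilon> * 2)"
        unfolding w_def using jet2_add[OF e(2)[of i] jet2_cmult[OF jet2_norm_sq[of z "e i"], of \<epsilon>]] e(1) by simp
      have "\<forall>\<^sub>F t in nhds 0. z + t *\<^sub>R e i \<in> U"
        by (rule eventually_line_in_open[OF \<open>open U\<close> \<open>z \<in> U\<close>])
      then show "\<forall>\<^sub>F t in nhds 0. w (z + t *\<^sub>R e i) \<le> w z"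
        by eventually_elim (use z(2) \<open>U \<subseteq> K\<close> in blast)
    qed
    then have "b i < 0" for i using \<epsilon> by (smt (verit) mult_pos_pos)
    then have "sum b UNIV < sum (\<lambda>_. 0) (UNIV::'n set)" by (intro sum_strict_mono) auto
    then show False using e(3) by simp
  qed
  then have "v z \<le> M" using bd z(1) by blast
  have "v x \<le> w x" unfolding w_def using \<epsilon> by simp
  also have "\<dots> \<le> w z" using z x by blast
  also have "\<dots> \<le> M + \<epsilon> * B\<^sup>2" unfolding w_def
    using \<open>v z \<le> M\<close> B(2)[OF z(1)] \<epsilon> by (intro add_mono mult_left_mono power_mono) auto
  also have "\<dots> = M + \<epsilon>'" using B by (simp add: \<epsilon>_def)
  finally show "v x \<le> M + \<epsilon>'" .
qed

section \<open>Interior estimates for harmonic functions\<close>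

text \<open>Carrying the gradient and the Hessian as explicit arguments makes limits and difference quotients
  easy to state.\<close>

definition harmonic_with :: "(real^'n) set \<Rightarrow> (real^'n \<Rightarrow> real) \<Rightarrow> (real^'n \<Rightarrow> real^'n) \<Rightarrow> (real^'n \<Rightarrow> real^'n^'n) \<Rightarrow> bool" where
  "harmonic_with S u g H \<longleftrightarrow> (\<forall>x\<in>S. (u has_derivative (\<lambda>h. g x \<bullet> h)) (at x) \<and>
      (g has_derivative (\<lambda>h. H x *v h)) (at x) \<and> trace (H x) = 0)"

lemma has_derivative_along_line:
  assumes "(F has_derivative F') (at (x + t *\<^sub>R e))"
  shows "((\<lambda>t. F (x + t *\<^sub>R e)) has_vector_derivative F' e) (at t)"
proof -
  have "((\<lambda>t. x + t *\<^sub>R e) has_derivative (\<lambda>h. h *\<^sub>R e)) (at t)"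
    by (auto intro!: derivative_eq_intros)
  from has_derivative_compose[OF this, of F F'] assms
  have "((\<lambda>t. F (x + t *\<^sub>R e)) has_derivative (\<lambda>h. F' (h *\<^sub>R e))) (at t)" by simp
  then show ?thesis unfolding has_vector_derivative_def
    using linear_cmul[OF has_derivative_linear[OF assms]] by simp
qed

lemma harmonic_with_jet2:
  assumes "harmonic_with S u g H" "open S" "x \<in> S"
  shows "jet2 (\<lambda>t. u (x + t *\<^sub>R e)) (u x) (g x \<bullet> e) ((H x *v e) \<bullet> e)"
proof -
  have "\<forall>\<^sub>F t in nhds 0. ((\<lambda>t. u (x + t *\<^sub>R e)) has_real_derivative g (x + t *\<^sub>R e) \<bullet> e) (at t)"
    using eventually_line_in_open[OF assms(2,3), of e]
  proof eventually_elim
    case (elim t)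
    then have "(u has_derivative (\<lambda>h. g (x + t *\<^sub>R e) \<bullet> h)) (at (x + t *\<^sub>R e))"
      using assms(1) unfolding harmonic_with_def by blast
    from has_derivative_along_line[OF this] show ?case
      by (simp add: has_real_derivative_iff_has_vector_derivative)
  qed
  moreover have "(g has_derivative (\<lambda>h. H x *v h)) (at (x + 0 *\<^sub>R e))"
    using assms unfolding harmonic_with_def by auto
  from has_derivative_along_line[OF this]
  have "((\<lambda>t. g (x + t *\<^sub>R e) \<bullet> e) has_vector_derivative ((H x *v e) \<bullet> e)) (at 0)"
    by (rule bounded_linear.has_vector_derivative[OF bounded_linear_inner_left])
  then have "((\<lambda>t. g (x + t *\<^sub>R e) \<bullet> e) has_real_derivative ((H x *v e) \<bullet> e)) (at 0)"
    by (simp add: has_real_derivative_iff_has_vector_derivative)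
  ultimately show ?thesis unfolding jet2_def
    by (auto intro!: exI[of _ "\<lambda>t. g (x + t *\<^sub>R e) \<bullet> e"])
qed

lemma trace_eq_sum_axis: "trace (A::real^'n^'n) = (\<Sum>i\<in>UNIV. (A *v axis i 1) \<bullet> axis i 1)"
  by (simp add: trace_def matrix_vector_mul_component column_def inner_axis matrix_vector_mult_basis)

text \<open>In the half-ball where the coordinate \<open>y\<^sub>i\<close> is positive, the odd part of \<open>u\<close> under the reflection in
  \<open>y\<^sub>i = 0\<close> is dominated by the harmonic barrier \<open>(M / R\<^sup>2) (\<bar>y\<bar>\<^sup>2 + n y\<^sub>i (R - y\<^sub>i))\<close>. Both vanish at the centre, so
  their derivatives there are ordered as well.\<close>

lemma harmonic_with_gradient_bound:
  fixes u :: "real^'n \<Rightarrow> real" and M R :: real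
  assumes h: "harmonic_with S u g H" and S: "open S" "cball x R \<subseteq> S" and R: "R > 0"
    and M: "\<And>y. y \<in> cball x R \<Longrightarrow> \<bar>u y\<bar> \<le> M"
  shows "\<bar>g x $ i\<bar> \<le> CARD('n) * M / R"
proof -
  let ?e = "axis i 1 :: real^'n" and ?N = "real CARD('n)"
  define \<sigma> where "\<sigma> y = y - (2 * (y $ i)) *\<^sub>R ?e" for y :: "real^'n"
  have n\<sigma>: "norm (\<sigma> y) = norm y" for y
    unfolding \<sigma>_def norm_eq by (simp add: inner_diff inner_axis inner_axis' algebra_simps inner_commute)
  have \<sigma>line: "\<sigma> (y + t *\<^sub>R axis j 1) = \<sigma> y + t *\<^sub>R ((if j = i then -1 else 1) *\<^sub>R axis j 1)" for y t j
    unfolding \<sigma>_def by (auto simp: vec_eq_iff axis_def algebra_simps)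
  have c\<sigma>: "continuous_on UNIV \<sigma>" unfolding \<sigma>_def by (intro continuous_intros)
  have M0: "M \<ge> 0" using M[of x] R by fastforce
  define v where "v s y = (s / 2) * (u (x + y) - u (x + \<sigma> y)) - (M / R\<^sup>2) * ((norm y)\<^sup>2 + ?N * ((y $ i) * (R - y $ i)))" for s y
  define K where "K = cball (0::real^'n) R \<inter> {y. 0 \<le> y $ i}"
  define U where "U = ball (0::real^'n) R \<inter> {y. 0 < y $ i}"
  have comp: "compact K" unfolding K_def
    by (intro compact_Int_closed compact_cball closed_Collect_le continuous_intros)
  have opU: "open U" unfolding U_def
    by (intro open_Int open_ball open_Collect_less continuous_intros)
  have in1: "x + y \<in> cball x R" "x + \<sigma> y \<in> cball x R" if "y \<in> K" for y
    using that n\<sigma>[of y] by (auto simp: K_def dist_norm)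
  have cu: "continuous_on S u" using h unfolding harmonic_with_def
    by (meson has_derivative_continuous continuous_at_imp_continuous_on)
  have cv: "continuous_on K (v s)" for s
  proof -
    have "continuous_on K (\<lambda>y. u (x + y))" "continuous_on K (\<lambda>y. u (x + \<sigma> y))"
      by (rule continuous_on_compose2[OF cu]; use in1 S continuous_on_subset[OF c\<sigma>] in \<open>force intro!: continuous_intros\<close>)+
    then show ?thesis unfolding v_def by (intro continuous_intros) auto
  qed
  have main: "v s y \<le> 0" if s: "s = 1 \<or> s = -1" and y: "y \<in> K" for s y
  proof (rule maximum_principle[where K = K and U = U])
    show "U \<subseteq> K" by (auto simp: U_def K_def)
    show "v s z \<le> 0" if z: "z \<in> K - U" for z
    proof -
      have zi: "0 \<le> z $ i" "z $ i \<le> R" "norm z \<le> R" using z component_le_norm_cart[of z i] by (auto simp: K_def)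
      consider "z $ i = 0" | "norm z = R" using z zi by (fastforce simp: K_def U_def)
      then show ?thesis
      proof cases
        case 1
        then have "\<sigma> z = z" by (simp add: \<sigma>_def)
        then show ?thesis using 1 M0 R by (simp add: v_def)
      next
        case 2
        have 1: "s * (u (x + z) - u (x + \<sigma> z)) / 2 \<le> M"
          using M[OF in1(1), of z] M[OF in1(2), of z] z s by auto
        have 2: "M / R\<^sup>2 * ((norm z)\<^sup>2 + ?N * ((z $ i) * (R - z $ i))) \<ge> M / R\<^sup>2 * R\<^sup>2"
          using M0 zi 2 by (intro mult_left_mono) auto
        have 3: "M / R\<^sup>2 * R\<^sup>2 = M" using R by simp
        from order_trans[OF 1 2[unfolded 3]]
        show ?thesis unfolding v_def by simp
      qed
    qed
  next
    fix z assume z: "z \<in> U"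
    then have zK: "z \<in> K" by (auto simp: U_def K_def)
    have xz: "x + z \<in> S" "x + \<sigma> z \<in> S" using in1[OF zK] S by auto
    define s' where "s' j = (if j = i then -1 else 1 :: real)" for j
    let ?A = "H (x + z)" and ?B = "H (x + \<sigma> z)"
    define b where "b j = (s / 2) * ((?A *v axis j 1) \<bullet> axis j 1 - (?B *v axis j 1) \<bullet> axis j 1)
       - (M / R\<^sup>2) * (2 + ?N * (- 2 * (axis j 1 $ i)\<^sup>2))" for j
    have "\<exists>a. jet2 (\<lambda>t. v s (z + t *\<^sub>R axis j 1)) (v s z) a (b j)" for j
    proof -
      have 1: "jet2 (\<lambda>t. u (x + (z + t *\<^sub>R axis j 1))) (u (x + z)) (g (x + z) \<bullet> axis j 1) ((?A *v axis j 1) \<bullet> axis j 1)"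
        using harmonic_with_jet2[OF h S(1) xz(1), of "axis j 1"] by (simp add: add.assoc)
      have "(?B *v (s' j *\<^sub>R axis j 1)) \<bullet> (s' j *\<^sub>R axis j 1) = (?B *v axis j 1) \<bullet> axis j 1"
        by (simp add: s'_def matrix_vector_mult_scaleR)
      then have 2: "\<exists>a. jet2 (\<lambda>t. u (x + \<sigma> (z + t *\<^sub>R axis j 1))) (u (x + \<sigma> z)) a ((?B *v axis j 1) \<bullet> axis j 1)"
        using harmonic_with_jet2[OF h S(1) xz(2), of "s' j *\<^sub>R axis j 1"] by (auto simp: \<sigma>line s'_def add.assoc)
      then obtain a where 2: "jet2 (\<lambda>t. u (x + \<sigma> (z + t *\<^sub>R axis j 1))) (u (x + \<sigma> z)) a ((?B *v axis j 1) \<bullet> axis j 1)" by blast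
      have 3: "jet2 (\<lambda>t. (z + t *\<^sub>R axis j 1) $ i) (z $ i) (axis j 1 $ i) 0"
        using jet2_affine[of "z $ i" "axis j 1 $ i"] by simp
      note 4 = jet2_diff[OF jet2_cmult[OF jet2_diff[OF 1 2], of "s / 2"]
          jet2_cmult[OF jet2_add[OF jet2_norm_sq[of z "axis j 1"] jet2_cmult[OF jet2_mult[OF 3 jet2_diff[OF jet2_const[of R] 3]], of ?N]], of "M / R\<^sup>2"]]
      show ?thesis unfolding v_def b_def
        by (rule exI, rule jet2_cong[OF 4 refl refl]) (simp add: norm_axis_1 power2_eq_square)
    qed
    then obtain a where a: "\<And>j. jet2 (\<lambda>t. v s (z + t *\<^sub>R axis j 1)) (v s z) (a j) (b j)" by metis
    have "(\<Sum>j\<in>UNIV. (axis j 1 $ i)\<^sup>2) = (\<Sum>j\<in>UNIV. if j = i then 1 else 0::real)"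
      by (intro sum.cong) (auto simp: axis_def)
    then have ax: "(\<Sum>j\<in>UNIV. (axis j (1::real) $ i)\<^sup>2) = 1" by simp
    have tr: "trace ?A = 0" "trace ?B = 0" using h xz unfolding harmonic_with_def by auto
    have "sum b UNIV = (s / 2) * (trace ?A - trace ?B) - (M / R\<^sup>2) * (2 * ?N + ?N * (-2 * (\<Sum>j\<in>UNIV. (axis j (1::real) $ i)\<^sup>2)))"
      unfolding b_def trace_eq_sum_axis
      by (simp add: sum_subtractf sum.distrib sum_distrib_left[symmetric] sum_divide_distrib[symmetric])
    also have "\<dots> = 0" by (simp add: ax tr)
    finally show "subharmonic_at (v s) z"
      using a by (intro subharmonic_atI[where e = "\<lambda>j. axis j 1" and a = a and b = b]) (auto simp: norm_axis_1)
  qed (use comp opU cv y in auto)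
  have gs: "s * (g x $ i) \<le> ?N * M / R" if s: "s = 1 \<or> s = -1" for s
  proof -
    have "x \<in> S" using subsetD[OF S(2), of x] R by simp
    then have "(u has_derivative (\<lambda>h. g x \<bullet> h)) (at (x + 0 *\<^sub>R ?e))"
      using h unfolding harmonic_with_def by auto
    from has_derivative_along_line[OF this]
    have d: "((\<lambda>t. u (x + t *\<^sub>R ?e)) has_real_derivative g x $ i) (at 0)"
      by (simp add: has_real_derivative_iff_has_vector_derivative inner_axis)
    have d': "((\<lambda>t. u (x + (-t) *\<^sub>R ?e)) has_real_derivative - (g x $ i)) (at 0)"
      using has_derivative_along_line[of u "\<lambda>h. g x \<bullet> h" x 0 "- ?e"] \<open>x \<in> S\<close> h
      by (simp add: has_real_derivative_iff_has_vector_derivative inner_axis harmonic_with_def)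
    define \<phi> where "\<phi> t = s * (u (x + t *\<^sub>R ?e) - u (x + (-t) *\<^sub>R ?e)) / 2 - (M / R\<^sup>2) * (t\<^sup>2 + ?N * (t * (R - t)))" for t
    have "(\<phi> has_real_derivative (s * (g x $ i) - (M / R\<^sup>2) * (?N * R))) (at 0)"
      unfolding \<phi>_def
      by (rule derivative_eq_intros d d' refl | simp)+
    moreover have "\<phi> t \<le> \<phi> 0" if t: "0 < t" "t < R" for t
    proof -
      have "\<sigma> (t *\<^sub>R ?e) = (-t) *\<^sub>R ?e" unfolding \<sigma>_def by (simp add: vec_eq_iff axis_def)
      then have "\<phi> t = v s (t *\<^sub>R ?e)" unfolding \<phi>_def v_def by (simp add: norm_axis_1)
      moreover have "t *\<^sub>R ?e \<in> K" using t by (simp add: K_def norm_axis_1)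
      ultimately show ?thesis using main[OF s] by (simp add: \<phi>_def)
    qed
    ultimately have "s * (g x $ i) - (M / R\<^sup>2) * (?N * R) \<le> 0"
      using DERIV_pos_inc_right[of \<phi> "s * (g x $ i) - (M / R\<^sup>2) * (?N * R)" 0] R
      by (smt (verit) field_sum_of_halves)
    then show ?thesis using R by (simp add: power2_eq_square field_simps)
  qed
  show ?thesis using gs[of 1] gs[of "-1"] by auto
qed

lemma cball_trans:
  fixes x y z :: "'a::metric_space"
  assumes "z \<in> cball y s" "y \<in> cball x r" "r + s \<le> R"
  shows "z \<in> cball x R"
  using assms dist_triangle[of x z y] by simp

lemma harmonic_with_subset: "harmonic_with S u g H \<Longrightarrow> T \<subseteq> S \<Longrightarrow> harmonic_with T u g H"
  unfolding harmonic_with_def by blast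

lemma harmonic_with_diff:
  assumes "harmonic_with S u g H" "harmonic_with S u' g' H'"
  shows "harmonic_with S (\<lambda>x. u x - u' x) (\<lambda>x. g x - g' x) (\<lambda>x. H x - H' x)"
  using assms unfolding harmonic_with_def
  by (auto intro!: derivative_eq_intros simp: inner_diff_left matrix_vector_mult_diff_rdistrib trace_sub)

lemma harmonic_with_cmult:
  fixes u :: "real^'n \<Rightarrow> real"
  assumes "harmonic_with S u g H"
  shows "harmonic_with S (\<lambda>x. c * u x) (\<lambda>x. c *\<^sub>R g x) (\<lambda>x. c *\<^sub>R H x)"
proof -
  have "trace (c *\<^sub>R A) = c * trace A" for A :: "real^'n^'n"
    by (simp add: trace_def sum_distrib_left)
  with assms show ?thesis unfolding harmonic_with_def
    by (auto intro!: derivative_eq_intros simp: scaleR_matrix_vector_assoc[symmetric])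
qed

lemma harmonic_with_translate:
  assumes "harmonic_with S u g H" "\<And>x. x \<in> T \<Longrightarrow> x + a \<in> S"
  shows "harmonic_with T (\<lambda>x. u (x + a)) (\<lambda>x. g (x + a)) (\<lambda>x. H (x + a))"
  unfolding harmonic_with_def
proof (intro ballI conjI)
  fix x assume "x \<in> T"
  then have xa: "x + a \<in> S" using assms(2) by simp
  have sh: "((\<lambda>x. x + a) has_derivative (\<lambda>h. h)) (at x)" by (auto intro!: derivative_eq_intros)
  show "((\<lambda>x. u (x + a)) has_derivative (\<lambda>h. g (x + a) \<bullet> h)) (at x)"
    by (rule has_derivative_compose[OF sh]) (use assms(1) xa in \<open>simp add: harmonic_with_def\<close>)
  show "((\<lambda>x. g (x + a)) has_derivative (\<lambda>h. H (x + a) *v h)) (at x)"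
    by (rule has_derivative_compose[OF sh]) (use assms(1) xa in \<open>simp add: harmonic_with_def\<close>)
  show "trace (H (x + a)) = 0" using assms(1) xa by (simp add: harmonic_with_def)
qed

lemma harmonic_with_gradient_norm_bound:
  fixes u :: "real^'n \<Rightarrow> real" and M R :: real
  assumes h: "harmonic_with S u g H" and S: "open S" "cball x R \<subseteq> S" and R: "R > 0"
    and M: "\<And>y. y \<in> cball x R \<Longrightarrow> \<bar>u y\<bar> \<le> M"
  shows "norm (g x) \<le> (real CARD('n))\<^sup>2 * M / R"
proof -
  have "norm (g x) \<le> (\<Sum>i\<in>UNIV. \<bar>g x $ i\<bar>)" by (rule norm_le_l1_cart)
  also have "\<dots> \<le> (\<Sum>i\<in>(UNIV::'n set). CARD('n) * M / R)"
    by (intro sum_mono harmonic_with_gradient_bound[OF assms])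
  finally show ?thesis by (simp add: power2_eq_square mult.assoc)
qed

text \<open>The gradient bound is applied to \<open>u\<close> and then to its difference quotients, which are harmonic; the directional
  derivatives themselves are not yet known to be.\<close>

lemma harmonic_with_hessian_bound:
  fixes u :: "real^'n \<Rightarrow> real" and M R :: real
  assumes h: "harmonic_with S u g H" and S: "open S" "cball x R \<subseteq> S" and R: "R > 0"
    and M: "\<And>y. y \<in> cball x R \<Longrightarrow> \<bar>u y\<bar> \<le> M"
  shows "norm (H x *v e) \<le> 8 * (real CARD('n))^4 * M / R\<^sup>2 * norm e"
proof (cases "e = 0")
  case True then show ?thesis by simp
next
  case e: False
  let ?N = "real CARD('n)"
  have gb: "norm (g y) \<le> ?N\<^sup>2 * M / (R/2)" if y: "y \<in> cball x (R/2)" for y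
  proof (rule harmonic_with_gradient_norm_bound[OF h S(1)])
    have sub: "cball y (R/2) \<subseteq> cball x R" by (rule subsetI, rule cball_trans[of _ y "R/2" x "R/2" R]) (use y in simp_all)
    then show "cball y (R/2) \<subseteq> S" using S by blast
    show "\<bar>u z\<bar> \<le> M" if "z \<in> cball y (R/2)" for z using M sub that by blast
  qed (use R in auto)
  have est: "norm ((g (x + k *\<^sub>R e) - g x) /\<^sub>R k) \<le> 8 * ?N^4 * M / R\<^sup>2 * norm e"
    if k: "k \<noteq> 0" "\<bar>k\<bar> * norm e \<le> R / 4" for k
  proof -
    define T where "T = S \<inter> {y. y + k *\<^sub>R e \<in> S}"
    have opT: "open T" unfolding T_def using S(1)
      by (intro open_Int open_vimage[of S "\<lambda>y. y + k *\<^sub>R e", unfolded vimage_def] continuous_intros)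
    have "harmonic_with T (\<lambda>y. u (y + k *\<^sub>R e) - u y) (\<lambda>y. g (y + k *\<^sub>R e) - g y) (\<lambda>y. H (y + k *\<^sub>R e) - H y)"
      by (rule harmonic_with_diff[OF harmonic_with_translate[OF h] harmonic_with_subset[OF h]]) (auto simp: T_def)
    then have hk: "harmonic_with T (\<lambda>y. (1/k) * (u (y + k *\<^sub>R e) - u y)) (\<lambda>y. (1/k) *\<^sub>R (g (y + k *\<^sub>R e) - g y)) (\<lambda>y. (1/k) *\<^sub>R (H (y + k *\<^sub>R e) - H y))"
      by (rule harmonic_with_cmult)
    have inn: "y + k *\<^sub>R e \<in> cball x (R/2)" "y \<in> cball x (R/2)" if "y \<in> cball x (R/4)" for y
    proof -
      have "norm (k *\<^sub>R e) \<le> R/4" using k by simp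
      then have "y + k *\<^sub>R e \<in> cball y (R/4)" by (simp add: dist_norm)
      show "y + k *\<^sub>R e \<in> cball x (R/2)"
        by (rule cball_trans[OF \<open>y + k *\<^sub>R e \<in> cball y (R/4)\<close> that]) simp
      show "y \<in> cball x (R/2)" using that R by simp
    qed
    have "norm ((1/k) *\<^sub>R (g (x + k *\<^sub>R e) - g x)) \<le> ?N\<^sup>2 * (?N\<^sup>2 * M / (R/2) * norm e) / (R/4)"
    proof (rule harmonic_with_gradient_norm_bound[OF hk opT])
      have "cball x (R/2) \<subseteq> S" using S(2) R by (auto simp: subset_iff)
      then show "cball x (R/4) \<subseteq> T" using inn unfolding T_def by blast
      fix y assume y: "y \<in> cball x (R/4)"
      have "norm (u (y + k *\<^sub>R e) - u y) \<le> ?N\<^sup>2 * M / (R/2) * norm ((y + k *\<^sub>R e) - y)"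
      proof (rule differentiable_bound[where S = "cball x (R/2)" and f' = "\<lambda>y h. g y \<bullet> h"])
        fix z assume z: "z \<in> cball x (R/2)"
        then have "z \<in> S" using S R by auto
        then show "(u has_derivative (\<bullet>) (g z)) (at z within cball x (R/2))"
          using h unfolding harmonic_with_def by (auto intro: has_derivative_at_withinI)
        show "onorm ((\<bullet>) (g z)) \<le> ?N\<^sup>2 * M / (R/2)"
        proof (rule onorm_le)
          fix h
          have "\<bar>g z \<bullet> h\<bar> \<le> norm (g z) * norm h" by (rule Cauchy_Schwarz_ineq2)
          also have "\<dots> \<le> ?N\<^sup>2 * M / (R/2) * norm h" by (intro mult_right_mono gb z) simp
          finally show "norm (g z \<bullet> h) \<le> ?N\<^sup>2 * M / (R/2) * norm h" by simp
        qed
      qed (use inn[OF y] in auto)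
      then have "\<bar>u (y + k *\<^sub>R e) - u y\<bar> \<le> ?N\<^sup>2 * M / (R/2) * (\<bar>k\<bar> * norm e)" by simp
      then have *: "\<bar>u (y + k *\<^sub>R e) - u y\<bar> \<le> (?N\<^sup>2 * M / (R/2) * norm e) * \<bar>k\<bar>"
        by (simp only: mult_ac)
      have "\<bar>1 / k * (u (y + k *\<^sub>R e) - u y)\<bar> = \<bar>u (y + k *\<^sub>R e) - u y\<bar> / \<bar>k\<bar>"
        by (simp add: abs_mult)
      also have "\<dots> \<le> ?N\<^sup>2 * M / (R/2) * norm e"
        using * k by (subst pos_divide_le_eq) auto
      finally show "\<bar>1 / k * (u (y + k *\<^sub>R e) - u y)\<bar> \<le> ?N\<^sup>2 * M / (R/2) * norm e" .
    qed (use R in auto)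
    also have "?N\<^sup>2 * (?N\<^sup>2 * M / (R/2) * norm e) / (R/4) = 8 * ?N^4 * M / R\<^sup>2 * norm e"
      using R by (simp add: field_simps power2_eq_square power4_eq_xxxx)
    finally show ?thesis by (simp add: inverse_eq_divide)
  qed
  have "x \<in> S" using subsetD[OF S(2), of x] R by simp
  then have "(g has_derivative (\<lambda>h. H x *v h)) (at (x + 0 *\<^sub>R e))"
    using h unfolding harmonic_with_def by auto
  from has_derivative_along_line[OF this]
  have lim: "((\<lambda>k. (g (x + k *\<^sub>R e) - g x) /\<^sub>R k) \<longlongrightarrow> H x *v e) (at 0)"
    using has_vector_derivative_quotient_limit[of "\<lambda>k. g (x + k *\<^sub>R e)"] by simp
  show ?thesis
  proof (rule tendsto_upperbound[OF tendsto_norm[OF lim]])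
    have "\<forall>\<^sub>F k in at (0::real). \<bar>k\<bar> < R / (4 * norm e) \<and> k \<noteq> 0"
      unfolding eventually_at using R e by (intro exI[of _ "R / (4 * norm e)"]) (auto simp: dist_real_def)
    then show "\<forall>\<^sub>F k in at 0. norm ((g (x + k *\<^sub>R e) - g x) /\<^sub>R k) \<le> 8 * ?N^4 * M / R\<^sup>2 * norm e"
    proof eventually_elim
      case (elim k)
      then show ?case using e by (intro est) (auto simp: field_simps)
    qed
  qed auto
qed

lemma has_derivative_limit:
  fixes F :: "nat \<Rightarrow> 'a::real_normed_vector \<Rightarrow> 'b::banach"
  assumes T: "open T" "convex T" "x \<in> T"
    and F: "\<And>n y. y \<in> T \<Longrightarrow> (F n has_derivative F' n y) (at y)"
    and C: "\<And>e. e > 0 \<Longrightarrow> \<forall>\<^sub>F m in sequentially. \<forall>n\<ge>m. \<forall>y\<in>T. \<forall>h. norm (F' m y h - F' n y h) \<le> e * norm h"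
    and L: "\<And>y. y \<in> T \<Longrightarrow> (\<lambda>n. F n y) \<longlonglongrightarrow> F0 y" "\<And>y h. y \<in> T \<Longrightarrow> (\<lambda>n. F' n y h) \<longlonglongrightarrow> G y h"
  shows "(F0 has_derivative G x) (at x)"
proof -
  have "\<exists>g. \<forall>y\<in>T. (\<lambda>n. F n y) \<longlonglongrightarrow> g y \<and> (g has_derivative G y) (at y within T)"
  proof (rule has_derivative_sequence[where ?x0.0 = x and l = "F0 x" and f' = F'])
    show "(F n has_derivative F' n y) (at y within T)" if "y \<in> T" for n y
      using F[OF that] by (rule has_derivative_at_withinI)
    fix e :: real assume "e > 0"
    from C[OF this] show "\<forall>\<^sub>F m in sequentially. \<forall>y\<in>T. \<forall>h. norm (F' m y h - G y h) \<le> e * norm h"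
    proof (eventually_elim, intro ballI allI)
      fix m y h assume a: "\<forall>n\<ge>m. \<forall>y\<in>T. \<forall>h. norm (F' m y h - F' n y h) \<le> e * norm h" and y: "y \<in> T"
      have "(\<lambda>n. norm (F' m y h - F' n y h)) \<longlonglongrightarrow> norm (F' m y h - G y h)"
        using y by (intro tendsto_intros L)
      then show "norm (F' m y h - G y h) \<le> e * norm h"
        by (rule tendsto_upperbound) (use a y in \<open>auto intro!: eventually_mono[OF eventually_ge_at_top[of m]]\<close>)
    qed
  qed (use T L in auto)
  then obtain g where g: "\<And>y. y \<in> T \<Longrightarrow> (\<lambda>n. F n y) \<longlonglongrightarrow> g y" "(g has_derivative G x) (at x within T)"
    using T(3) by blast
  have "(g has_derivative G x) (at x)" using g(2) at_within_open[OF T(3,1)] by simp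
  then show ?thesis
    by (rule has_derivative_transform_within_open[OF _ T(1,3)]) (use g(1) L(1) LIMSEQ_unique in blast)
qed

text \<open>The gradient and Hessian bounds for differences \<open>u\<^sub>m - u\<^sub>n\<close> make both sequences of derivatives locally uniformly
  Cauchy.\<close>

lemma harmonic_uniform_limit:
  fixes S :: "(real^'n) set"
  assumes S: "open S" and h: "\<And>m. harmonic_with S (u m) (g m) (H m)" and lim: "uniform_limit S u v sequentially"
  shows "\<exists>g' H'. harmonic_with S v g' H' \<and> (\<forall>x\<in>S. (\<lambda>m. g m x) \<longlonglongrightarrow> g' x)"
proof -
  let ?N = "real CARD('n)"
  have cauchy: "\<forall>\<^sub>F m in sequentially. \<forall>n\<ge>m. \<forall>x\<in>S. \<bar>u m x - u n x\<bar> \<le> e" if e: "e > 0" for e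
  proof -
    have "\<forall>\<^sub>F m in sequentially. \<forall>x\<in>S. dist (u m x) (v x) < e/2"
      by (rule uniform_limitD[OF lim]) (use e in simp)
    then obtain n0 where "\<And>m x. m \<ge> n0 \<Longrightarrow> x \<in> S \<Longrightarrow> dist (u m x) (v x) < e/2"
      unfolding eventually_sequentially by blast
    then have *: "\<bar>u m x - u n x\<bar> \<le> e" if "n0 \<le> m" "m \<le> n" "x \<in> S" for m n x
    proof -
      have "dist (u m x) (v x) < e/2" "dist (u n x) (v x) < e/2"
        using \<open>\<And>m x. m \<ge> n0 \<Longrightarrow> x \<in> S \<Longrightarrow> dist (u m x) (v x) < e/2\<close> that by auto
      then show ?thesis unfolding dist_real_def by linarith
    qed
    show ?thesis unfolding eventually_sequentially
      by (intro exI[of _ n0] allI impI ballI *)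
  qed
  have hd: "harmonic_with S (\<lambda>x. u m x - u n x) (\<lambda>x. g m x - g n x) (\<lambda>x. H m x - H n x)" for m n
    by (rule harmonic_with_diff[OF h h])
  have near: "\<exists>R>0. \<forall>y\<in>ball x R. cball y R \<subseteq> S" if x: "x \<in> S" for x
  proof -
    obtain R where "R > 0" "cball x R \<subseteq> S" using S x open_contains_cball by blast
    moreover have "cball y (R/2) \<subseteq> cball x R" if "y \<in> ball x (R/2)" for y
      by (rule subsetI, rule cball_trans[of _ y "R/2" x "R/2" R]) (use that in simp_all)
    ultimately show ?thesis by (intro exI[of _ "R/2"] conjI ballI) (simp, meson order_trans)
  qed
  have gC: "\<forall>\<^sub>F m in sequentially. \<forall>n\<ge>m. \<forall>y\<in>ball x R. norm (g m y - g n y) \<le> e"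
    if R: "R > 0" "\<forall>y\<in>ball x R. cball y R \<subseteq> S" and e: "e > 0" for x R e
  proof -
    have N: "?N > 0" by simp
    have "\<forall>\<^sub>F m in sequentially. \<forall>n\<ge>m. \<forall>x\<in>S. \<bar>u m x - u n x\<bar> \<le> e * R / ?N\<^sup>2"
      by (rule cauchy) (use e R in auto)
    then show ?thesis
    proof (eventually_elim, intro allI impI ballI)
      fix m n y assume a: "\<forall>n\<ge>m. \<forall>x\<in>S. \<bar>u m x - u n x\<bar> \<le> e * R / ?N\<^sup>2" "m \<le> n" "y \<in> ball x R"
      have yS: "cball y R \<subseteq> S" using R(2) a(3) by blast
      have "norm (g m y - g n y) \<le> ?N\<^sup>2 * (e * R / ?N\<^sup>2) / R"
        by (rule harmonic_with_gradient_norm_bound[OF hd S]) (use yS a R in \<open>auto simp: subset_iff\<close>)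
      then show "norm (g m y - g n y) \<le> e" using R by simp
    qed
  qed
  have HC: "\<forall>\<^sub>F m in sequentially. \<forall>n\<ge>m. \<forall>y\<in>ball x R. \<forall>h. norm ((H m y - H n y) *v h) \<le> e * norm h"
    if R: "R > 0" "\<forall>y\<in>ball x R. cball y R \<subseteq> S" and e: "e > 0" for x R e
  proof -
    have "\<forall>\<^sub>F m in sequentially. \<forall>n\<ge>m. \<forall>x\<in>S. \<bar>u m x - u n x\<bar> \<le> e * R\<^sup>2 / (8 * ?N^4)"
      by (rule cauchy) (use e R in auto)
    then show ?thesis
    proof (eventually_elim, intro allI impI ballI)
      fix m n y h assume a: "\<forall>n\<ge>m. \<forall>x\<in>S. \<bar>u m x - u n x\<bar> \<le> e * R\<^sup>2 / (8 * ?N^4)" "m \<le> n" "y \<in> ball x R"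
      have yS: "cball y R \<subseteq> S" using R(2) a(3) by blast
      have "norm ((H m y - H n y) *v h) \<le> 8 * ?N^4 * (e * R\<^sup>2 / (8 * ?N^4)) / R\<^sup>2 * norm h"
        by (rule harmonic_with_hessian_bound[OF hd S]) (use yS a R in \<open>auto simp: subset_iff\<close>)
      then show "norm ((H m y - H n y) *v h) \<le> e * norm h" using R by simp
    qed
  qed
  define g' where "g' x = lim (\<lambda>m. g m x)" for x
  define L where "L x h = lim (\<lambda>m. H m x *v h)" for x h
  have conv: "X \<longlonglongrightarrow> lim X"
    if CC: "\<And>e. e > 0 \<Longrightarrow> \<forall>\<^sub>F m in sequentially. \<forall>n\<ge>m. norm (X m - X n) \<le> e * C" and C: "C \<ge> 0"
    for X :: "nat \<Rightarrow> real^'n" and C :: real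
  proof -
    have "Cauchy X"
    proof (rule metric_CauchyI)
      fix e :: real assume e: "e > 0"
      define e' where "e' = e / (4 * (C + 1))"
      have e': "e' > 0" "e' * C < e / 2" using e C by (auto simp: e'_def field_simps intro: add_pos_nonneg)
      then obtain n0 where n0: "\<And>n. n \<ge> n0 \<Longrightarrow> dist (X n0) (X n) \<le> e' * C"
        using CC[OF e'(1)] unfolding eventually_sequentially dist_norm by auto
      have "dist (X m) (X n) < e" if "m \<ge> n0" "n \<ge> n0" for m n
        using n0[OF that(1)] n0[OF that(2)] e'(2) dist_triangle3[of "X m" "X n" "X n0"] by linarith
      then show "\<exists>M. \<forall>m\<ge>M. \<forall>n\<ge>M. dist (X m) (X n) < e" by blast
    qed
    then show ?thesis by (simp add: Cauchy_convergent_iff convergent_LIMSEQ_iff)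
  qed
  have glim: "(\<lambda>m. g m x) \<longlonglongrightarrow> g' x" if x: "x \<in> S" for x
  proof -
    obtain R where R: "R > 0" "\<forall>y\<in>ball x R. cball y R \<subseteq> S" using near[OF x] by blast
    show ?thesis unfolding g'_def
    proof (rule conv[where C = 1])
      fix e :: real assume "e > 0"
      from gC[OF R this] show "\<forall>\<^sub>F m in sequentially. \<forall>n\<ge>m. norm (g m x - g n x) \<le> e * 1"
        by eventually_elim (use R in auto)
    qed simp
  qed
  have Hlim: "(\<lambda>m. H m x *v k) \<longlonglongrightarrow> L x k" if x: "x \<in> S" for x k
  proof -
    obtain R where R: "R > 0" "\<forall>y\<in>ball x R. cball y R \<subseteq> S" using near[OF x] by blast
    show ?thesis unfolding L_def
    proof (rule conv[where C = "norm k"])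
      fix e :: real assume "e > 0"
      from HC[OF R this] show "\<forall>\<^sub>F m in sequentially. \<forall>n\<ge>m. norm (H m x *v k - H n x *v k) \<le> e * norm k"
        by eventually_elim (use R in \<open>auto simp: matrix_vector_mult_diff_rdistrib\<close>)
    qed simp
  qed
  have vlim: "(\<lambda>m. u m x) \<longlonglongrightarrow> v x" if "x \<in> S" for x
    using tendsto_uniform_limitI[OF lim that] .
  define H' where "H' x = (\<chi> i j. L x (axis j 1) $ i)" for x
  have linL: "linear (L x)" if x: "x \<in> S" for x
  proof (rule linearI)
    show "L x (a + b) = L x a + L x b" for a b
      by (rule LIMSEQ_unique[OF Hlim[OF x]]) (auto simp: matrix_vector_right_distrib intro!: tendsto_add Hlim x)
    show "L x (c *\<^sub>R a) = c *\<^sub>R L x a" for c a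
      by (rule LIMSEQ_unique[OF Hlim[OF x]]) (auto simp: matrix_vector_mult_scaleR intro!: tendsto_scaleR Hlim x)
  qed
  have L_eq: "L x h = H' x *v h" if x: "x \<in> S" for x h
    using matrix_works[OF linL[OF x, unfolded linear_matrix_vector_mul_eq[symmetric]]]
    by (simp add: matrix_def H'_def)
  have "harmonic_with S v g' H'" unfolding harmonic_with_def
  proof (intro ballI conjI)
    fix x assume x: "x \<in> S"
    obtain R where R: "R > 0" "\<forall>y\<in>ball x R. cball y R \<subseteq> S" using near[OF x] by blast
    have bS: "ball x R \<subseteq> S" using R by force
    have xR: "x \<in> ball x R" using R(1) by simp
    show "(v has_derivative (\<lambda>h. g' x \<bullet> h)) (at x)"
    proof (rule has_derivative_limit[OF open_ball convex_ball xR, where F = u and F' = "\<lambda>n y h. g n y \<bullet> h"])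
      fix e :: real assume "e > 0"
      from gC[OF R this] show "\<forall>\<^sub>F m in sequentially. \<forall>n\<ge>m. \<forall>y\<in>ball x R. \<forall>h. norm (g m y \<bullet> h - g n y \<bullet> h) \<le> e * norm h"
      proof (eventually_elim, intro ballI allI impI)
        fix m n and y h :: "real^'n" assume "\<forall>n\<ge>m. \<forall>y\<in>ball x R. norm (g m y - g n y) \<le> e" "n \<ge> m" "y \<in> ball x R"
        then have "norm (g m y - g n y) * norm h \<le> e * norm h" by (intro mult_right_mono) auto
        then show "norm (g m y \<bullet> h - g n y \<bullet> h) \<le> e * norm h"
          using Cauchy_Schwarz_ineq2[of "g m y - g n y" h] by (simp add: inner_diff_left)
      qed
    qed (use h bS vlim glim in \<open>auto simp: harmonic_with_def intro!: tendsto_intros\<close>)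
    show "(g' has_derivative (\<lambda>h. H' x *v h)) (at x)"
    proof (rule has_derivative_limit[OF open_ball convex_ball xR, where F = g and F' = "\<lambda>n y h. H n y *v h"])
      show "(\<lambda>n. H n y *v h) \<longlonglongrightarrow> H' y *v h" if "y \<in> ball x R" for y h
        using Hlim[of y h] L_eq[of y h] that bS by auto
    qed (use h bS glim HC[OF R] in \<open>auto simp: harmonic_with_def matrix_vector_mult_diff_rdistrib\<close>)
    have "(\<lambda>m. trace (H m x)) \<longlonglongrightarrow> trace (H' x)" unfolding trace_eq_sum_axis L_eq[OF x, symmetric]
      by (intro tendsto_intros Hlim x)
    moreover have "(\<lambda>m. trace (H m x)) = (\<lambda>_. 0)" using h x unfolding harmonic_with_def by auto
    ultimately show "trace (H' x) = 0" by (simp add: LIMSEQ_const_iff)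
  qed
  with glim show ?thesis by blast
qed

section \<open>Smoothness of harmonic functions\<close>

lemma harmonic_with_cong:
  assumes "harmonic_with S u g H" "open S" "\<And>x. x \<in> S \<Longrightarrow> u x = u' x" "\<And>x. x \<in> S \<Longrightarrow> g x = g' x" "\<And>x. x \<in> S \<Longrightarrow> H x = H' x"
  shows "harmonic_with S u' g' H'"
  unfolding harmonic_with_def
proof (intro ballI conjI)
  fix x assume x: "x \<in> S"
  have *: "(u has_derivative (\<lambda>h. g x \<bullet> h)) (at x)" "(g has_derivative (\<lambda>h. H x *v h)) (at x)" "trace (H x) = 0"
    using assms(1) x unfolding harmonic_with_def by auto
  show "(u' has_derivative (\<lambda>h. g' x \<bullet> h)) (at x)"
    using has_derivative_transform_within_open[OF *(1) assms(2) x assms(3)] assms(4)[OF x] by simp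
  show "(g' has_derivative (\<lambda>h. H' x *v h)) (at x)"
    using has_derivative_transform_within_open[OF *(2) assms(2) x assms(4)] assms(5)[OF x] by simp
  show "trace (H' x) = 0" using *(3) assms(5)[OF x] by simp
qed

lemma harmonic_with_continuous_on: "harmonic_with S u g H \<Longrightarrow> continuous_on S u"
  unfolding harmonic_with_def by (meson has_derivative_continuous continuous_at_imp_continuous_on)

text \<open>Difference quotients in direction \<open>e\<close> are harmonic and converge locally uniformly to the directional derivative,
  so the limit is harmonic. The limit of their gradients is \<open>H x *v e\<close>, whereas differentiating \<open>g y \<bullet> e\<close> directly
  gives the transpose of \<open>H x\<close> applied to \<open>e\<close>; symmetry of the Hessian is a by-product.\<close>

lemma directional_derivative_harmonic_at:
  fixes u :: "real^'n \<Rightarrow> real"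
  assumes S: "open S" and h: "harmonic_with S u g H" and x: "x \<in> S"
  shows "\<exists>A. ((\<lambda>y. g y \<bullet> e) has_derivative (\<lambda>k. (H x *v e) \<bullet> k)) (at x) \<and>
     ((\<lambda>y. H y *v e) has_derivative (\<lambda>k. A *v k)) (at x) \<and> trace A = 0"
proof -
  let ?N = "real CARD('n)"
  obtain R0 where R0: "R0 > 0" "cball x R0 \<subseteq> S" using S x open_contains_cball by blast
  define R where "R = R0 / 3"
  have R: "R > 0" "cball x (3 * R) \<subseteq> S" using R0 by (auto simp: R_def)
  define r where "r = R / (1 + norm e)"
  have r: "r > 0" "r * norm e \<le> R" using R by (auto simp: r_def add_pos_nonneg field_simps)
  have "continuous_on (cball x (3 * R)) u" using harmonic_with_continuous_on[OF h] R(2) continuous_on_subset by blast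
  then have "bounded (u ` cball x (3 * R))" by (intro compact_imp_bounded compact_continuous_image compact_cball)
  then obtain M where "\<forall>y\<in>u ` cball x (3 * R). norm y \<le> M" unfolding bounded_iff by blast
  then have M: "\<bar>u y\<bar> \<le> M" if "y \<in> cball x (3 * R)" for y using that by auto
  define B where "B = 8 * ?N^4 * M / R\<^sup>2 * norm e"
  have Hb: "norm (H z *v e) \<le> B" if z: "z \<in> cball x (2 * R)" for z
    unfolding B_def
  proof (rule harmonic_with_hessian_bound[OF h S])
    have sub: "cball z R \<subseteq> cball x (3 * R)"
      by (rule subsetI, rule cball_trans[of _ z R x "2 * R"]) (use z in simp_all)
    then show "cball z R \<subseteq> S" using R by blast
    show "\<bar>u w\<bar> \<le> M" if "w \<in> cball z R" for w using sub that M by blast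
  qed (use R in auto)
  let ?T = "ball x R"
  have inn: "y + k *\<^sub>R e \<in> cball x (2 * R)" if y: "y \<in> ?T" and k: "0 \<le> k" "k \<le> r" for y k
  proof (rule cball_trans)
    have "k * norm e \<le> r * norm e" using k by (intro mult_right_mono) auto
    then show "y + k *\<^sub>R e \<in> cball y R" using r k by (simp add: dist_norm)
    show "y \<in> cball x R" using y by simp
  qed simp
  have c2S: "cball x (2 * R) \<subseteq> S" using R by (auto simp: subset_iff)
  \<comment> \<open>Step sizes scaled by \<open>r\<close> keep the translated ball inside \<open>S\<close> for every \<open>m\<close>.\<close>
  define k where "k m = r / real (Suc m)" for m
  have k: "k m > 0" "k m \<le> r" for m using r by (auto simp: k_def field_simps)
  have k0: "k \<longlonglongrightarrow> 0" unfolding k_def by (rule lim_const_over_n[THEN LIMSEQ_Suc])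
  define q where "q m y = (1 / k m) * (u (y + k m *\<^sub>R e) - u y)" for m y
  have hq: "harmonic_with ?T (q m) (\<lambda>y. (1 / k m) *\<^sub>R (g (y + k m *\<^sub>R e) - g y)) (\<lambda>y. (1 / k m) *\<^sub>R (H (y + k m *\<^sub>R e) - H y))" for m
    unfolding q_def
  proof (rule harmonic_with_cmult[OF harmonic_with_diff[OF harmonic_with_translate[OF h] harmonic_with_subset[OF h]]])
    show "y + k m *\<^sub>R e \<in> S" if "y \<in> ?T" for y using inn[OF that, of "k m"] k[of m] c2S by auto
    show "?T \<subseteq> S" using R by (auto simp: subset_iff)
  qed
  have quot: "\<bar>q m y - g y \<bullet> e\<bar> \<le> k m * (B * norm e)" if y: "y \<in> ?T" for m y
  proof -
    have lin: "y + t *\<^sub>R e \<in> S" if "0 \<le> t" "t \<le> k m" for t using inn[OF y, of t] that k[of m] c2S by auto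
    have d1: "((\<lambda>t. u (y + t *\<^sub>R e)) has_real_derivative g (y + t *\<^sub>R e) \<bullet> e) (at t)" if "0 \<le> t" "t \<le> k m" for t
      using has_derivative_along_line[of u _ y t e] h lin[OF that] unfolding harmonic_with_def
      by (auto simp: has_real_derivative_iff_has_vector_derivative)
    have d2: "((\<lambda>t. g (y + t *\<^sub>R e) \<bullet> e) has_real_derivative (H (y + t *\<^sub>R e) *v e) \<bullet> e) (at t)" if "0 \<le> t" "t \<le> k m" for t
    proof -
      have "(g has_derivative (\<lambda>h. H (y + t *\<^sub>R e) *v h)) (at (y + t *\<^sub>R e))"
        using h lin[OF that] unfolding harmonic_with_def by auto
      from bounded_linear.has_vector_derivative[OF bounded_linear_inner_left has_derivative_along_line[OF this], of e]
      show ?thesis by (simp add: has_real_derivative_iff_has_vector_derivative)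
    qed
    obtain s where s: "0 < s" "s < k m" "u (y + k m *\<^sub>R e) - u (y + 0 *\<^sub>R e) = (k m - 0) * (g (y + s *\<^sub>R e) \<bullet> e)"
      using MVT2[of 0 "k m" "\<lambda>t. u (y + t *\<^sub>R e)" "\<lambda>t. g (y + t *\<^sub>R e) \<bullet> e"] d1 k[of m] by auto
    obtain s' where s': "0 < s'" "s' < s" "g (y + s *\<^sub>R e) \<bullet> e - g (y + 0 *\<^sub>R e) \<bullet> e = (s - 0) * ((H (y + s' *\<^sub>R e) *v e) \<bullet> e)"
      using MVT2[of 0 s "\<lambda>t. g (y + t *\<^sub>R e) \<bullet> e" "\<lambda>t. (H (y + t *\<^sub>R e) *v e) \<bullet> e"] d2 s by auto
    have "q m y = g (y + s *\<^sub>R e) \<bullet> e" using s k[of m] by (simp add: q_def)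
    then have "q m y - g y \<bullet> e = s * ((H (y + s' *\<^sub>R e) *v e) \<bullet> e)" using s' by simp
    then have "\<bar>q m y - g y \<bullet> e\<bar> = s * \<bar>(H (y + s' *\<^sub>R e) *v e) \<bullet> e\<bar>" using s by (simp add: abs_mult)
    also have "\<dots> \<le> s * (norm (H (y + s' *\<^sub>R e) *v e) * norm e)"
      using s by (intro mult_left_mono Cauchy_Schwarz_ineq2) auto
    also have "\<dots> \<le> k m * (B * norm e)"
      using s s' Hb[OF inn[OF y, of s']] k[of m] by (intro mult_mono mult_right_mono mult_nonneg_nonneg) auto
    finally show ?thesis .
  qed
  have ul: "uniform_limit ?T q (\<lambda>y. g y \<bullet> e) sequentially"
    unfolding uniform_limit_iff
  proof (intro allI impI)
    fix \<epsilon> :: real assume "\<epsilon> > 0"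
    have "(\<lambda>m. k m * (B * norm e)) \<longlonglongrightarrow> 0" using tendsto_mult_left_zero[OF k0] .
    then have "\<forall>\<^sub>F m in sequentially. k m * (B * norm e) < \<epsilon>" using \<open>\<epsilon> > 0\<close> by (rule order_tendstoD)
    then show "\<forall>\<^sub>F m in sequentially. \<forall>y\<in>?T. dist (q m y) (g y \<bullet> e) < \<epsilon>"
      unfolding dist_real_def by eventually_elim (blast intro: le_less_trans quot)
  qed
  obtain g' H' where
     g': "harmonic_with ?T (\<lambda>y. g y \<bullet> e) g' H'" "\<And>y. y \<in> ?T \<Longrightarrow> (\<lambda>m. (1 / k m) *\<^sub>R (g (y + k m *\<^sub>R e) - g y)) \<longlonglongrightarrow> g' y"
    using harmonic_uniform_limit[OF open_ball hq ul] by blast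
  have g'_eq: "g' y = H y *v e" if y: "y \<in> ?T" for y
  proof (rule LIMSEQ_unique[OF g'(2)[OF y]])
    have "y \<in> S" using y R by auto
    then have "(g has_derivative (\<lambda>h. H y *v h)) (at (y + 0 *\<^sub>R e))"
      using h unfolding harmonic_with_def by auto
    from has_vector_derivative_quotient_limit[OF has_derivative_along_line[OF this]]
    have "((\<lambda>k. (g (y + k *\<^sub>R e) - g y) /\<^sub>R k) \<longlongrightarrow> H y *v e) (at 0)" by simp
    moreover have "filterlim k (at 0) sequentially"
      unfolding filterlim_at using k0 k by (auto intro!: always_eventually simp: less_imp_neq[THEN not_sym])
    ultimately have "(\<lambda>m. (g (y + k m *\<^sub>R e) - g y) /\<^sub>R k m) \<longlonglongrightarrow> H y *v e"
      by (rule filterlim_compose)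
    then show "(\<lambda>m. (1 / k m) *\<^sub>R (g (y + k m *\<^sub>R e) - g y)) \<longlonglongrightarrow> H y *v e"
      by (simp add: inverse_eq_divide)
  qed
  have "harmonic_with ?T (\<lambda>y. g y \<bullet> e) (\<lambda>y. H y *v e) H'"
    by (rule harmonic_with_cong[OF g'(1)]) (auto simp: g'_eq)
  then show ?thesis unfolding harmonic_with_def using R by (intro exI[of _ "H' x"]) auto
qed

lemma directional_derivative_harmonic:
  fixes u :: "real^'n \<Rightarrow> real"
  assumes S: "open S" and h: "harmonic_with S u g H"
  shows "\<exists>A. harmonic_with S (\<lambda>y. g y \<bullet> e) (\<lambda>y. H y *v e) A"
proof -
  have "\<forall>x\<in>S. \<exists>A. ((\<lambda>y. g y \<bullet> e) has_derivative (\<lambda>k. (H x *v e) \<bullet> k)) (at x) \<and>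
     ((\<lambda>y. H y *v e) has_derivative (\<lambda>k. A *v k)) (at x) \<and> trace A = 0"
    using directional_derivative_harmonic_at[OF S h] by blast
  from bchoice[OF this] obtain A where "\<forall>x\<in>S. ((\<lambda>y. g y \<bullet> e) has_derivative (\<lambda>k. (H x *v e) \<bullet> k)) (at x) \<and>
     ((\<lambda>y. H y *v e) has_derivative (\<lambda>k. A x *v k)) (at x) \<and> trace (A x) = 0" ..
  then show ?thesis unfolding harmonic_with_def by (intro exI[of _ A]) auto
qed

text \<open>The direction comes first, so that \<open>dd e ^^ n\<close> is the iterated directional derivative.\<close>

definition dd :: "'a::real_normed_vector \<Rightarrow> ('a \<Rightarrow> real) \<Rightarrow> 'a \<Rightarrow> real" where
  "dd e u x = frechet_derivative u (at x) e"

definition harmonic :: "(real^'n) set \<Rightarrow> (real^'n \<Rightarrow> real) \<Rightarrow> bool" where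
  "harmonic S u \<longleftrightarrow> (\<exists>g H. harmonic_with S u g H)"

lemma harmonic_with_dd_eq: "harmonic_with S u g H \<Longrightarrow> x \<in> S \<Longrightarrow> dd e u x = g x \<bullet> e"
  unfolding dd_def harmonic_with_def using frechet_derivative_at by metis

lemma harmonic_with_dd:
  assumes "harmonic_with S u g H" "open S"
  shows "\<exists>A. harmonic_with S (dd e u) (\<lambda>y. H y *v e) A"
proof -
  obtain A where A: "harmonic_with S (\<lambda>y. g y \<bullet> e) (\<lambda>y. H y *v e) A" using directional_derivative_harmonic[OF assms(2,1)] by blast
  have "harmonic_with S (dd e u) (\<lambda>y. H y *v e) A"
    by (rule harmonic_with_cong[OF A assms(2)]) (auto simp: harmonic_with_dd_eq[OF assms(1)])
  then show ?thesis by blast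
qed

lemma harmonic_dd: "open S \<Longrightarrow> harmonic S u \<Longrightarrow> harmonic S (dd e u)"
  unfolding harmonic_def using harmonic_with_dd by blast

lemma harmonic_with_dd_dd_eq: "harmonic_with S u g H \<Longrightarrow> open S \<Longrightarrow> x \<in> S \<Longrightarrow> dd d (dd e u) x = (H x *v e) \<bullet> d"
  using harmonic_with_dd[of S u g H e] harmonic_with_dd_eq by blast

lemma harmonic_with_hessian_symmetric:
  assumes "harmonic_with S u g H" "open S" "x \<in> S"
  shows "(H x *v e) \<bullet> d = (H x *v d) \<bullet> e"
proof -
  obtain A where A: "harmonic_with S (dd e u) (\<lambda>y. H y *v e) A" using harmonic_with_dd[OF assms(1,2)] by blast
  have "(g has_derivative (\<lambda>h. H x *v h)) (at x)" using assms unfolding harmonic_with_def by auto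
  then have "((\<lambda>y. g y \<bullet> e) has_derivative (\<lambda>h. (H x *v h) \<bullet> e)) (at x)"
    by (rule has_derivative_inner_left)
  then have "(dd e u has_derivative (\<lambda>h. (H x *v h) \<bullet> e)) (at x)"
    by (rule has_derivative_transform_within_open[OF _ assms(2,3)]) (simp add: harmonic_with_dd_eq[OF assms(1)])
  moreover have "(dd e u has_derivative (\<lambda>h. (H x *v e) \<bullet> h)) (at x)"
    using A assms(3) unfolding harmonic_with_def by auto
  ultimately show ?thesis using has_derivative_unique by metis
qed

lemma dd_commute: "harmonic S u \<Longrightarrow> open S \<Longrightarrow> x \<in> S \<Longrightarrow> dd d (dd e u) x = dd e (dd d u) x"
  unfolding harmonic_def using harmonic_with_dd_dd_eq harmonic_with_hessian_symmetric by metis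

lemma dd_linear_direction:
  "harmonic S u \<Longrightarrow> x \<in> S \<Longrightarrow> dd (a *\<^sub>R e + b *\<^sub>R d) u x = a * dd e u x + b * dd d u x"
  unfolding harmonic_def by (auto simp: harmonic_with_dd_eq inner_add_right)

lemma dd_sum_direction:
  "harmonic S u \<Longrightarrow> x \<in> S \<Longrightarrow> dd (\<Sum>i\<in>I. c i *\<^sub>R e i) u x = (\<Sum>i\<in>I. c i * dd (e i) u x)"
  unfolding harmonic_def by (auto simp: harmonic_with_dd_eq inner_sum_right)

lemma dd_cong:
  assumes "open S" "x \<in> S" "\<And>y. y \<in> S \<Longrightarrow> u y = v y"
  shows "dd e u x = dd e v x"
proof -
  have "(u has_derivative D) (at x) \<longleftrightarrow> (v has_derivative D) (at x)" for D
    using has_derivative_transform_within_open[of u D x UNIV S v] has_derivative_transform_within_open[of v D x UNIV S u] assms by auto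
  then show ?thesis unfolding dd_def frechet_derivative_def by simp
qed

lemma harmonic_cong: "harmonic S u \<Longrightarrow> open S \<Longrightarrow> (\<And>x. x \<in> S \<Longrightarrow> u x = v x) \<Longrightarrow> harmonic S v"
  unfolding harmonic_def using harmonic_with_cong by metis

lemma harmonic_continuous_on: "harmonic S u \<Longrightarrow> continuous_on S u"
  unfolding harmonic_def using harmonic_with_continuous_on by blast

lemma harmonic_jet2:
  assumes "harmonic S u" "open S" "x \<in> S"
  shows "jet2 (\<lambda>t. u (x + t *\<^sub>R e)) (u x) (dd e u x) (dd e (dd e u) x)"
proof -
  obtain g H where h: "harmonic_with S u g H" using assms unfolding harmonic_def by blast
  show ?thesis using harmonic_with_jet2[OF h assms(2,3), of e]
    by (simp add: harmonic_with_dd_eq[OF h assms(3)] harmonic_with_dd_dd_eq[OF h assms(2,3)])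
qed

lemma harmonic_line_derivative:
  assumes "harmonic S u" "x + t *\<^sub>R e \<in> S"
  shows "((\<lambda>t. u (x + t *\<^sub>R e)) has_real_derivative dd e u (x + t *\<^sub>R e)) (at t)"
proof -
  obtain g H where h: "harmonic_with S u g H" using assms unfolding harmonic_def by blast
  then have "(u has_derivative (\<lambda>h. g (x + t *\<^sub>R e) \<bullet> h)) (at (x + t *\<^sub>R e))"
    using assms(2) unfolding harmonic_with_def by auto
  from has_derivative_along_line[OF this] show ?thesis
    by (simp add: has_real_derivative_iff_has_vector_derivative harmonic_with_dd_eq[OF h assms(2)])
qed

lemma harmonic_dd_bound:
  fixes u :: "real^'n \<Rightarrow> real" and M R :: real
  assumes h: "harmonic S u" and S: "open S" "cball x R \<subseteq> S" and R: "R > 0"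
    and M: "\<And>y. y \<in> cball x R \<Longrightarrow> \<bar>u y\<bar> \<le> M"
  shows "\<bar>dd e u x\<bar> \<le> (real CARD('n))\<^sup>2 * M / R * norm e"
proof -
  obtain g H where h: "harmonic_with S u g H" using assms unfolding harmonic_def by blast
  have x: "x \<in> S" using subsetD[OF S(2), of x] R by simp
  have "\<bar>dd e u x\<bar> \<le> norm (g x) * norm e"
    unfolding harmonic_with_dd_eq[OF h x] by (rule Cauchy_Schwarz_ineq2)
  also have "\<dots> \<le> (real CARD('n))\<^sup>2 * M / R * norm e"
    by (intro mult_right_mono harmonic_with_gradient_norm_bound[OF h S R M]) auto
  finally show ?thesis .
qed

definition orthonormal_frame :: "('i \<Rightarrow> 'a::real_inner) \<Rightarrow> bool" where
  "orthonormal_frame e \<longleftrightarrow> (\<forall>i j. e i \<bullet> e j = (if i = j then 1 else 0))"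

lemma norm_orthonormal_frame: "orthonormal_frame e \<Longrightarrow> norm (e i) = 1"
  by (simp add: orthonormal_frame_def norm_eq_1)

lemma orthonormal_frame_axis: "orthonormal_frame (\<lambda>i. axis i (1::real))"
  by (auto simp: orthonormal_frame_def inner_axis_axis)

lemma orthonormal_frame_matrix:
  fixes e :: "'n \<Rightarrow> real^'n"
  assumes "orthonormal_frame e"
  shows "orthogonal_matrix (\<chi> i. e i)"
proof -
  have "(\<chi> i. e i) ** transpose (\<chi> i. e i) = mat 1"
    using assms by (auto simp: orthonormal_frame_def matrix_matrix_mult_def transpose_def mat_def vec_eq_iff inner_vec_def)
  then show ?thesis by (simp add: orthogonal_matrix_def matrix_left_right_inverse)
qed

lemma matrix_in_frame:
  fixes A :: "real^'n^'n"
  shows "(\<chi> i j. (A *v e j) \<bullet> e i) = (\<chi> i. e i) ** (A ** transpose (\<chi> i. e i))"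
  unfolding matrix_matrix_mult_def transpose_def
  by (simp add: inner_vec_def matrix_vector_mult_def mult.commute vec_eq_iff)

text \<open>The trace is invariant under orthogonal conjugation; hence the Laplacian may be computed in any orthonormal frame.\<close>

lemma orthonormal_trace:
  fixes A :: "real^'n^'n" and e :: "'n \<Rightarrow> real^'n"
  assumes "orthonormal_frame e"
  shows "(\<Sum>i\<in>UNIV. (A *v e i) \<bullet> e i) = trace A"
proof -
  let ?E = "\<chi> i. e i"
  have "(\<Sum>i\<in>UNIV. (A *v e i) \<bullet> e i) = trace (\<chi> i j. (A *v e j) \<bullet> e i)" by (simp add: trace_def)
  also have "\<dots> = trace ((A ** transpose ?E) ** ?E)" unfolding matrix_in_frame by (rule trace_mul_sym)
  also have "\<dots> = trace A"
    using orthonormal_frame_matrix[OF assms] by (simp add: matrix_mul_assoc[symmetric] orthogonal_matrix_def)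
  finally show ?thesis .
qed

lemma harmonic_laplacian_frame:
  fixes e :: "'n \<Rightarrow> real^'n"
  assumes "harmonic S u" "open S" "x \<in> S" "orthonormal_frame e"
  shows "(\<Sum>i\<in>UNIV. dd (e i) (dd (e i) u) x) = 0"
proof -
  obtain g H where h: "harmonic_with S u g H" using assms unfolding harmonic_def by blast
  then have "trace (H x) = 0" using assms unfolding harmonic_with_def by auto
  then show ?thesis unfolding harmonic_with_dd_dd_eq[OF h assms(2,3)] orthonormal_trace[OF assms(4)] .
qed

section \<open>Iterated directional derivatives\<close>

lemma harmonic_has_derivative: "harmonic S u \<Longrightarrow> x \<in> S \<Longrightarrow> (u has_derivative (\<lambda>e. dd e u x)) (at x)"
  unfolding harmonic_def harmonic_with_def dd_def by (metis frechet_derivative_at ext)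

lemma dd_sum:
  assumes "finite I" "\<And>i. i \<in> I \<Longrightarrow> harmonic S (u i)" "x \<in> S"
  shows "dd e (\<lambda>x. \<Sum>i\<in>I. c i * u i x) x = (\<Sum>i\<in>I. c i * dd e (u i) x)"
proof -
  have "((\<lambda>x. \<Sum>i\<in>I. c i * u i x) has_derivative (\<lambda>e. \<Sum>i\<in>I. c i * dd e (u i) x)) (at x)"
    by (rule has_derivative_sum, rule has_derivative_mult_right, rule harmonic_has_derivative[OF assms(2,3)])
  from fun_cong[OF frechet_derivative_at[OF this], of e] show ?thesis by (simp only: dd_def)
qed

lemma harmonic_ddn: "open S \<Longrightarrow> harmonic S u \<Longrightarrow> harmonic S ((dd e ^^ n) u)"
  by (induction n) (auto intro: harmonic_dd)

lemma ddn_cong: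
  assumes "open S" "\<And>y. y \<in> S \<Longrightarrow> u y = v y"
  shows "x \<in> S \<Longrightarrow> (dd e ^^ n) u x = (dd e ^^ n) v x"
  by (induction n arbitrary: x) (auto intro: dd_cong[OF assms(1)] assms(2))

lemma ddn_sum:
  assumes "open S" "finite I" "\<And>i. i \<in> I \<Longrightarrow> harmonic S (u i)"
  shows "x \<in> S \<Longrightarrow> (dd e ^^ n) (\<lambda>x. \<Sum>i\<in>I. c i * u i x) x = (\<Sum>i\<in>I. c i * (dd e ^^ n) (u i) x)"
proof (induction n arbitrary: x)
  case (Suc n)
  have "(dd e ^^ Suc n) (\<lambda>x. \<Sum>i\<in>I. c i * u i x) x = dd e (\<lambda>x. \<Sum>i\<in>I. c i * (dd e ^^ n) (u i) x) x"
    using dd_cong[OF assms(1) Suc.prems Suc.IH] by simp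
  also have "\<dots> = (\<Sum>i\<in>I. c i * dd e ((dd e ^^ n) (u i)) x)"
    by (rule dd_sum[OF assms(2) _ Suc.prems]) (simp add: harmonic_ddn assms)
  finally show ?case by simp
qed simp

lemma ddn_add:
  assumes "open S" "harmonic S u" "harmonic S v" "x \<in> S"
  shows "(dd e ^^ n) (\<lambda>x. u x + s * v x) x = (dd e ^^ n) u x + s * (dd e ^^ n) v x"
proof -
  have "harmonic S (if i then u else v)" for i using assms by simp
  with ddn_sum[OF assms(1), where I = UNIV and u = "\<lambda>i. if i then u else v" and x = x and e = e and n = n and c = "\<lambda>i. if i then 1 else s"] assms(4)
  show ?thesis by (simp add: UNIV_bool add.commute)
qed

lemma ddn_commute:
  assumes "open S" "harmonic S u"
  shows "x \<in> S \<Longrightarrow> dd d ((dd e ^^ n) u) x = (dd e ^^ n) (dd d u) x"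
proof (induction n arbitrary: x)
  case (Suc n)
  have "dd d ((dd e ^^ Suc n) u) x = dd e (dd d ((dd e ^^ n) u)) x"
    using dd_commute[OF harmonic_ddn[OF assms] assms(1) Suc.prems] by simp
  also have "\<dots> = (dd e ^^ Suc n) (dd d u) x"
    using dd_cong[OF assms(1) Suc.prems Suc.IH] by simp
  finally show ?case .
qed simp

lemma ddn_scaleR:
  assumes "open S" "harmonic S u"
  shows "x \<in> S \<Longrightarrow> (dd (t *\<^sub>R e) ^^ n) u x = t ^ n * (dd e ^^ n) u x"
proof (induction n arbitrary: x)
  case (Suc n)
  have "(dd (t *\<^sub>R e) ^^ Suc n) u x = dd (t *\<^sub>R e) (\<lambda>x. t ^ n * (dd e ^^ n) u x) x"
    using dd_cong[OF assms(1) Suc.prems Suc.IH] by simp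
  also have "\<dots> = t ^ n * dd (t *\<^sub>R e) ((dd e ^^ n) u) x"
    using dd_sum[of "{()}" S "\<lambda>_. (dd e ^^ n) u" x "t *\<^sub>R e" "\<lambda>_. t ^ n"] harmonic_ddn[OF assms] Suc.prems by simp
  also have "\<dots> = t ^ n * (t * dd e ((dd e ^^ n) u) x)"
    using dd_linear_direction[OF harmonic_ddn[OF assms] Suc.prems, of t e 0 0] by simp
  finally show ?case by simp
qed simp

lemma sum_binomial_Pascal:
  fixes a :: "nat \<Rightarrow> real"
  shows "(\<Sum>j\<le>n. real (n choose j) * a j) + (\<Sum>j\<le>n. real (n choose j) * a (Suc j)) = (\<Sum>j\<le>Suc n. real (Suc n choose j) * a j)"
proof -
  have "(\<Sum>j\<le>Suc n. real (Suc n choose j) * a j) = a 0 + (\<Sum>j\<le>n. real (Suc n choose Suc j) * a (Suc j))"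
    by (subst sum.atMost_Suc_shift) simp
  also have "\<dots> = a 0 + (\<Sum>j\<le>n. real (n choose Suc j) * a (Suc j)) + (\<Sum>j\<le>n. real (n choose j) * a (Suc j))"
    by (simp add: algebra_simps sum.distrib)
  also have "a 0 + (\<Sum>j\<le>n. real (n choose Suc j) * a (Suc j)) = (\<Sum>j\<le>Suc n. real (n choose j) * a j)"
    by (subst sum.atMost_Suc_shift) simp
  also have "\<dots> = (\<Sum>j\<le>n. real (n choose j) * a j)" by simp
  finally show ?thesis by simp
qed

text \<open>Directional derivatives commute and are linear in the direction, so the binomial theorem holds for them.\<close>

lemma ddn_binomial:
  assumes "open S" "harmonic S w" "z \<in> S"
  shows "(dd (e + s *\<^sub>R y) ^^ n) w z = (\<Sum>j\<le>n. real (n choose j) * (s ^ j * (dd e ^^ (n - j)) ((dd y ^^ j) w) z))"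
  using assms(2)
proof (induction n arbitrary: w)
  case (Suc n)
  let ?a = "\<lambda>j. s ^ j * (dd e ^^ (Suc n - j)) ((dd y ^^ j) w) z"
  have h: "harmonic S (dd e w)" "harmonic S (dd y w)" using assms Suc.prems by (auto intro: harmonic_dd)
  have "(dd (e + s *\<^sub>R y) ^^ Suc n) w z = (dd (e + s *\<^sub>R y) ^^ n) (dd (e + s *\<^sub>R y) w) z"
    by (simp add: funpow_swap1)
  also have "\<dots> = (dd (e + s *\<^sub>R y) ^^ n) (\<lambda>x. dd e w x + s * dd y w x) z"
    by (rule ddn_cong[OF assms(1) _ assms(3)]) (use dd_linear_direction[OF Suc.prems, of _ 1 e s y] in simp)
  also have "\<dots> = (dd (e + s *\<^sub>R y) ^^ n) (dd e w) z + s * (dd (e + s *\<^sub>R y) ^^ n) (dd y w) z"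
    by (rule ddn_add[OF assms(1) h assms(3)])
  also have "(dd (e + s *\<^sub>R y) ^^ n) (dd e w) z = (\<Sum>j\<le>n. real (n choose j) * ?a j)"
    unfolding Suc.IH[OF h(1)]
  proof (intro sum.cong refl)
    fix j assume j: "j \<in> {..n}"
    have "(dd e ^^ (n - j)) ((dd y ^^ j) (dd e w)) z = (dd e ^^ (n - j)) (dd e ((dd y ^^ j) w)) z"
      by (rule ddn_cong[OF assms(1) _ assms(3)]) (simp add: ddn_commute[OF assms(1) Suc.prems])
    also have "\<dots> = (dd e ^^ (Suc n - j)) ((dd y ^^ j) w) z"
      using j by (simp add: Suc_diff_le funpow_swap1)
    finally show "real (n choose j) * (s ^ j * (dd e ^^ (n - j)) ((dd y ^^ j) (dd e w)) z) = real (n choose j) * ?a j" by simp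
  qed
  also have "s * (dd (e + s *\<^sub>R y) ^^ n) (dd y w) z = (\<Sum>j\<le>n. real (n choose j) * ?a (Suc j))"
    unfolding Suc.IH[OF h(2)] by (simp add: sum_distrib_left funpow_swap1 algebra_simps)
  finally show ?case using sum_binomial_Pascal[of n ?a] by (simp only:)
qed simp

lemma ddn_continuous_direction:
  fixes w :: "real^'n \<Rightarrow> real"
  assumes "open S" "harmonic S w" "z \<in> S"
  shows "continuous_on UNIV (\<lambda>e. (dd e ^^ n) w z)"
  using assms(2)
proof (induction n arbitrary: w)
  case (Suc n)
  have "(dd e ^^ Suc n) w z = (\<Sum>i\<in>UNIV. e $ i * (dd e ^^ n) (dd (axis i 1) w) z)" for e
  proof -
    have e: "e = (\<Sum>i\<in>UNIV. (e $ i) *\<^sub>R axis i 1)" by (simp add: vec_eq_iff axis_def if_distrib cong: if_cong)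
    have "(dd e ^^ Suc n) w z = (dd e ^^ n) (dd e w) z" by (simp add: funpow_swap1)
    also have "\<dots> = (dd e ^^ n) (\<lambda>x. \<Sum>i\<in>UNIV. e $ i * dd (axis i 1) w x) z"
      using dd_sum_direction[OF Suc.prems, where I = UNIV and c = "\<lambda>i. e $ i" and e = "\<lambda>i. axis i 1"]
      by (intro ddn_cong[OF assms(1) _ assms(3)]) (simp add: e[symmetric])
    also have "\<dots> = (\<Sum>i\<in>UNIV. e $ i * (dd e ^^ n) (dd (axis i 1) w) z)"
      by (rule ddn_sum[OF assms(1) _ _ assms(3)]) (auto intro: harmonic_dd assms Suc.prems)
    finally show ?thesis .
  qed
  moreover have "continuous_on UNIV (\<lambda>e. \<Sum>i\<in>UNIV. e $ i * (dd e ^^ n) (dd (axis i 1) w) z)"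
    by (intro continuous_intros Suc.IH harmonic_dd assms Suc.prems)
  ultimately show ?case by presburger
qed simp

text \<open>Each derivative costs a step of size \<open>\<rho>\<close> towards the boundary and a factor proportional to \<open>1 / \<rho>\<close>.\<close>

lemma ddn_bound:
  fixes u :: "real^'n \<Rightarrow> real" and M R \<rho> :: real
  assumes S: "open S" "harmonic S u" "cball z R \<subseteq> S" and M: "\<And>y. y \<in> cball z R \<Longrightarrow> \<bar>u y\<bar> \<le> M" and \<rho>: "\<rho> > 0"
  shows "dist z x + real n * \<rho> \<le> R \<Longrightarrow> \<bar>(dd e ^^ n) u x\<bar> \<le> ((real CARD('n))\<^sup>2 / \<rho> * norm e) ^ n * M"
proof (induction n arbitrary: x)
  case 0 then show ?case using M by simp
next
  case (Suc n)
  let ?C = "(real CARD('n))\<^sup>2 / \<rho> * norm e"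
  have sm: "dist z y + real n * \<rho> \<le> R" if "y \<in> cball x \<rho>" for y
    using that Suc.prems dist_triangle[of z y x] by (simp add: algebra_simps)
  have sub: "cball x \<rho> \<subseteq> S"
  proof
    fix y assume "y \<in> cball x \<rho>"
    from sm[OF this] have "dist z y \<le> R" using \<rho> by (smt (verit) mult_nonneg_nonneg of_nat_0_le_iff)
    then show "y \<in> S" using S(3) by auto
  qed
  have "\<bar>dd e ((dd e ^^ n) u) x\<bar> \<le> (real CARD('n))\<^sup>2 * (?C ^ n * M) / \<rho> * norm e"
    by (rule harmonic_dd_bound[OF harmonic_ddn[OF S(1,2)] S(1) sub \<rho>]) (rule Suc.IH, rule sm)
  also have "\<dots> = ?C ^ Suc n * M" by (simp add: field_simps)
  finally show ?case by simp
qed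

lemma harmonic_Taylor:
  assumes S: "harmonic S u" "open S" and seg: "\<And>t. 0 \<le> t \<Longrightarrow> t \<le> 1 \<Longrightarrow> z + t *\<^sub>R e \<in> S"
  obtains \<theta> where "0 \<le> \<theta>" "\<theta> \<le> 1"
    "u (z + e) = (\<Sum>m<n. (dd e ^^ m) u z / fact m) + (dd e ^^ n) u (z + \<theta> *\<^sub>R e) / fact n"
proof -
  have "\<exists>t. 0 < t \<and> t \<le> (1::real) \<and> u (z + 1 *\<^sub>R e) = (\<Sum>m<n. (dd e ^^ m) u (z + 0 *\<^sub>R e) / fact m * 1 ^ m) + (dd e ^^ n) u (z + t *\<^sub>R e) / fact n * 1 ^ n"
  proof (rule Maclaurin2[where diff = "\<lambda>m t. (dd e ^^ m) u (z + t *\<^sub>R e)"])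
    show "\<forall>m t. m < n \<and> 0 \<le> t \<and> t \<le> 1 \<longrightarrow> ((\<lambda>t. (dd e ^^ m) u (z + t *\<^sub>R e)) has_real_derivative (dd e ^^ Suc m) u (z + t *\<^sub>R e)) (at t)"
      using harmonic_line_derivative[OF harmonic_ddn[OF S(2,1)]] seg by auto
  qed auto
  then obtain t where "0 < t" "t \<le> 1" "u (z + e) = (\<Sum>m<n. (dd e ^^ m) u z / fact m) + (dd e ^^ n) u (z + t *\<^sub>R e) / fact n"
    by auto
  then show ?thesis using that[of t] by simp
qed

lemma power_self_le_exp_fact: "real n ^ n \<le> exp 1 ^ n * fact n"
proof -
  have "real n ^ n / fact n \<le> (\<Sum>k. real n ^ k / fact k)"
    using sum_le_suminf[of "\<lambda>k. real n ^ k / fact k" "{n}"] summable_exp[of "real n"] by (simp add: divide_inverse mult.commute)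
  also have "\<dots> = exp (real n)" by (simp add: exp_def divide_inverse mult.commute)
  also have "\<dots> = exp 1 ^ n" using exp_of_nat_mult[of n "1::real"] by simp
  finally show ?thesis by (simp add: field_simps)
qed

lemma harmonic_bounded_near:
  assumes "harmonic S u" "open S" "z \<in> S"
  obtains R M where "R > 0" "cball z R \<subseteq> S" "\<And>y. y \<in> cball z R \<Longrightarrow> \<bar>u y\<bar> \<le> M"
proof -
  obtain R where R: "R > 0" "cball z R \<subseteq> S" using assms open_contains_cball by blast
  have "continuous_on (cball z R) u" using harmonic_continuous_on[OF assms(1)] R(2) continuous_on_subset by blast
  then have "bounded (u ` cball z R)" by (intro compact_imp_bounded compact_continuous_image compact_cball)
  then obtain M where "\<forall>y\<in>u ` cball z R. norm y \<le> M" unfolding bounded_iff by blast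
  then have "\<bar>u y\<bar> \<le> M" if "y \<in> cball z R" for y using that by auto
  with R that show ?thesis by blast
qed

text \<open>Choosing the step size \<open>\<rho>\<close> proportional to \<open>1 / n\<close> yields the growth \<open>(C n)\<^sup>n\<close> that characterizes real
  analyticity.\<close>

lemma ddn_bound_near:
  fixes u :: "real^'n \<Rightarrow> real"
  assumes "harmonic S u" "open S" "z \<in> S"
  obtains R M C where "R > 0" "M \<ge> 0" "C > 0" "cball z R \<subseteq> S" "\<And>n x e. dist z x \<le> R \<Longrightarrow> \<bar>(dd e ^^ n) u x\<bar> \<le> (C * real n * norm e) ^ n * M"
proof -
  obtain R M where R: "R > 0" "cball z R \<subseteq> S" "\<And>y. y \<in> cball z R \<Longrightarrow> \<bar>u y\<bar> \<le> M"
    using harmonic_bounded_near[OF assms] by metis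
  define C where "C = (real CARD('n))\<^sup>2 * 2 / R"
  have M: "M \<ge> 0" using R(3)[of z] R(1) by fastforce
  have "\<bar>(dd e ^^ n) u x\<bar> \<le> (C * real n * norm e) ^ n * M" if x: "dist z x \<le> R / 2" for n x e
  proof (cases "n = 0")
    case True
    then show ?thesis using R(3)[of x] x R(1) by simp
  next
    case False
    have "\<bar>(dd e ^^ n) u x\<bar> \<le> ((real CARD('n))\<^sup>2 / (R / 2 / real n) * norm e) ^ n * M"
      by (rule ddn_bound[OF assms(2,1) R(2,3)]) (use R x False in \<open>auto simp: field_simps\<close>)
    then show ?thesis by (simp add: C_def field_simps)
  qed
  moreover have "cball z (R/2) \<subseteq> S" using R(1,2) by (auto simp: subset_iff)
  moreover have "C > 0" using R by (simp add: C_def)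
  ultimately show ?thesis using that[of "R/2" M C] R M by auto
qed

text \<open>The Taylor remainder of order \<open>n\<close> is at most a constant times \<open>2\<^sup>-\<^sup>n\<close> on a ball whose radius does not depend on \<open>n\<close>.\<close>

lemma harmonic_infinite_order_zero:
  assumes S: "harmonic S u" "open S" "z \<in> S" and flat: "\<And>n e. (dd e ^^ n) u z = 0"
  shows "\<exists>\<delta>>0. \<forall>x\<in>ball z \<delta>. u x = 0"
proof -
  obtain R M C where R: "R > 0" "M \<ge> 0" "C > 0" "cball z R \<subseteq> S"
      and b: "\<And>n x e. dist z x \<le> R \<Longrightarrow> \<bar>(dd e ^^ n) u x\<bar> \<le> (C * real n * norm e) ^ n * M"
    using ddn_bound_near[OF S] by metis
  \<comment> \<open>Stirling costs a factor \<open>exp 1\<close> per derivative; this radius leaves the ratio \<open>1/2\<close>.\<close>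
  define \<delta> where "\<delta> = min R (1 / (2 * C * exp 1))"
  have \<delta>: "\<delta> > 0" "\<delta> \<le> R" "\<delta> \<le> 1 / (2 * C * exp 1)" using R by (auto simp: \<delta>_def)
  have "u x = 0" if x: "x \<in> ball z \<delta>" for x
  proof -
    define e where "e = x - z"
    have e: "norm e < \<delta>" using x by (simp add: e_def dist_norm norm_minus_commute)
    have seg: "dist z (z + t *\<^sub>R e) \<le> R" if "0 \<le> t" "t \<le> 1" for t
      using that e \<delta> mult_left_le_one_le[of "norm e" t] by (simp add: dist_norm)
    have "\<bar>u x\<bar> \<le> (1/2) ^ n * M" for n
    proof -
      obtain \<theta> where \<theta>: "0 \<le> \<theta>" "\<theta> \<le> 1"
        "u (z + e) = (\<Sum>m<n. (dd e ^^ m) u z / fact m) + (dd e ^^ n) u (z + \<theta> *\<^sub>R e) / fact n"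
        by (rule harmonic_Taylor[OF S(1,2), of z e n]) (use seg R(4) in auto)
      then have "u x = (dd e ^^ n) u (z + \<theta> *\<^sub>R e) / fact n" by (simp add: flat e_def)
      then have "\<bar>u x\<bar> \<le> (C * real n * norm e) ^ n * M / fact n"
        using b[OF seg[OF \<theta>(1,2)], where e = e and n = n] by (simp add: divide_right_mono)
      also have "\<dots> = (C * norm e) ^ n * M * (real n ^ n / fact n)" by (simp add: power_mult_distrib)
      also have "\<dots> \<le> (C * norm e) ^ n * M * exp 1 ^ n"
        using power_self_le_exp_fact[of n] R by (intro mult_left_mono) (auto simp: field_simps)
      also have "\<dots> = (C * norm e * exp 1) ^ n * M" by (simp add: power_mult_distrib)
      also have "\<dots> \<le> (1/2) ^ n * M"
      proof (intro mult_right_mono power_mono)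
        have "norm e \<le> 1 / (2 * C * exp 1)" using e \<delta> by simp
        then show "C * norm e * exp 1 \<le> 1/2" using R by (simp add: field_simps)
      qed (use R in auto)
      finally show ?thesis .
    qed
    moreover have "(\<lambda>n. (1/2) ^ n * M) \<longlonglongrightarrow> 0" by (intro tendsto_mult_left_zero LIMSEQ_power_zero) simp
    ultimately have "\<bar>u x\<bar> \<le> 0" using LIMSEQ_le_const by blast
    then show ?thesis by simp
  qed
  then show ?thesis using \<delta> by blast
qed

lemma harmonic_leading_term:
  assumes S: "harmonic S u" "open S" "z \<in> S" and flat: "\<And>m e. m < n \<Longrightarrow> (dd e ^^ m) u z = 0"
  shows "\<exists>r>0. \<exists>C\<ge>0. \<forall>e. norm e \<le> r \<longrightarrow> z + e \<in> S \<and> \<bar>u (z + e) - (dd e ^^ n) u z / fact n\<bar> \<le> C * norm e ^ Suc n"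
proof -
  obtain R M C where R: "R > 0" "M \<ge> 0" "C > 0" "cball z R \<subseteq> S"
      and b: "\<And>n x e. dist z x \<le> R \<Longrightarrow> \<bar>(dd e ^^ n) u x\<bar> \<le> (C * real n * norm e) ^ n * M"
    using ddn_bound_near[OF S] by metis
  let ?C = "(C * real (Suc n)) ^ Suc n * M / fact (Suc n)"
  have "z + e \<in> S \<and> \<bar>u (z + e) - (dd e ^^ n) u z / fact n\<bar> \<le> ?C * norm e ^ Suc n" if e: "norm e \<le> R" for e
  proof -
    have seg: "dist z (z + t *\<^sub>R e) \<le> R" if "0 \<le> t" "t \<le> 1" for t
      using that e mult_left_le_one_le[of "norm e" t] by (simp add: dist_norm)
    obtain \<theta> where \<theta>: "0 \<le> \<theta>" "\<theta> \<le> 1"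
      "u (z + e) = (\<Sum>m<Suc n. (dd e ^^ m) u z / fact m) + (dd e ^^ Suc n) u (z + \<theta> *\<^sub>R e) / fact (Suc n)"
      by (rule harmonic_Taylor[OF S(1,2), of z e "Suc n"]) (use seg R(4) in auto)
    have "u (z + e) - (dd e ^^ n) u z / fact n = (dd e ^^ Suc n) u (z + \<theta> *\<^sub>R e) / fact (Suc n)"
      using \<theta>(3) by (simp add: flat)
    then have "\<bar>u (z + e) - (dd e ^^ n) u z / fact n\<bar> \<le> (C * real (Suc n) * norm e) ^ Suc n * M / fact (Suc n)"
      using b[OF seg[OF \<theta>(1,2)], where e = e and n = "Suc n"] by (simp add: divide_right_mono del: fact_Suc funpow.simps power_Suc)
    also have "\<dots> = ?C * norm e ^ Suc n" by (simp add: power_mult_distrib del: fact_Suc)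
    finally show ?thesis using seg[of 1] R(4) by auto
  qed
  moreover have "?C \<ge> 0" using R by simp
  ultimately show ?thesis using R(1) by blast
qed

section \<open>Zeros of a Hessian of bounded distortion\<close>

definition hess :: "(real^'n \<Rightarrow> real) \<Rightarrow> real^'n \<Rightarrow> real^'n^'n" where
  "hess u x = (\<chi> i j. dd (axis i 1) (dd (axis j 1) u) x)"

lemma hess_eq:
  assumes "harmonic_with S u g H" "open S" "x \<in> S"
  shows "hess u x = H x"
  by (simp add: hess_def vec_eq_iff harmonic_with_dd_dd_eq[OF assms] matrix_vector_mult_basis inner_axis column_def)

lemma hess_dd:
  assumes "harmonic S u" "open S" "x \<in> S"
  shows "(hess u x *v e) \<bullet> d = dd d (dd e u) x"
proof -
  obtain g H where h: "harmonic_with S u g H" using assms unfolding harmonic_def by blast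
  show ?thesis using hess_eq[OF h assms(2,3)] harmonic_with_dd_dd_eq[OF h assms(2,3)] by simp
qed

lemma hess_ddn:
  assumes "open S" "harmonic S u" "x \<in> S"
  shows "hess ((dd e ^^ n) u) x $ i $ j = (dd e ^^ n) (dd (axis i 1) (dd (axis j 1) u)) x"
proof -
  have "dd (axis i 1) (dd (axis j 1) ((dd e ^^ n) u)) x = dd (axis i 1) ((dd e ^^ n) (dd (axis j 1) u)) x"
    by (rule dd_cong[OF assms(1,3)]) (rule ddn_commute[OF assms(1,2)])
  also have "\<dots> = (dd e ^^ n) (dd (axis i 1) (dd (axis j 1) u)) x"
    by (rule ddn_commute[OF assms(1) harmonic_dd[OF assms(1,2)] assms(3)])
  finally show ?thesis by (simp add: hess_def)
qed

text \<open>The outer distortion inequality of a quasiconformal map, stated for its derivative. It is homogeneous and closed,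
  so it passes to blow-ups; a singular matrix satisfies it only if it is zero.\<close>

definition qc_matrix :: "real \<Rightarrow> real^3^3 \<Rightarrow> bool" where
  "qc_matrix K A \<longleftrightarrow> (\<forall>v. norm (A *v v) ^ 3 \<le> K * \<bar>det A\<bar> * norm v ^ 3)"

lemma det_scaleR_3: "det (c *\<^sub>R A) = c ^ 3 * det (A::real^3^3)"
  by (simp add: det_3 power3_eq_cube algebra_simps)

lemma qc_matrix_scaleR:
  assumes "qc_matrix K A" shows "qc_matrix K (c *\<^sub>R A)"
  unfolding qc_matrix_def
proof
  fix v
  have "norm ((c *\<^sub>R A) *v v) ^ 3 = \<bar>c\<bar> ^ 3 * norm (A *v v) ^ 3"
    by (simp add: scaleR_matrix_vector_assoc[symmetric] power_mult_distrib)
  also have "\<dots> \<le> \<bar>c\<bar> ^ 3 * (K * \<bar>det A\<bar> * norm v ^ 3)"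
    using assms unfolding qc_matrix_def by (intro mult_left_mono) auto
  also have "\<dots> = K * \<bar>det (c *\<^sub>R A)\<bar> * norm v ^ 3"
    by (simp add: det_scaleR_3 abs_mult power_abs algebra_simps)
  finally show "norm ((c *\<^sub>R A) *v v) ^ 3 \<le> K * \<bar>det (c *\<^sub>R A)\<bar> * norm v ^ 3" .
qed

lemma tendsto_matrix:
  fixes A :: "'b \<Rightarrow> real^'n^'m"
  assumes "\<And>i j. ((\<lambda>t. A t $ i $ j) \<longlongrightarrow> L $ i $ j) F"
  shows "(A \<longlongrightarrow> L) F"
  by (intro vec_tendstoI assms)

lemma qc_matrix_limit:
  assumes "(A \<longlongrightarrow> L) F" "F \<noteq> bot" "\<forall>\<^sub>F t in F. qc_matrix K (A t)"
  shows "qc_matrix K L"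
  unfolding qc_matrix_def
proof
  fix v
  have "linear (\<lambda>A::real^3^3. A *v v)"
    by (intro linearI) (simp_all add: matrix_vector_mult_add_rdistrib scaleR_matrix_vector_assoc)
  then have 1: "((\<lambda>t. norm (A t *v v) ^ 3) \<longlongrightarrow> norm (L *v v) ^ 3) F"
    using assms(1) by (intro tendsto_intros bounded_linear.tendsto[of "\<lambda>A. A *v v"]) (simp_all add: linear_conv_bounded_linear)
  have 2: "((\<lambda>t. K * \<bar>det (A t)\<bar> * norm v ^ 3) \<longlongrightarrow> K * \<bar>det L\<bar> * norm v ^ 3) F"
    unfolding det_3 by (intro tendsto_intros assms(1))
  show "norm (L *v v) ^ 3 \<le> K * \<bar>det L\<bar> * norm v ^ 3"
    by (rule tendsto_le[OF assms(2) 2 1]) (use assms(3) in \<open>auto simp: qc_matrix_def elim: eventually_mono\<close>)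
qed

lemma qc_matrix_singular:
  assumes "qc_matrix K A" "det A = 0" shows "A = 0"
proof -
  have "norm (A *v v) ^ 3 \<le> 0" for v using assms unfolding qc_matrix_def by (metis abs_zero mult_zero_left mult_zero_right)
  then have "A *v v = 0" for v by (simp add: power_le_zero_eq)
  then show ?thesis by (simp add: matrix_eq)
qed

lemma qc_matrix_entry:
  assumes "qc_matrix K A" shows "\<bar>A $ i $ j\<bar> ^ 3 \<le> K * \<bar>det A\<bar>"
proof -
  have "\<bar>A $ i $ j\<bar> \<le> norm (A *v axis j 1)"
    using component_le_norm_cart[of "A *v axis j 1" i] by (simp add: matrix_vector_mult_basis column_def)
  then have "\<bar>A $ i $ j\<bar> ^ 3 \<le> norm (A *v axis j 1) ^ 3" by (intro power_mono) auto
  also have "\<dots> \<le> K * \<bar>det A\<bar> * norm (axis j (1::real)) ^ 3" using assms unfolding qc_matrix_def by blast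
  finally show ?thesis by (simp add: norm_axis_1)
qed

lemma det_zero_if_kernel:
  fixes A :: "real^'n^'n"
  assumes "A *v x = 0" "x \<noteq> 0" shows "det A = 0"
  using assms by (metis invertible_det_nz invertible_left_inverse matrix_left_invertible_ker)

text \<open>The lowest nonzero coefficient of a matrix polynomial is its rescaled limit at \<open>0\<close>.\<close>

lemma matrix_sum_expansion_limit:
  fixes B :: "nat \<Rightarrow> real^'n^'n"
  assumes "k \<le> n" "\<And>j. j < k \<Longrightarrow> B j = 0"
  shows "((\<lambda>s. (1 / s ^ k) *\<^sub>R (\<Sum>j\<le>n. s ^ j *\<^sub>R B j)) \<longlongrightarrow> B k) (at_right 0)"
proof -
  have "((\<lambda>s. \<Sum>j\<in>{k..n}. s ^ (j - k) *\<^sub>R B j) \<longlongrightarrow> (\<Sum>j\<in>{k..n}. 0 ^ (j - k) *\<^sub>R B j)) (at_right 0)"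
    by (intro tendsto_intros)
  also have "(\<Sum>j\<in>{k..n}. 0 ^ (j - k) *\<^sub>R B j) = B k"
  proof -
    have "(\<Sum>j\<in>{k..n}. 0 ^ (j - k) *\<^sub>R B j) = (\<Sum>j\<in>{k}. 0 ^ (j - k) *\<^sub>R B j)"
      using assms(1) by (intro sum.mono_neutral_right) (auto simp: power_0_left)
    then show ?thesis by simp
  qed
  finally show ?thesis
  proof (rule Lim_transform_eventually)
    have "\<forall>\<^sub>F s in at_right (0::real). s > 0" by (simp add: eventually_at_right_less)
    then show "\<forall>\<^sub>F s in at_right 0. (\<Sum>j\<in>{k..n}. s ^ (j - k) *\<^sub>R B j) = (1 / s ^ k) *\<^sub>R (\<Sum>j\<le>n. s ^ j *\<^sub>R B j)"
    proof eventually_elim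
      case (elim s)
      have "(\<Sum>j\<le>n. s ^ j *\<^sub>R B j) = (\<Sum>j\<in>{k..n}. s ^ j *\<^sub>R B j)"
        using assms by (intro sum.mono_neutral_right) auto
      then have "(1 / s ^ k) *\<^sub>R (\<Sum>j\<le>n. s ^ j *\<^sub>R B j) = (\<Sum>j\<in>{k..n}. (s ^ j / s ^ k) *\<^sub>R B j)"
        by (simp add: scaleR_sum_right)
      also have "\<dots> = (\<Sum>j\<in>{k..n}. s ^ (j - k) *\<^sub>R B j)"
        using elim by (intro sum.cong refl) (simp add: power_diff)
      finally show ?case by simp
    qed
  qed
qed

context
  fixes S :: "(real^3) set" and u :: "real^3 \<Rightarrow> real" and z :: "real^3" and K :: real
  assumes S: "open S" "harmonic S u" "z \<in> S" and K: "K > 0" and qc: "\<And>x. x \<in> S \<Longrightarrow> qc_matrix K (hess u x)"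
begin

abbreviation "entry i j \<equiv> dd (axis i 1) (dd (axis j 1) u)"

lemma harmonic_entry: "harmonic S (entry i j)"
  by (intro harmonic_dd S)

lemma hess_leading_term:
  assumes flat: "\<And>m e. m < n \<Longrightarrow> hess ((dd e ^^ m) u) z = 0"
  shows "\<exists>r>0. \<exists>C\<ge>0. \<forall>e. norm e \<le> r \<longrightarrow> z + e \<in> S \<and>
     (\<forall>i j. \<bar>(hess u (z + e) - (1 / fact n) *\<^sub>R hess ((dd e ^^ n) u) z) $ i $ j\<bar> \<le> C * norm e ^ Suc n)"
proof -
  have "\<exists>r>0. \<exists>C\<ge>0. \<forall>e. norm e \<le> r \<longrightarrow> z + e \<in> S \<and> \<bar>entry i j (z + e) - (dd e ^^ n) (entry i j) z / fact n\<bar> \<le> C * norm e ^ Suc n" for i j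
    by (rule harmonic_leading_term[OF harmonic_entry S(1,3)]) (metis flat hess_ddn[OF S] zero_index)
  then obtain r C where rC: "\<And>i j. r i j > 0" "\<And>i j. C i j \<ge> 0"
     "\<And>i j e. norm e \<le> r i j \<Longrightarrow> z + e \<in> S \<and> \<bar>entry i j (z + e) - (dd e ^^ n) (entry i j) z / fact n\<bar> \<le> C i j * norm e ^ Suc n"
    by metis
  define R where "R = Min (range (\<lambda>(i, j). r i j))"
  define D where "D = Max (range (\<lambda>(i, j). C i j))"
  have R: "R > 0" "\<And>i j. R \<le> r i j" unfolding R_def using rC(1) by (auto intro!: Min_le)
  have D: "\<And>i j. C i j \<le> D" unfolding D_def by (auto intro!: Max_ge)
  have "D \<ge> 0" using D rC(2) order_trans by blast
  moreover have "z + e \<in> S \<and>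
     (\<forall>i j. \<bar>(hess u (z + e) - (1 / fact n) *\<^sub>R hess ((dd e ^^ n) u) z) $ i $ j\<bar> \<le> D * norm e ^ Suc n)" if e: "norm e \<le> R" for e
  proof (intro conjI allI)
    have *: "norm e \<le> r i j" for i j using e R order_trans by blast
    show "z + e \<in> S" using rC(3)[OF *] by blast
    fix i j
    have "\<bar>entry i j (z + e) - (dd e ^^ n) (entry i j) z / fact n\<bar> \<le> C i j * norm e ^ Suc n" using rC(3)[OF *] by blast
    also have "\<dots> \<le> D * norm e ^ Suc n" by (intro mult_right_mono D) simp
    finally show "\<bar>(hess u (z + e) - (1 / fact n) *\<^sub>R hess ((dd e ^^ n) u) z) $ i $ j\<bar> \<le> D * norm e ^ Suc n"
      by (simp add: hess_ddn[OF S] ) (simp add: hess_def)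
  qed
  ultimately show ?thesis using R(1) by blast
qed

text \<open>The leading term of the Hessian is the limit of \<open>n! t\<^sup>-\<^sup>n hess u (z + t e)\<close>, and the distortion inequality
  survives scaling and limits.\<close>

lemma qc_leading_term:
  assumes flat: "\<And>m e. m < n \<Longrightarrow> hess ((dd e ^^ m) u) z = 0"
  shows "qc_matrix K (hess ((dd e ^^ n) u) z)"
proof -
  obtain r C where r: "r > 0" "C \<ge> 0" "\<And>e. norm e \<le> r \<Longrightarrow> z + e \<in> S \<and>
     (\<forall>i j. \<bar>(hess u (z + e) - (1 / fact n) *\<^sub>R hess ((dd e ^^ n) u) z) $ i $ j\<bar> \<le> C * norm e ^ Suc n)"
    using hess_leading_term[OF flat] by metis
  define A where "A t = (fact n / t ^ n) *\<^sub>R hess u (z + t *\<^sub>R e)" for t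
  define \<rho> where "\<rho> = r / (1 + norm e)"
  have \<rho>: "\<rho> > 0" using r by (auto simp: \<rho>_def add_pos_nonneg)
  have ev: "\<forall>\<^sub>F t in at_right 0. 0 < t \<and> t < \<rho>"
    unfolding eventually_at_right_field using \<rho> by (intro exI[of _ \<rho>]) auto
  have nt: "norm (t *\<^sub>R e) \<le> r" if "0 < t" "t < \<rho>" for t
  proof -
    have "t * norm e \<le> \<rho> * (1 + norm e)" using that by (intro mult_mono) auto
    also have "\<rho> * (1 + norm e) = r" unfolding \<rho>_def
      using add_pos_nonneg[OF zero_less_one norm_ge_zero[of e]] by simp
    finally show ?thesis using that by simp
  qed
  have "(A \<longlongrightarrow> hess ((dd e ^^ n) u) z) (at_right 0)"
  proof (rule tendsto_matrix)
    fix i j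
    let ?L = "hess ((dd e ^^ n) u) z $ i $ j"
    have "\<forall>\<^sub>F t in at_right 0. norm (A t $ i $ j - ?L) \<le> (fact n * C * norm e ^ Suc n) * t"
      using ev
    proof eventually_elim
      case (elim t)
      then have t: "t > 0" by simp
      have L: "hess ((dd (t *\<^sub>R e) ^^ n) u) z $ i $ j = t ^ n * ?L"
        by (simp add: hess_ddn[OF S] ddn_scaleR[OF S(1) harmonic_entry S(3)])
      have "A t $ i $ j - ?L = (fact n / t ^ n) * ((hess u (z + t *\<^sub>R e) - (1 / fact n) *\<^sub>R hess ((dd (t *\<^sub>R e) ^^ n) u) z) $ i $ j)"
        using t by (simp add: A_def L field_simps)
      then have "norm (A t $ i $ j - ?L) = (fact n / t ^ n) * \<bar>(hess u (z + t *\<^sub>R e) - (1 / fact n) *\<^sub>R hess ((dd (t *\<^sub>R e) ^^ n) u) z) $ i $ j\<bar>"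
        using t by (simp add: abs_mult)
      also have "\<dots> \<le> (fact n / t ^ n) * (C * norm (t *\<^sub>R e) ^ Suc n)"
        using r(3)[OF nt[of t]] elim by (intro mult_left_mono) auto
      also have "\<dots> = (fact n * C * norm e ^ Suc n) * t"
        using t by (simp add: power_mult_distrib field_simps)
      finally show ?case .
    qed
    moreover have "((\<lambda>t. (fact n * C * norm e ^ Suc n) * t) \<longlongrightarrow> 0) (at_right 0)"
      by (rule tendsto_mult_right_zero) simp
    ultimately have "((\<lambda>t. A t $ i $ j - ?L) \<longlongrightarrow> 0) (at_right 0)"
      by (rule Lim_null_comparison)
    then show "((\<lambda>t. A t $ i $ j) \<longlongrightarrow> ?L) (at_right 0)" by (rule LIM_zero_cancel)
  qed
  then show ?thesis
  proof (rule qc_matrix_limit)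
    show "\<forall>\<^sub>F t in at_right 0. qc_matrix K (A t)"
      using ev by eventually_elim (auto simp: A_def intro!: qc_matrix_scaleR qc r(3)[THEN conjunct1] nt)
  qed simp
qed

text \<open>Suppose the leading term vanishes in the direction \<open>\<omega>\<close>. Expanding it at \<open>\<omega> + s y\<close> in powers of \<open>s\<close>,
  the first nonzero coefficient would again be of bounded distortion. But by the total symmetry of the derivatives of
  \<open>u\<close>, the image of \<open>\<omega>\<close> under that coefficient is the image of \<open>y\<close> under the preceding one, which is zero: the
  coefficient has a kernel and hence vanishes. So all coefficients vanish, including the last one, which does not depend on \<open>\<omega>\<close>.\<close>

lemma leading_term_nonzero:
  assumes flat: "\<And>m e. m < n \<Longrightarrow> hess ((dd e ^^ m) u) z = 0"
    and nz: "hess ((dd e0 ^^ n) u) z \<noteq> 0" and \<omega>: "\<omega> \<noteq> 0"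
  shows "hess ((dd \<omega> ^^ n) u) z \<noteq> 0"
proof
  assume zero: "hess ((dd \<omega> ^^ n) u) z = 0"
  define V where "V j y = (dd \<omega> ^^ (n - j)) ((dd y ^^ j) u)" for j y
  have HV: "harmonic S (V j y)" for j y unfolding V_def by (intro harmonic_ddn S)
  have Ventry: "hess (V j y) z $ a $ b = (dd \<omega> ^^ (n - j)) ((dd y ^^ j) (entry a b)) z" for j y a b
  proof -
    have "hess (V j y) z $ a $ b = (dd \<omega> ^^ (n - j)) (dd (axis a 1) (dd (axis b 1) ((dd y ^^ j) u))) z"
      unfolding V_def by (rule hess_ddn[OF S(1) harmonic_ddn[OF S(1,2)] S(3)])
    also have "\<dots> = (dd \<omega> ^^ (n - j)) ((dd y ^^ j) (entry a b)) z"
      by (rule ddn_cong[OF S(1) _ S(3)]) (use hess_ddn[OF S(1,2)] in \<open>simp add: hess_def\<close>)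
    finally show ?thesis .
  qed
  have "k \<le> n \<Longrightarrow> hess (V k y) z = 0" for k y
  proof (induction k arbitrary: y rule: less_induct)
    case (less k)
    show ?case
    proof (cases k)
      case 0 then show ?thesis using zero by (simp add: V_def)
    next
      case (Suc k')
      have sw: "dd \<omega> (V k y) x = dd y (V k' y) x" if x: "x \<in> S" for x
      proof -
        have nk: "n - k' = Suc (n - k)" using Suc less.prems by simp
        have "dd \<omega> (V k y) x = (dd \<omega> ^^ (n - k')) (dd y ((dd y ^^ k') u)) x"
          by (simp add: V_def nk Suc)
        also have "\<dots> = dd y ((dd \<omega> ^^ (n - k')) ((dd y ^^ k') u)) x"
          by (rule ddn_commute[OF S(1) harmonic_ddn[OF S(1,2)] x, symmetric])
        finally show ?thesis by (simp add: V_def)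
      qed
      have "(hess (V k y) z *v \<omega>) \<bullet> d = 0" for d
      proof -
        have "(hess (V k y) z *v \<omega>) \<bullet> d = dd d (dd \<omega> (V k y)) z" by (rule hess_dd[OF HV S(1,3)])
        also have "\<dots> = dd d (dd y (V k' y)) z" by (rule dd_cong[OF S(1,3) sw])
        also have "\<dots> = (hess (V k' y) z *v y) \<bullet> d" by (rule hess_dd[OF HV S(1,3), symmetric])
        also have "\<dots> = 0" using less.IH[of k' y] less.prems Suc by simp
        finally show ?thesis .
      qed
      then have "hess (V k y) z *v \<omega> = 0" using inner_eq_zero_iff by blast
      then have det0: "det (hess (V k y) z) = 0" using \<omega> by (rule det_zero_if_kernel)
      define B where "B j = real (n choose j) *\<^sub>R hess (V j y) z" for j
      have lim: "((\<lambda>s. (1 / s ^ k) *\<^sub>R (\<Sum>j\<le>n. s ^ j *\<^sub>R B j)) \<longlongrightarrow> B k) (at_right 0)"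
        by (rule matrix_sum_expansion_limit[OF less.prems]) (use less.IH less.prems in \<open>simp add: B_def\<close>)
      have N: "(\<Sum>j\<le>n. s ^ j *\<^sub>R B j) = hess ((dd (\<omega> + s *\<^sub>R y) ^^ n) u) z" for s
        by (simp add: vec_eq_iff B_def Ventry hess_ddn[OF S] ddn_binomial[OF S(1) harmonic_entry S(3)] mult_ac)
      have "qc_matrix K (B k)"
        by (rule qc_matrix_limit[OF lim]) (auto intro!: always_eventually qc_matrix_scaleR simp: N qc_leading_term[OF flat])
      moreover have "det (B k) = 0" by (simp add: B_def det_scaleR_3 det0)
      ultimately have "B k = 0" by (rule qc_matrix_singular)
      then show ?thesis using less.prems by (simp add: B_def)
    qed
  qed
  from this[of n e0] nz show False by (simp add: V_def)
qed

text \<open>The leading term is continuous in the direction and nonzero on the compact unit sphere, so it dominates the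
  Taylor remainder near \<open>z\<close>. An entry of the Hessian of comparable size then bounds the determinant from below.\<close>

lemma hess_det_lower_bound:
  assumes zero: "hess u z = 0" and nonflat: "\<not> (\<exists>\<delta>>0. \<forall>x\<in>ball z \<delta>. hess u x = 0)"
  shows "\<exists>n c r. c > 0 \<and> r > 0 \<and> (\<forall>e. 0 < norm e \<and> norm e < r \<longrightarrow> z + e \<in> S \<and> c * norm e ^ n \<le> \<bar>det (hess u (z + e))\<bar>)"
proof -
  have "\<exists>n e. hess ((dd e ^^ n) u) z \<noteq> 0"
  proof (rule ccontr)
    assume "\<not> ?thesis"
    then have *: "(dd e ^^ n) (entry i j) z = 0" for n e i j by (metis hess_ddn[OF S] zero_index)
    have "\<exists>\<delta>>0. \<forall>x\<in>ball z \<delta>. entry i j x = 0" for i j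
      by (rule harmonic_infinite_order_zero[OF harmonic_entry S(1,3) *])
    then obtain \<delta> where \<delta>: "\<And>i j. \<delta> i j > 0" "\<And>i j x. x \<in> ball z (\<delta> i j) \<Longrightarrow> entry i j x = 0" by metis
    define D where "D = Min (range (\<lambda>(i, j). \<delta> i j))"
    have D: "D > 0" "\<And>i j. D \<le> \<delta> i j" unfolding D_def using \<delta>(1) by (auto intro!: Min_le)
    have "hess u x = 0" if "x \<in> ball z D" for x
    proof -
      have "x \<in> ball z (\<delta> i j)" for i j using that D(2)[of i j] by simp
      then show ?thesis unfolding hess_def by (simp add: vec_eq_iff \<delta>(2))
    qed
    then show False using nonflat D(1) by blast
  qed
  then obtain n e0 where n: "hess ((dd e0 ^^ n) u) z \<noteq> 0" "\<And>m e. m < n \<Longrightarrow> hess ((dd e ^^ m) u) z = 0"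
    using exists_least_iff[of "\<lambda>n. \<exists>e. hess ((dd e ^^ n) u) z \<noteq> 0"] by blast
  define N where "N e = hess ((dd e ^^ n) u) z" for e
  have cN: "continuous_on UNIV N"
  proof -
    have "continuous_on UNIV (\<lambda>e. \<chi> i j. (dd e ^^ n) (entry i j) z)"
      by (intro continuous_on_vec_lambda ddn_continuous_direction[OF S(1) harmonic_entry S(3)])
    moreover have "N = (\<lambda>e. \<chi> i j. (dd e ^^ n) (entry i j) z)" by (simp add: N_def fun_eq_iff vec_eq_iff hess_ddn[OF S])
    ultimately show ?thesis by simp
  qed
  have "continuous_on (sphere 0 1) (\<lambda>\<omega>. norm (N \<omega>))"
    by (intro continuous_on_norm continuous_on_subset[OF cN]) simp
  then obtain \<omega>0 where \<omega>0: "\<omega>0 \<in> sphere 0 1" "\<And>\<omega>. \<omega> \<in> sphere 0 1 \<Longrightarrow> norm (N \<omega>0) \<le> norm (N \<omega>)"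
    using continuous_attains_inf[of "sphere (0::real^3) 1" "\<lambda>\<omega>. norm (N \<omega>)"] by fastforce
  define c where "c = norm (N \<omega>0)"
  have "\<omega>0 \<noteq> 0" using \<omega>0(1) by auto
  then have "c > 0" unfolding c_def N_def using leading_term_nonzero[OF n(2,1), of \<omega>0] by simp
  have Nge: "c * norm e ^ n \<le> norm (N e)" if "e \<noteq> 0" for e
  proof -
    have "N e = norm e ^ n *\<^sub>R N (e /\<^sub>R norm e)"
      using that by (simp add: N_def vec_eq_iff hess_ddn[OF S] ddn_scaleR[OF S(1) harmonic_entry S(3)] power_inverse field_simps)
    then have "norm (N e) = norm e ^ n * norm (N (e /\<^sub>R norm e))" by simp
    moreover have "c \<le> norm (N (e /\<^sub>R norm e))" unfolding c_def using that by (intro \<omega>0(2)) simp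
    ultimately have "norm e ^ n * c \<le> norm (N e)" by (simp add: mult_left_mono)
    then show ?thesis by (simp only: mult.commute)
  qed
  obtain r C where r: "r > 0" "C \<ge> 0" "\<And>e. norm e \<le> r \<Longrightarrow> z + e \<in> S \<and>
     (\<forall>i j. \<bar>(hess u (z + e) - (1 / fact n) *\<^sub>R N e) $ i $ j\<bar> \<le> C * norm e ^ Suc n)"
    using hess_leading_term[OF n(2)] unfolding N_def by metis
  have entries: "norm A \<le> 9 * b" if "\<And>i j. \<bar>A $ i $ j\<bar> \<le> b" for A :: "real^3^3" and b
  proof -
    have "norm A \<le> (\<Sum>i\<in>UNIV. norm (A $ i))" unfolding norm_vec_def by (rule L2_set_le_sum) simp
    also have "\<dots> \<le> (\<Sum>i\<in>(UNIV::3 set). 3 * b)"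
    proof (rule sum_mono)
      fix i
      have "norm (A $ i) \<le> (\<Sum>j\<in>UNIV. \<bar>A $ i $ j\<bar>)" by (rule norm_le_l1_cart)
      also have "\<dots> \<le> (\<Sum>j\<in>(UNIV::3 set). b)" by (intro sum_mono that)
      finally show "norm (A $ i) \<le> 3 * b" by simp
    qed
    finally show ?thesis by simp
  qed
  \<comment> \<open>Within this radius the Taylor remainder is at most half of the leading term.\<close>
  define \<rho> where "\<rho> = min r (c / (2 * fact n * (9 * C + 1)))"
  have \<rho>: "\<rho> > 0" using r \<open>c > 0\<close> by (simp add: \<rho>_def add_nonneg_pos)
  define c' where "c' = (c / (18 * fact n)) ^ 3 / K"
  have "z + e \<in> S \<and> c' * norm e ^ (3 * n) \<le> \<bar>det (hess u (z + e))\<bar>" if e: "0 < norm e" "norm e < \<rho>" for e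
  proof -
    have er: "norm e \<le> r" using e by (simp add: \<rho>_def)
    let ?A = "hess u (z + e)"
    have "norm (?A - (1 / fact n) *\<^sub>R N e) \<le> 9 * (C * norm e ^ Suc n)"
      by (rule entries) (use r(3)[OF er] in blast)
    also have "\<dots> = (9 * C * norm e) * norm e ^ n" by simp
    also have "\<dots> \<le> (c / (2 * fact n)) * norm e ^ n"
    proof (rule mult_right_mono)
      have "9 * C * norm e \<le> norm e * (9 * C + 1)" by (simp add: algebra_simps)
      also have "\<dots> \<le> c / (2 * fact n * (9 * C + 1)) * (9 * C + 1)"
        using e r by (intro mult_right_mono) (auto simp: \<rho>_def)
      also have "\<dots> = c / (2 * fact n)" using r(2) by simp
      finally show "9 * C * norm e \<le> c / (2 * fact n)" .
    qed simp
    finally have "norm (?A - (1 / fact n) *\<^sub>R N e) \<le> (c / (2 * fact n)) * norm e ^ n" .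
    moreover define q where "q = (c / (2 * fact n)) * norm e ^ n"
    ultimately have 1: "norm (?A - (1 / fact n) *\<^sub>R N e) \<le> q" by simp
    have 2: "2 * q \<le> norm ((1 / fact n) *\<^sub>R N e)"
      using Nge[of e] e by (simp add: q_def divide_right_mono)
    have 3: "norm ((1 / fact n) *\<^sub>R N e) \<le> norm ?A + norm (?A - (1 / fact n) *\<^sub>R N e)"
      using norm_triangle_ineq4[of ?A "?A - (1 / fact n) *\<^sub>R N e"] by simp
    have big: "q \<le> norm ?A" using 1 2 3 by linarith
    have q9: "q / 9 = (c / (18 * fact n)) * norm e ^ n" by (simp add: q_def)
    have "\<exists>i j. q / 9 \<le> \<bar>?A $ i $ j\<bar>"
    proof (rule ccontr)
      assume "\<not> ?thesis"
      then have lt: "\<bar>?A $ i $ j\<bar> < q / 9" for i j by (meson not_le)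
      define b where "b = Max (range (\<lambda>(i, j). \<bar>?A $ i $ j\<bar>))"
      have "b < q / 9" unfolding b_def using lt by (subst Max_less_iff) auto
      moreover have "norm ?A \<le> 9 * b" by (rule entries) (auto simp: b_def intro!: Max_ge)
      ultimately show False using big by simp
    qed
    then obtain i j where ij: "(c / (18 * fact n)) * norm e ^ n \<le> \<bar>?A $ i $ j\<bar>" unfolding q9 by blast
    have "((c / (18 * fact n)) * norm e ^ n) ^ 3 \<le> \<bar>?A $ i $ j\<bar> ^ 3"
      using ij \<open>c > 0\<close> by (intro power_mono) auto
    also have "\<dots> \<le> K * \<bar>det ?A\<bar>" by (rule qc_matrix_entry[OF qc]) (use r(3)[OF er] in blast)
    finally have "c' * norm e ^ (3 * n) \<le> \<bar>det ?A\<bar>"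
      using K by (simp add: c'_def power_mult_distrib power_mult[symmetric] mult.commute field_simps)
    then show ?thesis using r(3)[OF er] by blast
  qed
  moreover have "c' > 0" unfolding c'_def using \<open>c > 0\<close> K by simp
  ultimately show ?thesis using \<rho> by blast
qed

end

section \<open>Superharmonicity of the logarithm of the Hessian determinant\<close>

text \<open>Differentiate the quadratic form along the great circle \<open>cos t e + sin t v\<close> at its maximum.\<close>

lemma quadratic_form_max_critical:
  fixes A :: "real^'n^'n"
  assumes sym: "\<And>v w. (A *v v) \<bullet> w = (A *v w) \<bullet> v"
    and e: "norm e = 1" and max: "\<And>s t. norm (s *\<^sub>R e + t *\<^sub>R v) = 1 \<Longrightarrow> (A *v (s *\<^sub>R e + t *\<^sub>R v)) \<bullet> (s *\<^sub>R e + t *\<^sub>R v) \<le> (A *v e) \<bullet> e"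
    and v: "norm v = 1" "e \<bullet> v = 0"
  shows "(A *v e) \<bullet> v = 0"
proof -
  define m where "m = (A *v e) \<bullet> e"
  define p where "p = (A *v e) \<bullet> v"
  define q where "q = (A *v v) \<bullet> v"
  have n: "(norm (s *\<^sub>R e + t *\<^sub>R v))\<^sup>2 = s\<^sup>2 + t\<^sup>2" for s t
    using e v unfolding power2_norm_eq_inner
    by (simp add: inner_add inner_commute[of v e] norm_eq_1 power2_eq_square)
  have val: "(A *v (s *\<^sub>R e + t *\<^sub>R v)) \<bullet> (s *\<^sub>R e + t *\<^sub>R v) = s\<^sup>2 * m + 2 * s * t * p + t\<^sup>2 * q" for s t
    using sym[of v e] by (simp add: matrix_vector_right_distrib matrix_vector_mult_scaleR inner_add m_def p_def q_def power2_eq_square algebra_simps)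
  have "((\<lambda>t. (cos t)\<^sup>2 * m + 2 * cos t * sin t * p + (sin t)\<^sup>2 * q) has_real_derivative 2 * p) (at 0)"
    by (auto intro!: derivative_eq_intros)
  moreover have "(cos t)\<^sup>2 * m + 2 * cos t * sin t * p + (sin t)\<^sup>2 * q \<le> m" for t
  proof -
    have "(norm (cos t *\<^sub>R e + sin t *\<^sub>R v))\<^sup>2 = 1" unfolding n by simp
    then have "norm (cos t *\<^sub>R e + sin t *\<^sub>R v) = 1" by (metis norm_ge_zero one_power2 power2_eq_imp_eq zero_le_one)
    from max[OF this] show ?thesis unfolding val m_def[symmetric] .
  qed
  ultimately have "2 * p = 0"
    by (intro DERIV_local_max[where f = "\<lambda>t. (cos t)\<^sup>2 * m + 2 * cos t * sin t * p + (sin t)\<^sup>2 * q" and x = 0 and d = 1]) auto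
  then show ?thesis by (simp add: p_def)
qed

text \<open>Maximize the quadratic form over the unit sphere, then over the unit circle orthogonal to the first maximizer;
  the cross product completes the frame.\<close>

lemma symmetric_matrix_3_diagonalizable:
  fixes A :: "real^3^3"
  assumes sym: "\<And>v w. (A *v v) \<bullet> w = (A *v w) \<bullet> v"
  shows "\<exists>e :: 3 \<Rightarrow> real^3. orthonormal_frame e \<and> (\<forall>i j. i \<noteq> j \<longrightarrow> (A *v e i) \<bullet> e j = 0)"
proof -
  have cq: "continuous_on X (\<lambda>v. (A *v v) \<bullet> v)" for X
    by (intro continuous_intros linear_continuous_on) (simp add: matrix_vector_mul_bounded_linear)
  obtain a where a: "norm a = 1" "\<And>v. norm v = 1 \<Longrightarrow> (A *v v) \<bullet> v \<le> (A *v a) \<bullet> a"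
    using continuous_attains_sup[OF compact_sphere _ cq, of 0 1] by fastforce
  have a0: "(A *v a) \<bullet> v = 0" if "norm v = 1" "a \<bullet> v = 0" for v
    by (rule quadratic_form_max_critical[OF sym a(1) a(2) that])
  have comp: "compact (sphere 0 1 \<inter> {v. a \<bullet> v = 0})"
    by (intro compact_Int_closed compact_sphere closed_hyperplane)
  obtain b0 where b0: "norm b0 = 1" "a \<bullet> b0 = 0"
  proof -
    obtain y where y: "y \<noteq> 0" "orthogonal a y" using orthogonal_to_vector_exists[of a] by auto
    then show thesis using that[of "y /\<^sub>R norm y"] by (simp add: orthogonal_def)
  qed
  then have "sphere 0 1 \<inter> {v. a \<bullet> v = 0} \<noteq> {}" by auto
  then obtain b where b: "norm b = 1" "a \<bullet> b = 0" "\<And>v. norm v = 1 \<Longrightarrow> a \<bullet> v = 0 \<Longrightarrow> (A *v v) \<bullet> v \<le> (A *v b) \<bullet> b"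
    using continuous_attains_sup[OF comp _ cq] by fastforce
  define c where "c = cross3 a b"
  have c: "a \<bullet> c = 0" "b \<bullet> c = 0" unfolding c_def using dot_cross_self by auto
  have nc: "norm c = 1"
  proof -
    have "(norm c)\<^sup>2 = 1" using norm_cross_dot[of a b] a b by (simp add: c_def)
    then show ?thesis by (metis norm_ge_zero one_power2 power2_eq_imp_eq zero_le_one)
  qed
  have b0: "(A *v b) \<bullet> c = 0"
    by (rule quadratic_form_max_critical[OF sym b(1) b(3) nc c(2)]) (simp_all add: inner_add b c)
  define e :: "3 \<Rightarrow> real^3" where "e i = (if i = 1 then a else if i = 2 then b else c)" for i
  have e: "e 1 = a" "e 2 = b" "e 3 = c" by (simp_all add: e_def)
  have "orthonormal_frame e"
    unfolding orthonormal_frame_def forall_3 e using a b c nc by (simp add: norm_eq_1 inner_commute)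
  moreover have "\<forall>i j. i \<noteq> j \<longrightarrow> (A *v e i) \<bullet> e j = 0"
    unfolding forall_3 e using a0[OF b(1,2)] a0[OF nc c(1)] b0 sym[of b a] sym[of c a] sym[of c b] by simp
  ultimately show ?thesis by blast
qed

lemma det_in_orthonormal_frame:
  fixes A :: "real^'n^'n" and e :: "'n \<Rightarrow> real^'n"
  assumes "orthonormal_frame e"
  shows "det (\<chi> i j. (A *v e j) \<bullet> e i) = det A"
proof -
  have "(det (\<chi> i. e i))\<^sup>2 = 1" using det_orthogonal_matrix[OF orthonormal_frame_matrix[OF assms]] by auto
  then show ?thesis unfolding matrix_in_frame by (simp add: det_mul power2_eq_square mult.left_commute)
qed

lemma orthonormal_frame_norm_sq:
  fixes e :: "'n \<Rightarrow> real^'n"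
  assumes "orthonormal_frame e"
  shows "(\<Sum>i\<in>UNIV. (x \<bullet> e i)\<^sup>2) = (norm x)\<^sup>2"
proof -
  define E where "E = (\<chi> i. e i)"
  have "orthogonal_matrix E" using orthonormal_frame_matrix[OF assms] by (simp add: E_def)
  then have "norm (E *v x) = norm x"
    using orthogonal_transformation_matrix[of "(*v) E"] orthogonal_transformation_norm[of "(*v) E" x] by simp
  moreover have "(norm (E *v x))\<^sup>2 = (\<Sum>i\<in>UNIV. (x \<bullet> e i)\<^sup>2)"
    unfolding power2_norm_eq_inner
    by (simp add: inner_vec_def E_def matrix_vector_mult_def power2_eq_square mult.commute)
  ultimately show ?thesis by simp
qed

text \<open>Here \<open>l1\<close>, \<open>l2\<close>, \<open>l3\<close> are the eigenvalues of the Hessian and \<open>T\<close> is the tensor of third derivatives. In the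
  direction \<open>k\<close> the first derivative of the determinant is \<open>d k\<close> and, up to terms that cancel in the sum over \<open>k\<close>, the
  second is \<open>2 * s k\<close>. The contributions of \<open>T 1 2 3\<close> cancel because \<open>l1 + l2 + l3 = 0\<close>. The remaining components fall into three groups,
  one for each index that occurs an odd number of times; after the trace condition has eliminated one component, each group is
  minus a square.\<close>

lemma lewy_quadratic_form:
  fixes l1 l2 l3 :: real and T :: "3 \<Rightarrow> 3 \<Rightarrow> 3 \<Rightarrow> real"
  assumes l: "l1 + l2 + l3 = 0"
    and sym: "\<And>i j k. T i j k = T j i k" "\<And>i j k. T i j k = T i k j"
    and tr: "\<And>k. T 1 1 k + T 2 2 k + T 3 3 k = 0"
  defines "d k \<equiv> T 1 1 k * l2 * l3 + T 2 2 k * l1 * l3 + T 3 3 k * l1 * l2"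
    and "s k \<equiv> T 1 1 k * T 2 2 k * l3 + T 1 1 k * T 3 3 k * l2 + T 2 2 k * T 3 3 k * l1
         - (T 2 3 k)\<^sup>2 * l1 - (T 1 3 k)\<^sup>2 * l2 - (T 1 2 k)\<^sup>2 * l3"
  shows "(\<Sum>k\<in>UNIV. 2 * s k * (l1 * l2 * l3) - (d k)\<^sup>2) \<le> 0"
proof -
  define a1 b1 c1 where "a1 = T 1 1 1" "b1 = T 1 2 2" "c1 = T 1 3 3"
  define a2 b2 c2 where "a2 = T 2 2 2" "b2 = T 1 1 2" "c2 = T 2 3 3"
  define a3 b3 c3 where "a3 = T 3 3 3" "b3 = T 1 1 3" "c3 = T 2 2 3"
  define t where "t = T 1 2 3"
  have e: "T 1 1 1 = a1" "T 2 2 1 = b1" "T 3 3 1 = c1" "T 2 2 2 = a2" "T 1 1 2 = b2" "T 3 3 2 = c2"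
    "T 3 3 3 = a3" "T 1 1 3 = b3" "T 2 2 3 = c3" "T 2 3 1 = t" "T 1 3 1 = b3" "T 1 2 1 = b2"
    "T 2 3 2 = c3" "T 1 3 2 = t" "T 1 2 2 = b1" "T 2 3 3 = c2" "T 1 3 3 = c1" "T 1 2 3 = t"
    unfolding a1_b1_c1_def a2_b2_c2_def a3_b3_c3_def t_def by (metis sym)+
  have a: "a1 = - b1 - c1" "a2 = - b2 - c2" "a3 = - b3 - c3" using tr[of 1] tr[of 2] tr[of 3] by (simp_all add: e)
  \<comment> \<open>Eliminating \<open>l1\<close> and the pure third derivatives turns the claim into a polynomial identity.\<close>
  have l3: "l1 = - l2 - l3" using l by simp
  have "(\<Sum>k\<in>UNIV. 2 * s k * (l1 * l2 * l3) - (d k)\<^sup>2) =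
     - ((b1 * l3\<^sup>2 + c1 * l2\<^sup>2)\<^sup>2 + (b2 * l3\<^sup>2 + c2 * l1\<^sup>2)\<^sup>2 + (b3 * l2\<^sup>2 + c3 * l1\<^sup>2)\<^sup>2)"
    unfolding sum_3 s_def d_def e a l3 by (simp add: power2_eq_square algebra_simps)
  also have "\<dots> \<le> 0" by (simp only: neg_le_0_iff_le) (intro add_nonneg_nonneg zero_le_power2)
  finally show ?thesis .
qed

text \<open>In the diagonalizing frame only the terms of \<open>lewy_quadratic_form\<close> survive: the second derivatives of
  the entries enter linearly and cancel in the Laplacian, the entries being harmonic.\<close>

lemma ln_det_hess_superharmonic:
  fixes u :: "real^3 \<Rightarrow> real"
  assumes S: "harmonic S u" "open S" "x \<in> S" and nz: "det (hess u x) \<noteq> 0"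
  obtains e :: "3 \<Rightarrow> real^3" and a b where "orthonormal_frame e"
    "\<And>i j. i \<noteq> j \<Longrightarrow> (hess u x *v e i) \<bullet> e j = 0"
    "\<And>k. jet2 (\<lambda>t. ln ((det (hess u (x + t *\<^sub>R e k)))\<^sup>2)) (ln ((det (hess u x))\<^sup>2)) (a k) (b k)"
    "(\<Sum>k\<in>UNIV. b k) \<le> 0"
proof -
  have "(hess u x *v v) \<bullet> w = (hess u x *v w) \<bullet> v" for v w
    by (simp add: hess_dd[OF S] dd_commute[OF S])
  then obtain e :: "3 \<Rightarrow> real^3" where e: "orthonormal_frame e" "\<And>i j. i \<noteq> j \<Longrightarrow> (hess u x *v e i) \<bullet> e j = 0"
    using symmetric_matrix_3_diagonalizable[of "hess u x"] by blast
  define h where "h i j = dd (e i) (dd (e j) u)" for i j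
  have Hh: "harmonic S (h i j)" for i j unfolding h_def by (intro harmonic_dd S)
  define J where "J y = h 1 1 y * h 2 2 y * h 3 3 y + h 1 2 y * h 2 3 y * h 3 1 y + h 1 3 y * h 2 1 y * h 3 2 y
     - h 1 1 y * h 2 3 y * h 3 2 y - h 1 2 y * h 2 1 y * h 3 3 y - h 1 3 y * h 2 2 y * h 3 1 y" for y
  have detJ: "det (hess u y) = J y" if "y \<in> S" for y
  proof -
    have "det (hess u y) = det (\<chi> i j. h i j y)"
      using det_in_orthonormal_frame[OF e(1), of "hess u y"] by (simp add: hess_dd[OF S(1,2) that] h_def)
    then show ?thesis by (simp add: det_3 J_def)
  qed
  have off: "h i j x = 0" if "i \<noteq> j" for i j
    using e(2)[of j i] that by (simp add: hess_dd[OF S] h_def)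
  define T where "T i j k = dd (e k) (h i j) x" for i j k
  have T1: "T i j k = T j i k" for i j k unfolding T_def h_def
    by (rule dd_cong[OF S(2,3)]) (rule dd_commute[OF S(1,2)])
  have T2: "T i j k = T i k j" for i j k
  proof -
    have "T i j k = T j i k" by (rule T1)
    also have "\<dots> = T k i j" unfolding T_def h_def by (rule dd_commute[OF harmonic_dd[OF S(2,1)] S(2,3)])
    also have "\<dots> = T i k j" by (rule T1)
    finally show ?thesis .
  qed
  define Q where "Q i j k = dd (e k) (dd (e k) (h i j)) x" for i j k
  have Qsum: "(\<Sum>k\<in>UNIV. Q i j k) = 0" for i j unfolding Q_def
    by (rule harmonic_laplacian_frame[OF Hh S(2,3) e(1)])
  have tr: "T 1 1 k + T 2 2 k + T 3 3 k = 0" for k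
  proof -
    have "T i i k = dd (e i) (dd (e i) (dd (e k) u)) x" for i
      using T2[of i i k] by (simp add: T_def h_def)
    then show ?thesis using harmonic_laplacian_frame[OF harmonic_dd[OF S(2,1)] S(2,3) e(1), of "e k"] by (simp add: sum_3)
  qed
  define l where "l i = h i i x" for i
  have ltr: "l 1 + l 2 + l 3 = 0"
    using harmonic_laplacian_frame[OF S e(1)] by (simp add: sum_3 l_def h_def)
  have jh: "jet2 (\<lambda>t. h i j (x + t *\<^sub>R e k)) (h i j x) (T i j k) (Q i j k)" for i j k
    unfolding T_def Q_def by (rule harmonic_jet2[OF Hh S(2,3)])
  define d where "d k = T 1 1 k * l 2 * l 3 + T 2 2 k * l 1 * l 3 + T 3 3 k * l 1 * l 2" for k
  define s where "s k = T 1 1 k * T 2 2 k * l 3 + T 1 1 k * T 3 3 k * l 2 + T 2 2 k * T 3 3 k * l 1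
         - (T 2 3 k)\<^sup>2 * l 1 - (T 1 3 k)\<^sup>2 * l 2 - (T 1 2 k)\<^sup>2 * l 3" for k
  define q where "q k = Q 1 1 k * l 2 * l 3 + Q 2 2 k * l 1 * l 3 + Q 3 3 k * l 1 * l 2" for k
  have J0: "J x = l 1 * l 2 * l 3" unfolding J_def l_def by (simp add: off)
  have jJ: "jet2 (\<lambda>t. J (x + t *\<^sub>R e k)) (J x) (d k) (2 * s k + q k)" for k
  proof -
    note m = jet2_mult[OF jet2_mult[OF jh[of _ _ k] jh[of _ _ k]] jh[of _ _ k]]
    note j = jet2_diff[OF jet2_diff[OF jet2_diff[OF jet2_add[OF jet2_add[OF m[of 1 1 2 2 3 3] m[of 1 2 2 3 3 1]] m[of 1 3 2 1 3 2]]
       m[of 1 1 2 3 3 2]] m[of 1 2 2 1 3 3]] m[of 1 3 2 2 3 1]]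
    have T': "T 2 1 k = T 1 2 k" "T 3 1 k = T 1 3 k" "T 3 2 k = T 2 3 k" by (rule T1)+
    show ?thesis unfolding J_def
      by (rule jet2_cong[OF j]) (simp_all add: off l_def[symmetric] T' d_def s_def q_def power2_eq_square algebra_simps)
  qed
  have Jnz: "J x \<noteq> 0" using nz detJ[OF S(3)] by simp
  have jets: "jet2 (\<lambda>t. ln ((det (hess u (x + t *\<^sub>R e k)))\<^sup>2)) (ln ((det (hess u x))\<^sup>2))
     (2 * d k / J x) (2 * ((2 * s k + q k) * J x - (d k)\<^sup>2) / (J x)\<^sup>2)" for k
  proof -
    have "jet2 (\<lambda>t. ln (J (x + t *\<^sub>R e k) * J (x + t *\<^sub>R e k))) (ln (J x * J x))
     (2 * d k / J x) (2 * ((2 * s k + q k) * J x - (d k)\<^sup>2) / (J x)\<^sup>2)"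
      by (rule jet2_cong[OF jet2_ln[OF jet2_mult[OF jJ jJ]]])
        (use Jnz in \<open>auto simp: field_simps power2_eq_square zero_less_mult_iff\<close>)
    moreover have "\<forall>\<^sub>F t in nhds 0. (J (x + t *\<^sub>R e k))\<^sup>2 = (det (hess u (x + t *\<^sub>R e k)))\<^sup>2"
      using eventually_line_in_open[OF S(2,3), of "e k"] by eventually_elim (simp add: detJ)
    ultimately show ?thesis unfolding detJ[OF S(3)] power2_eq_square[symmetric]
      by (rule jet2_transform[OF _ eventually_mono]) simp
  qed
  have qsum: "(\<Sum>k\<in>UNIV. q k) = 0"
  proof -
    have "(\<Sum>k\<in>UNIV. q k) = (\<Sum>k\<in>UNIV. Q 1 1 k) * (l 2 * l 3) + (\<Sum>k\<in>UNIV. Q 2 2 k) * (l 1 * l 3) + (\<Sum>k\<in>UNIV. Q 3 3 k) * (l 1 * l 2)"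
      by (simp add: q_def sum.distrib sum_distrib_right mult.assoc)
    then show ?thesis by (simp add: Qsum)
  qed
  have "(\<Sum>k\<in>UNIV. 2 * ((2 * s k + q k) * J x - (d k)\<^sup>2) / (J x)\<^sup>2)
     = (2 / (J x)\<^sup>2) * ((\<Sum>k\<in>UNIV. 2 * s k * J x - (d k)\<^sup>2) + (\<Sum>k\<in>UNIV. q k) * J x)"
    by (simp add: sum_3 algebra_simps add_divide_distrib diff_divide_distrib)
  also have "\<dots> \<le> 0"
  proof -
    have "(\<Sum>k\<in>UNIV. 2 * s k * J x - (d k)\<^sup>2) \<le> 0"
      unfolding J0 d_def s_def by (rule lewy_quadratic_form[OF ltr T1 T2 tr])
    then show ?thesis unfolding qsum by (intro mult_nonneg_nonpos) auto
  qed
  finally show thesis using that[OF e jets] by blast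
qed

section \<open>Nonvanishing of the Jacobian\<close>

lemma continuous_on_det_hess:
  fixes u :: "real^3 \<Rightarrow> real"
  assumes "harmonic S u" "open S"
  shows "continuous_on S (\<lambda>x. det (hess u x))"
  unfolding det_3 hess_def vec_lambda_beta
  by (intro continuous_intros harmonic_continuous_on harmonic_dd assms)

lemma square_dominates_linear:
  fixes L :: real
  assumes "\<epsilon> > 0" "L \<le> - ((a + \<bar>b\<bar>) / \<epsilon> + 1)" "a \<ge> 0"
  shows "b \<le> \<epsilon> * L\<^sup>2 + a * L"
proof -
  have 1: "- L \<ge> 1" using assms by (smt (verit) divide_nonneg_pos)
  have "\<epsilon> * (- L) \<ge> \<epsilon> * ((a + \<bar>b\<bar>) / \<epsilon> + 1)" using assms by (intro mult_left_mono) auto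
  moreover have "\<epsilon> * ((a + \<bar>b\<bar>) / \<epsilon> + 1) = a + \<bar>b\<bar> + \<epsilon>"
    unfolding distrib_left using assms(1) by simp
  ultimately have 2: "\<epsilon> * (- L) - a \<ge> \<bar>b\<bar>" using assms(1) by linarith
  have "\<bar>b\<bar> \<le> (- L) * (\<epsilon> * (- L) - a)"
    using mult_mono[OF 1 2] 1 by simp
  also have "\<dots> = \<epsilon> * L\<^sup>2 + a * L" by (simp add: algebra_simps power2_eq_square)
  finally show ?thesis by simp
qed

text \<open>The square of \<open>ln q\<close>, \<open>q = \<bar>y - z\<bar>\<^sup>2\<close>, is superharmonic near \<open>z\<close> in dimension three, and at \<open>z\<close> it grows faster
  than every multiple of \<open>\<bar>ln q\<bar>\<close>.\<close>

lemma ln_norm_sq_squared_jet: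
  fixes y z e :: "'a::euclidean_space"
  assumes "y \<noteq> z" "norm e = 1"
  defines "q \<equiv> (norm (y - z))\<^sup>2"
  shows "jet2 (\<lambda>t. (ln ((norm (y + t *\<^sub>R e - z))\<^sup>2))\<^sup>2) ((ln q)\<^sup>2) (4 * ln q * ((y - z) \<bullet> e) / q)
    (8 * ((y - z) \<bullet> e)\<^sup>2 / q\<^sup>2 + 4 * ln q * (1 / q - 2 * ((y - z) \<bullet> e)\<^sup>2 / q\<^sup>2))"
proof -
  have q: "q > 0" using assms by simp
  have "jet2 (\<lambda>t. (norm (y - z + t *\<^sub>R e))\<^sup>2) q (2 * ((y - z) \<bullet> e)) 2"
    using jet2_norm_sq[of "y - z" e] assms by simp
  from jet2_ln[OF this q] have l: "jet2 (\<lambda>t. ln ((norm (y - z + t *\<^sub>R e))\<^sup>2)) (ln q) (2 * ((y - z) \<bullet> e) / q) (2 / q - (2 * ((y - z) \<bullet> e))\<^sup>2 / q\<^sup>2)" .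
  have eq: "y + t *\<^sub>R e - z = y - z + t *\<^sub>R e" for t by simp
  show ?thesis unfolding eq power2_eq_square[of "ln _"]
    by (rule jet2_cong[OF jet2_mult[OF l l]]) (use q in \<open>simp_all add: field_simps power2_eq_square\<close>)
qed

text \<open>Near a zero \<open>z\<close>, \<open>v = ln (det\<^sup>2)\<close> is superharmonic and bounded below by a multiple of \<open>ln \<bar>y - z\<bar>\<^sup>2\<close>
  plus a constant. After
  adding \<open>\<epsilon> (ln \<bar>y - z\<bar>\<^sup>2)\<^sup>2\<close> it tends to infinity at \<open>z\<close>, so the minimum principle compares it with its values on a
  fixed sphere. Letting \<open>\<epsilon>\<close> tend to \<open>0\<close> bounds \<open>v\<close> from below, which contradicts the continuity of the determinant at \<open>z\<close>.\<close>

lemma det_hess_nonzero: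
  fixes u :: "real^3 \<Rightarrow> real"
  assumes S: "open S" "harmonic S u" "z \<in> S" and K: "K > 0" and qc: "\<And>x. x \<in> S \<Longrightarrow> qc_matrix K (hess u x)"
    and nonflat: "\<not> (\<exists>\<delta>>0. \<forall>x\<in>ball z \<delta>. hess u x = 0)"
  shows "det (hess u z) \<noteq> 0"
proof
  assume d0: "det (hess u z) = 0"
  then have "hess u z = 0" using qc_matrix_singular qc S(3) by blast
  then obtain n c r where ncr: "c > 0" "r > 0"
      "\<And>e. 0 < norm e \<Longrightarrow> norm e < r \<Longrightarrow> z + e \<in> S \<and> c * norm e ^ n \<le> \<bar>det (hess u (z + e))\<bar>"
    using hess_det_lower_bound[OF S K qc _ nonflat] by blast
  \<comment> \<open>The bound \<open>exp (- 1)\<close> ensures \<open>ln \<bar>y - z\<bar>\<^sup>2 \<le> -2\<close>, where \<open>(ln \<bar>y - z\<bar>\<^sup>2)\<^sup>2\<close> is superharmonic.\<close>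
  define r0 where "r0 = min (r / 2) (exp (- 1))"
  have r0: "r0 > 0" "r0 < r" "r0 \<le> exp (-1)" using ncr by (auto simp: r0_def)
  have low: "y \<in> S \<and> c * norm (y - z) ^ n \<le> \<bar>det (hess u y)\<bar>" if "y \<noteq> z" "norm (y - z) \<le> r0" for y
    using ncr(3)[of "y - z"] that r0 by simp
  define v where "v y = ln ((det (hess u y))\<^sup>2)" for y
  have dnz: "det (hess u y) \<noteq> 0" if "y \<noteq> z" "norm (y - z) \<le> r0" for y
  proof -
    have "c * norm (y - z) ^ n > 0" using that ncr(1) by simp
    then show ?thesis using low[OF that] by auto
  qed
  have cdet: "continuous_on S (\<lambda>x. det (hess u x))" by (rule continuous_on_det_hess[OF S(2,1)])
  have cv: "continuous_on X v" if "\<And>y. y \<in> X \<Longrightarrow> y \<noteq> z \<and> norm (y - z) \<le> r0" for X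
    unfolding v_def using that dnz low
    by (intro continuous_intros continuous_on_subset[OF cdet]) auto
  have "compact (v ` sphere z r0)"
    by (intro compact_continuous_image cv compact_sphere) (use r0 in \<open>auto simp: dist_norm norm_minus_commute\<close>)
  then have "bounded (v ` sphere z r0)" by (rule compact_imp_bounded)
  then obtain B where "\<forall>y\<in>v ` sphere z r0. norm y \<le> B" unfolding bounded_iff by blast
  then have "\<bar>v y\<bar> \<le> B" if "y \<in> sphere z r0" for y using that by simp
  then have m: "- B \<le> v y" if "norm (y - z) = r0" for y using that
    by (metis abs_le_D2 dist_norm dist_commute mem_sphere minus_le_iff)
  define m where "m = - B"
  have main: "m \<le> v x + \<epsilon> * (ln ((norm (x - z))\<^sup>2))\<^sup>2" if x: "x \<noteq> z" "norm (x - z) \<le> r0" and \<epsilon>: "\<epsilon> > 0" for x \<epsilon>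
  proof -
    define w where "w y = - (v y + \<epsilon> * (ln ((norm (y - z))\<^sup>2))\<^sup>2)" for y
    define X where "X = (real n + \<bar>m - 2 * ln c\<bar>) / \<epsilon> + 1"
    \<comment> \<open>On the inner sphere \<open>ln \<rho>\<^sup>2 \<le> - X\<close>, so the squared logarithm outweighs the lower bound for \<open>v\<close>.\<close>
    define \<rho> where "\<rho> = min (norm (x - z)) (exp (- X / 2))"
    have \<rho>: "\<rho> > 0" "\<rho> \<le> norm (x - z)" "\<rho> \<le> exp (- X / 2)" using x by (auto simp: \<rho>_def)
    define A where "A = {y. \<rho> \<le> norm (y - z)} \<inter> cball z r0"
    define U where "U = {y. \<rho> < norm (y - z)} \<inter> ball z r0"
    have inA: "y \<noteq> z" "norm (y - z) \<le> r0" "\<rho> \<le> norm (y - z)" if "y \<in> A" for y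
      using that \<rho> by (auto simp: A_def dist_norm norm_minus_commute)
    have "w x \<le> - m"
    proof (rule maximum_principle[where K = A and U = U])
      show "compact A" unfolding A_def
        by (intro closed_Int_compact compact_cball closed_Collect_le continuous_intros)
      show "open U" unfolding U_def
        by (intro open_Int open_ball open_Collect_less continuous_intros)
      show "U \<subseteq> A" by (auto simp: U_def A_def)
      show "continuous_on A w" unfolding w_def using inA
        by (intro continuous_intros cv) auto
      show "x \<in> A" using x \<rho> by (auto simp: A_def dist_norm norm_minus_commute)
      show "w y \<le> - m" if y: "y \<in> A - U" for y
      proof -
        have yA: "y \<in> A" using y by simp
        consider "norm (y - z) = r0" | "norm (y - z) = \<rho>" using y inA[OF yA] by (force simp: U_def dist_norm norm_minus_commute)
        then show ?thesis
        proof cases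
          case 1
          have "0 \<le> \<epsilon> * (ln ((norm (y - z))\<^sup>2))\<^sup>2" using \<epsilon> by simp
          then show ?thesis using m[OF 1] by (simp add: w_def m_def)
        next
          case 2
          define L where "L = ln (\<rho>\<^sup>2)"
          have Lr: "L = 2 * ln \<rho>" using \<rho> by (simp add: L_def ln_realpow)
          have "ln \<rho> \<le> ln (exp (- X / 2))" using \<rho> by (subst ln_le_cancel_iff) auto
          then have L: "L \<le> - X" by (simp add: Lr)
          have "(c * \<rho> ^ n)\<^sup>2 \<le> (det (hess u y))\<^sup>2"
            using low[OF inA(1,2)[OF yA]] 2 ncr(1) \<rho> by (metis abs_le_square_iff abs_of_nonneg mult_nonneg_nonneg less_imp_le zero_le_power)
          then have "ln ((c * \<rho> ^ n)\<^sup>2) \<le> v y" unfolding v_def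
            using dnz[OF inA(1,2)[OF yA]] ncr(1) \<rho> by (subst ln_le_cancel_iff) auto
          moreover have "ln ((c * \<rho> ^ n)\<^sup>2) = 2 * ln c + real n * L"
            using ncr(1) \<rho> by (simp add: ln_realpow ln_mult Lr algebra_simps)
          moreover have "m - 2 * ln c \<le> \<epsilon> * L\<^sup>2 + real n * L"
            by (rule square_dominates_linear[OF \<epsilon>]) (use L in \<open>auto simp: X_def\<close>)
          ultimately show ?thesis by (simp add: w_def 2 L_def)
        qed
      qed
      fix y assume y: "y \<in> U"
      then have yA: "y \<in> A" by (auto simp: U_def A_def)
      have yS: "y \<in> S" using low inA[OF yA] by blast
      obtain e :: "3 \<Rightarrow> real^3" and a b where e: "orthonormal_frame e"
        and jv: "\<And>k. jet2 (\<lambda>t. ln ((det (hess u (y + t *\<^sub>R e k)))\<^sup>2)) (ln ((det (hess u y))\<^sup>2)) (a k) (b k)"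
        and bs: "(\<Sum>k\<in>UNIV. b k) \<le> 0"
        using ln_det_hess_superharmonic[OF S(2,1) yS dnz[OF inA(1,2)[OF yA]]] by metis
      note ne = norm_orthonormal_frame[OF e]
      define q where "q = (norm (y - z))\<^sup>2"
      define L where "L = ln q"
      have q: "q > 0" using inA[OF yA] by (simp add: q_def)
      have "norm (y - z) \<le> exp (-1)" using inA[OF yA] r0 by simp
      then have "q \<le> (exp (-1))\<^sup>2" unfolding q_def by (intro power_mono) auto
      also have "(exp (-1::real))\<^sup>2 = exp (-2)" by (simp add: power2_eq_square exp_add[symmetric])
      finally have L: "L \<le> -2" unfolding L_def using q by (metis exp_gt_zero ln_exp ln_le_cancel_iff)
      define B2 where "B2 k = 8 * ((y - z) \<bullet> e k)\<^sup>2 / q\<^sup>2 + 4 * L * (1 / q - 2 * ((y - z) \<bullet> e k)\<^sup>2 / q\<^sup>2)" for k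
      have sq: "(\<Sum>k\<in>UNIV. ((y - z) \<bullet> e k)\<^sup>2) = q" unfolding q_def by (rule orthonormal_frame_norm_sq[OF e])
      have "(\<Sum>k\<in>UNIV. B2 k) = 8 * (\<Sum>k\<in>UNIV. ((y - z) \<bullet> e k)\<^sup>2) / q\<^sup>2 + 4 * L * (3 / q - 2 * (\<Sum>k\<in>UNIV. ((y - z) \<bullet> e k)\<^sup>2) / q\<^sup>2)"
        unfolding B2_def sum_3 by (simp add: algebra_simps add_divide_distrib diff_divide_distrib)
      also have "\<dots> = (8 + 4 * L) / q" unfolding sq using q by (simp add: power2_eq_square field_simps)
      also have "\<dots> \<le> 0" using L q by (simp add: divide_nonpos_pos)
      finally have B2: "(\<Sum>k\<in>UNIV. B2 k) \<le> 0" .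
      have jw: "jet2 (\<lambda>t. w (y + t *\<^sub>R e k)) (w y) (- (a k + \<epsilon> * (4 * L * ((y - z) \<bullet> e k) / q))) (- (b k + \<epsilon> * B2 k))" for k
        unfolding w_def v_def B2_def L_def q_def
        by (intro jet2_minus jet2_add jet2_cmult jv ln_norm_sq_squared_jet[OF inA(1)[OF yA] ne])
      have "(\<Sum>k\<in>UNIV. - (b k + \<epsilon> * B2 k)) = - ((\<Sum>k\<in>UNIV. b k) + \<epsilon> * (\<Sum>k\<in>UNIV. B2 k))"
        unfolding sum_negf sum.distrib sum_distrib_left ..
      also have "\<dots> \<ge> 0" using bs mult_nonneg_nonpos[of \<epsilon> "\<Sum>k\<in>UNIV. B2 k"] B2 \<epsilon> by linarith
      finally have "(\<Sum>k\<in>UNIV. - (b k + \<epsilon> * B2 k)) \<ge> 0" .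
      then show "subharmonic_at w y" by (rule subharmonic_atI[OF ne jw])
    qed
    then show ?thesis by (simp add: w_def)
  qed
  have vm: "m \<le> v x" if x: "x \<noteq> z" "norm (x - z) \<le> r0" for x
  proof (rule field_le_epsilon)
    fix \<epsilon> :: real assume "\<epsilon> > 0"
    define Q where "Q = (ln ((norm (x - z))\<^sup>2))\<^sup>2"
    have "Q \<ge> 0" by (simp add: Q_def)
    have "m \<le> v x + (\<epsilon> / (Q + 1)) * Q" unfolding Q_def
      by (rule main[OF x]) (use \<open>\<epsilon> > 0\<close> in \<open>simp add: add_nonneg_pos\<close>)
    also have "(\<epsilon> / (Q + 1)) * Q \<le> \<epsilon>" using \<open>\<epsilon> > 0\<close> \<open>Q \<ge> 0\<close> by (simp add: field_simps)
    finally show "m \<le> v x + \<epsilon>" by simp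
  qed
  have "isCont (\<lambda>x. det (hess u x)) z" using cdet S continuous_on_eq_continuous_at by blast
  then have lim: "((\<lambda>x. (det (hess u x))\<^sup>2) \<longlongrightarrow> (det (hess u z))\<^sup>2) (at z)"
    unfolding isCont_def by (rule tendsto_power)
  have "exp m \<le> (det (hess u y))\<^sup>2" if "y \<noteq> z" "dist y z < r0" for y
  proof -
    have y: "norm (y - z) \<le> r0" using that(2) by (simp add: dist_norm)
    have "exp m \<le> exp (v y)" using vm[OF that(1) y] by simp
    then show ?thesis using dnz[OF that(1) y] by (simp add: v_def)
  qed
  then have "\<forall>\<^sub>F y in at z. exp m \<le> (det (hess u y))\<^sup>2"
    unfolding eventually_at using r0(1) by blast
  then have "exp m \<le> (det (hess u z))\<^sup>2" by (rule tendsto_lowerbound[OF lim]) simp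
  then have "exp m \<le> 0" using d0 by simp
  then show False using exp_gt_zero[of m] by linarith
qed

section \<open>Distance to the boundary of a convex image\<close>

lemma harmonic_axis_jets:
  fixes h :: "real^'n \<Rightarrow> real"
  assumes "harmonic S h" "open S" "x \<in> S"
  shows "\<exists>a b. (\<forall>k. jet2 (\<lambda>t. h (x + t *\<^sub>R axis k 1)) (h x) (a k) (b k)) \<and> (\<Sum>k\<in>UNIV. b k) = 0"
proof -
  have "(\<Sum>i\<in>UNIV. dd (axis i 1) (dd (axis i 1) h) x) = 0"
    by (rule harmonic_laplacian_frame[OF assms orthonormal_frame_axis])
  then show ?thesis using harmonic_jet2[OF assms]
    by (intro exI[of _ "\<lambda>k. dd (axis k 1) h x"] exI[of _ "\<lambda>k. dd (axis k 1) (dd (axis k 1) h) x"] conjI allI)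
qed

text \<open>A point \<open>w\<close> outside \<open>D\<close> is separated from \<open>D\<close> by a unit vector \<open>n\<close>, so \<open>h y = n \<bullet> w - f y \<bullet> n\<close> is a
  nonnegative harmonic function. On \<open>cball 0 (1/2)\<close> it is at least a constant \<open>m\<close> which depends neither on \<open>w\<close> nor on \<open>n\<close>.
  In the annulus around this ball, \<open>h\<close> dominates the barrier \<open>c (1 / \<bar>y\<bar>\<^sup>2 - 1 / r\<^sup>2)\<close>, which is subharmonic in dimension at
  most four and decays linearly at the outer sphere.\<close>

lemma Hopf_boundary_distance:
  fixes f :: "real^'n \<Rightarrow> real^'n" and D :: "(real^'n) set"
  assumes H: "\<And>n. harmonic (ball 0 1) (\<lambda>x. f x \<bullet> n)" and cf: "continuous_on (ball 0 1) f"
    and D: "open D" "convex D" and fD: "f ` ball 0 1 \<subseteq> D" and dim: "CARD('n) \<le> 4"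
  shows "\<exists>c>0. \<forall>x\<in>ball 0 1. ball (f x) (c * (1 - norm x)) \<subseteq> D"
proof -
  let ?B = "ball (0::real^'n) 1"
  have sub: "cball (0::real^'n) (1/2) \<subseteq> ?B" by auto
  have "compact (f ` cball 0 (1/2))"
    by (intro compact_continuous_image continuous_on_subset[OF cf sub] compact_cball)
  moreover have "f ` cball 0 (1/2) \<subseteq> D" using sub fD by blast
  ultimately obtain m where m: "m > 0" "(\<Union>y\<in>f ` cball 0 (1/2). cball y m) \<subseteq> D"
    using compact_subset_open_imp_cball_epsilon_subset[OF _ D(1)] by blast
  \<comment> \<open>At \<open>\<bar>y\<bar> = 1/2\<close> the barrier is at most \<open>4 * c - c = m\<close>.\<close>
  define c where "c = m / 3"
  have c: "c > 0" using m by (simp add: c_def)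
  have "w \<in> D" if x: "x \<in> ?B" and w: "w \<in> ball (f x) (c * (1 - norm x))" for x w
  proof (rule ccontr)
    assume "w \<notin> D"
    then have "\<exists>a b. a \<noteq> 0 \<and> (\<forall>y\<in>D. a \<bullet> y \<le> b) \<and> (\<forall>y\<in>{w}. a \<bullet> y \<ge> b)"
      by (intro separating_hyperplane_sets D) (use fD x in auto)
    then obtain a b where a: "a \<noteq> 0" "\<And>y. y \<in> D \<Longrightarrow> a \<bullet> y \<le> b" "b \<le> a \<bullet> w" by blast
    define n where "n = a /\<^sub>R norm a"
    have nn: "norm n = 1" using a by (simp add: n_def)
    have nD: "n \<bullet> y \<le> n \<bullet> w" if "y \<in> D" for y
      using order_trans[OF a(2)[OF that] a(3)] a(1) by (simp add: n_def mult_left_mono)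
    define h where "h y = n \<bullet> w - f y \<bullet> n" for y
    have h0: "0 \<le> h y" if "y \<in> ?B" for y
    proof -
      have "f y \<in> D" using fD that by blast
      from nD[OF this] show ?thesis by (simp add: h_def inner_commute)
    qed
    have hm: "m \<le> h y" if "y \<in> cball 0 (1/2)" for y
    proof -
      have "f y + m *\<^sub>R n \<in> cball (f y) m" using m nn by (simp add: dist_norm)
      then have "f y + m *\<^sub>R n \<in> D" using m(2) that by blast
      from nD[OF this] show ?thesis using nn by (simp add: h_def inner_add inner_commute norm_eq_1)
    qed
    have hx: "h x < c * (1 - norm x)"
    proof -
      have "h x = n \<bullet> (w - f x)" by (simp add: h_def inner_diff_right inner_commute)
      also have "\<dots> \<le> norm n * norm (w - f x)" by (rule norm_cauchy_schwarz)
      also have "\<dots> < c * (1 - norm x)" using w nn by (simp add: dist_norm norm_minus_commute)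
      finally show ?thesis .
    qed
    show False
    proof (cases "norm x \<le> 1/2")
      case True
      then have "3 * c \<le> h x" using hm[of x] by (simp add: c_def)
      moreover have "c * (1 - norm x) \<le> c" using c by (simp add: mult_left_le)
      ultimately show False using hx c by linarith
    next
      case False
      have ch: "continuous_on ?B h" unfolding h_def by (intro continuous_intros cf)
      have bar: "c * (1 / (norm x)\<^sup>2) - c / r\<^sup>2 \<le> h x" if r: "norm x < r" "r < 1" for r
      proof -
        define v where "v y = c * (1 / (norm y)\<^sup>2) - (c / r\<^sup>2 + h y)" for y
        define A where "A = {y::real^'n. 1/2 \<le> norm y} \<inter> cball 0 r"
        define U where "U = {y::real^'n. 1/2 < norm y} \<inter> ball 0 r"
        have inA: "y \<in> ?B" "y \<noteq> 0" if "y \<in> A" for y using that r by (auto simp: A_def)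
        have r0: "r > 1/2" using r False by simp
        have "v x \<le> 0"
        proof (rule maximum_principle[where K = A and U = U])
          show "compact A" unfolding A_def
            by (intro closed_Int_compact compact_cball closed_Collect_le continuous_intros)
          show "open U" unfolding U_def
            by (intro open_Int open_ball open_Collect_less continuous_intros)
          show "U \<subseteq> A" by (auto simp: U_def A_def)
          show "continuous_on A v" unfolding v_def using inA
            by (intro continuous_intros continuous_on_subset[OF ch]) auto
          show "x \<in> A" using False r by (simp add: A_def)
          show "v y \<le> 0" if y: "y \<in> A - U" for y
          proof -
            have yA: "y \<in> A" using y by simp
            consider "norm y = 1/2" | "norm y = r" using y by (force simp: A_def U_def)
            then show ?thesis
            proof cases
              case 1
              then have "3 * c \<le> h y" using hm[of y] by (simp add: c_def)
              moreover have "c \<le> c / r\<^sup>2" using r r0 c by (simp add: field_simps power_le_one)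
              moreover have "c * (1 / (norm y)\<^sup>2) = 4 * c" unfolding 1 by (simp add: power2_eq_square)
              ultimately show ?thesis unfolding v_def by linarith
            next
              case 2
              then show ?thesis using h0[OF inA(1)[OF yA]] by (simp add: v_def)
            qed
          qed
          fix y assume y: "y \<in> U"
          then have yA: "y \<in> A" by (auto simp: U_def A_def)
          define q where "q = (norm y)\<^sup>2"
          have q: "q > 0" using inA[OF yA] by (simp add: q_def)
          obtain a b where ab: "\<And>k. jet2 (\<lambda>t. f (y + t *\<^sub>R axis k 1) \<bullet> n) (f y \<bullet> n) (a k) (b k)" "(\<Sum>k\<in>UNIV. b k) = 0"
            using harmonic_axis_jets[OF H[of n] open_ball inA(1)[OF yA]] by blast
          define b' where "b' k = c * (2 * (2 * (y \<bullet> axis k 1))\<^sup>2 / q ^ 3 - 2 / q\<^sup>2) - (0 + (0 - b k))" for k :: 'n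
          have jv: "\<exists>a'. jet2 (\<lambda>t. v (y + t *\<^sub>R axis k 1)) (v y) a' (b' k)" for k
          proof -
            have "jet2 (\<lambda>t. (norm (y + t *\<^sub>R axis k 1))\<^sup>2) q (2 * (y \<bullet> axis k 1)) 2"
              using jet2_norm_sq[of y "axis k 1"] by (simp add: q_def norm_axis_1)
            from jet2_inverse[OF this q]
            have "jet2 (\<lambda>t. 1 / (norm (y + t *\<^sub>R axis k 1))\<^sup>2) (1 / q) (- (2 * (y \<bullet> axis k 1)) / q\<^sup>2) (2 * (2 * (y \<bullet> axis k 1))\<^sup>2 / q ^ 3 - 2 / q\<^sup>2)" .
            note j = jet2_diff[OF jet2_cmult[OF this, of c] jet2_add[OF jet2_const[of "c / r\<^sup>2"] jet2_diff[OF jet2_const[of "n \<bullet> w"] ab(1)[of k]]]]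
            show ?thesis unfolding v_def h_def b'_def q_def[symmetric] by (rule exI, rule j)
          qed
          then obtain a' where jv: "\<And>k. jet2 (\<lambda>t. v (y + t *\<^sub>R axis k 1)) (v y) (a' k) (b' k)" by metis
          have sq: "(\<Sum>k\<in>UNIV. (y \<bullet> axis k 1)\<^sup>2) = q" unfolding q_def
            by (rule orthonormal_frame_norm_sq[OF orthonormal_frame_axis])
          have "(\<Sum>k\<in>UNIV. b' k) = c * (8 * (\<Sum>k\<in>UNIV. (y \<bullet> axis k 1)\<^sup>2) / q ^ 3 - 2 * real CARD('n) / q\<^sup>2) + (\<Sum>k\<in>UNIV. b k)"
            unfolding b'_def
            by (simp add: sum.distrib sum_subtractf sum_distrib_left[symmetric] sum_divide_distrib[symmetric] power_mult_distrib)
          also have "\<dots> = c * ((8 - 2 * real CARD('n)) / q\<^sup>2)" unfolding sq ab(2)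
            using q by (simp add: power2_eq_square power3_eq_cube field_simps)
          also have "\<dots> \<ge> 0" using c dim by simp
          finally show "subharmonic_at v y"
            using jv by (intro subharmonic_atI[where e = "\<lambda>k. axis k 1" and a = a' and b = b']) (simp_all add: norm_axis_1)
        qed
        then show ?thesis by (simp add: v_def)
      qed
      have "((\<lambda>r. c * (1 / (norm x)\<^sup>2) - c / r\<^sup>2) \<longlongrightarrow> c * (1 / (norm x)\<^sup>2) - c / 1\<^sup>2) (at_left 1)"
        by (intro tendsto_intros) auto
      then have "c * (1 / (norm x)\<^sup>2) - c / 1\<^sup>2 \<le> h x"
      proof (rule tendsto_upperbound)
        have "norm x < 1" using x by simp
        then show "\<forall>\<^sub>F r in at_left 1. c * (1 / (norm x)\<^sup>2) - c / r\<^sup>2 \<le> h x"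
          unfolding eventually_at_left_field using bar by blast
      qed simp
      moreover have "c * (1 - norm x) \<le> c * (1 / (norm x)\<^sup>2 - 1)"
      proof (rule mult_left_mono)
        have nx: "0 < norm x" "norm x < 1" using False x by auto
        have "(2 - norm x) * (norm x)\<^sup>2 \<le> (2 - norm x) * norm x"
          using nx by (intro mult_left_mono) (auto simp: power2_eq_square mult_left_le)
        also have "\<dots> \<le> 1" using zero_le_power2[of "1 - norm x"] by (simp add: power2_eq_square algebra_simps)
        finally show "1 - norm x \<le> 1 / (norm x)\<^sup>2 - 1" using nx by (simp add: field_simps)
      qed (use c in simp)
      ultimately show False using hx by (simp add: right_diff_distrib)
    qed
  qed
  then show ?thesis using c by blast
qed

section \<open>The Ahlfors-Schwarz estimate for the Jacobian\<close>

text \<open>A Schwarz lemma for the inverse of \<open>f\<close>: compactness of the preimage of \<open>cball (f x0) d\<close> makes \<open>\<Phi>\<close> attain its maximum, and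
  the powers in \<open>\<Phi>\<close> are chosen so that the second derivative test bounds \<open>\<Phi>\<close> itself. The natural
  quantity has \<open>\<eta>\<^sup>2\<close>, \<open>J\<close> to the power \<open>-2/3\<close> and \<open>(1 - \<bar>x\<bar>\<^sup>2)\<close> to the power \<open>-2\<close>; \<open>\<Phi>\<close> is its cube.\<close>

lemma Ahlfors_Schwarz_jacobian_bound:
  fixes u :: "real^3 \<Rightarrow> real" and f :: "real^3 \<Rightarrow> real^3"
  assumes hu: "harmonic (ball 0 1) u" and f: "\<And>x e. x \<in> ball 0 1 \<Longrightarrow> f x \<bullet> e = dd e u x"
    and K: "K > 0" and qc: "\<And>x. x \<in> ball 0 1 \<Longrightarrow> qc_matrix K (hess u x)"
    and nz: "\<And>x. x \<in> ball 0 1 \<Longrightarrow> det (hess u x) \<noteq> 0"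
    and x0: "x0 \<in> ball 0 1" and d: "d > 0"
    and comp: "compact {x \<in> ball 0 1. f x \<in> cball (f x0) d}"
    and cf: "continuous_on (ball 0 1) f"
  shows "d ^ 6 \<le> 4 * K\<^sup>2 * (det (hess u x0))\<^sup>2 * (1 - (norm x0)\<^sup>2) ^ 6"
proof -
  let ?B = "ball (0::real^3) 1"
  define P where "P = {x \<in> ?B. f x \<in> cball (f x0) d}"
  define \<eta> where "\<eta> x = d\<^sup>2 - (norm (f x - f x0))\<^sup>2" for x
  define p where "p x = 1 - (norm x)\<^sup>2" for x :: "real^3"
  define J where "J x = det (hess u x)" for x
  define \<Phi> where "\<Phi> x = \<eta> x ^ 6 / ((J x)\<^sup>2 * p x ^ 6)" for x
  have P: "P \<subseteq> ?B" by (auto simp: P_def)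
  have pp: "p x > 0" if "x \<in> ?B" for x
    using that power_strict_mono[of "norm x" 1 2] by (simp add: p_def)
  have Jn: "J x \<noteq> 0" if "x \<in> ?B" for x using nz that by (simp add: J_def)
  have cJ: "continuous_on ?B J" unfolding J_def by (rule continuous_on_det_hess[OF hu open_ball])
  have c\<eta>: "continuous_on ?B \<eta>" unfolding \<eta>_def by (intro continuous_intros cf)
  have cp: "continuous_on P p" unfolding p_def by (intro continuous_intros)
  have "continuous_on P \<Phi>" unfolding \<Phi>_def
  proof (intro continuous_intros continuous_on_subset[OF cJ P] continuous_on_subset[OF c\<eta> P] cp ballI)
    fix x assume "x \<in> P"
    then have "x \<in> ?B" using P by blast
    then show "(J x)\<^sup>2 * p x ^ 6 \<noteq> 0" using Jn[of x] pp[of x] by simp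
  qed
  moreover have x0P: "x0 \<in> P" using x0 d by (simp add: P_def)
  ultimately obtain x where x: "x \<in> P" "\<And>y. y \<in> P \<Longrightarrow> \<Phi> y \<le> \<Phi> x"
    using continuous_attains_sup[of P \<Phi>] comp unfolding P_def[symmetric] by blast
  have xB: "x \<in> ?B" using x P by blast
  have \<Phi>0: "\<Phi> x0 = d ^ 12 / ((J x0)\<^sup>2 * p x0 ^ 6)" by (simp add: \<Phi>_def \<eta>_def power_mult[symmetric])
  have \<Phi>pos: "\<Phi> x > 0"
  proof -
    have "\<Phi> x0 > 0" unfolding \<Phi>0 using d Jn[OF x0] pp[OF x0] by (intro divide_pos_pos mult_pos_pos) auto
    then show ?thesis using x(2)[OF x0P] by simp
  qed
  have \<eta>x: "\<eta> x > 0"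
  proof -
    have "norm (f x - f x0) \<le> d" using x(1) by (simp add: P_def dist_norm norm_minus_commute)
    then have "\<eta> x \<ge> 0" unfolding \<eta>_def by (simp add: power_mono)
    moreover have "\<eta> x \<noteq> 0" using \<Phi>pos by (auto simp: \<Phi>_def)
    ultimately show ?thesis by simp
  qed
  obtain e :: "3 \<Rightarrow> real^3" and aJ bJ where e: "orthonormal_frame e"
    "\<And>i j. i \<noteq> j \<Longrightarrow> (hess u x *v e i) \<bullet> e j = 0"
    and jJ: "\<And>k. jet2 (\<lambda>t. ln ((J (x + t *\<^sub>R e k))\<^sup>2)) (ln ((J x)\<^sup>2)) (aJ k) (bJ k)"
    and bJ: "(\<Sum>k\<in>UNIV. bJ k) \<le> 0"
    using ln_det_hess_superharmonic[OF hu open_ball xB nz[OF xB]] unfolding J_def by metis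
  note ne = norm_orthonormal_frame[OF e(1)]
  define l where "l i = (hess u x *v e i) \<bullet> e i" for i
  \<comment> \<open>The frame diagonalizes the derivative of \<open>f\<close>, so \<open>X\<close> is its squared operator norm, and \<open>X3\<close> is the distortion inequality.\<close>
  define X where "X = Max (range (\<lambda>i. (l i)\<^sup>2))"
  have lX: "(l i)\<^sup>2 \<le> X" for i unfolding X_def by (rule Max_ge) auto
  have X3: "X ^ 3 \<le> K\<^sup>2 * (J x)\<^sup>2"
  proof -
    have "X \<in> range (\<lambda>i. (l i)\<^sup>2)" unfolding X_def by (rule Max_in) auto
    then obtain i where i: "X = (l i)\<^sup>2" by auto
    have "\<bar>l i\<bar> \<le> norm (hess u x *v e i) * norm (e i)" unfolding l_def by (rule Cauchy_Schwarz_ineq2)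
    then have "\<bar>l i\<bar> ^ 3 \<le> norm (hess u x *v e i) ^ 3" using ne by (intro power_mono) auto
    also have "\<dots> \<le> K * \<bar>J x\<bar> * norm (e i) ^ 3" using qc[OF xB] unfolding qc_matrix_def J_def by blast
    finally have "\<bar>l i\<bar> ^ 3 \<le> K * \<bar>J x\<bar>" using ne by simp
    then have "(\<bar>l i\<bar> ^ 3)\<^sup>2 \<le> (K * \<bar>J x\<bar>)\<^sup>2" by (intro power_mono) auto
    then show ?thesis unfolding i by (simp add: power_mult_distrib power_mult[symmetric] power_even_abs)
  qed
  have X0: "X \<ge> 0" using lX[of 1] by (meson order_trans zero_le_power2)
  define g where "g i y = dd (e i) u y - f x0 \<bullet> e i" for i y
  define T where "T i k = dd (e k) (dd (e k) (dd (e i) u)) x" for i k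
  have \<eta>eq: "\<eta> y = d\<^sup>2 - (\<Sum>i\<in>UNIV. g i y * g i y)" if "y \<in> ?B" for y
    unfolding \<eta>_def orthonormal_frame_norm_sq[OF e(1), symmetric]
    by (simp add: g_def inner_diff_left f[OF that] power2_eq_square)
  define a\<eta> where "a\<eta> k = - 2 * g k x * l k" for k
  define b\<eta> where "b\<eta> k = - 2 * (l k)\<^sup>2 - 2 * (\<Sum>i\<in>UNIV. g i x * T i k)" for k
  have j\<eta>: "jet2 (\<lambda>t. \<eta> (x + t *\<^sub>R e k)) (\<eta> x) (a\<eta> k) (b\<eta> k)" for k
  proof -
    define m where "m i = (if i = k then l k else 0)" for i
    have M: "dd (e k) (dd (e i) u) x = m i" for i
      using e(2)[of i k] hess_dd[OF hu open_ball xB, of "e i" "e k"] by (auto simp: l_def m_def)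
    have j1: "jet2 (\<lambda>t. g i (x + t *\<^sub>R e k)) (g i x) (m i) (T i k)" for i
      using jet2_diff[OF harmonic_jet2[OF harmonic_dd[OF open_ball hu] open_ball xB] jet2_const]
      unfolding g_def T_def M[symmetric] by fastforce
    have j2: "jet2 (\<lambda>t. d\<^sup>2 - (\<Sum>i\<in>UNIV. g i (x + t *\<^sub>R e k) * g i (x + t *\<^sub>R e k)))
        (d\<^sup>2 - (\<Sum>i\<in>UNIV. g i x * g i x))
        (0 - (\<Sum>i\<in>UNIV. (m i) * g i x + g i x * (m i)))
        (0 - (\<Sum>i\<in>UNIV. T i k * g i x + 2 * (m i) * (m i) + g i x * T i k))"
      by (rule jet2_diff[OF jet2_const jet2_sum[OF finite jet2_mult[OF j1 j1]]])
    have s1: "(\<Sum>i\<in>UNIV. (m i) * g i x + g i x * (m i)) = 2 * g k x * l k"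
    proof -
      have "(\<Sum>i\<in>UNIV. (m i) * g i x + g i x * (m i)) = (\<Sum>i\<in>UNIV. if i = k then 2 * g k x * l k else 0)"
        by (intro sum.cong) (auto simp: m_def)
      then show ?thesis by simp
    qed
    have s2: "(\<Sum>i\<in>UNIV. T i k * g i x + 2 * (m i) * (m i) + g i x * T i k) = 2 * (l k)\<^sup>2 + 2 * (\<Sum>i\<in>UNIV. g i x * T i k)"
    proof -
      have "(\<Sum>i\<in>UNIV. T i k * g i x + 2 * (m i) * (m i) + g i x * T i k)
        = (\<Sum>i\<in>UNIV. (if i = k then 2 * (l k)\<^sup>2 else 0) + 2 * (g i x * T i k))"
        by (intro sum.cong) (auto simp: m_def power2_eq_square)
      then show ?thesis by (simp add: sum.distrib sum_distrib_left)
    qed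
    show ?thesis
    proof (rule jet2_transform[OF jet2_cong[OF j2[unfolded s1 s2]]])
      show "\<forall>\<^sub>F t in nhds 0. d\<^sup>2 - (\<Sum>i\<in>UNIV. g i (x + t *\<^sub>R e k) * g i (x + t *\<^sub>R e k)) = \<eta> (x + t *\<^sub>R e k)"
        using eventually_line_in_open[OF open_ball xB, of "e k"] by eventually_elim (simp add: \<eta>eq)
    qed (simp_all add: \<eta>eq[OF xB] a\<eta>_def b\<eta>_def)
  qed
  have jp: "jet2 (\<lambda>t. p (x + t *\<^sub>R e k)) (p x) (- 2 * (x \<bullet> e k)) (- 2)" for k
    using jet2_diff[OF jet2_const[of 1] jet2_norm_sq[of x "e k"]] ne by (simp add: p_def)
  define G where "G y = 6 * ln (\<eta> y) - ln ((J y)\<^sup>2) - 6 * ln (p y)" for y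
  define bG where "bG k = 6 * (b\<eta> k / \<eta> x - (a\<eta> k)\<^sup>2 / (\<eta> x)\<^sup>2) - bJ k - 6 * ((- 2) / p x - (- 2 * (x \<bullet> e k))\<^sup>2 / (p x)\<^sup>2)" for k
  have "bG k \<le> 0" for k
  proof (rule jet2_local_max)
    show "jet2 (\<lambda>t. G (x + t *\<^sub>R e k)) (G x) (6 * (a\<eta> k / \<eta> x) - aJ k - 6 * (- 2 * (x \<bullet> e k) / p x)) (bG k)"
      unfolding G_def bG_def
      by (intro jet2_diff jet2_cmult jet2_ln j\<eta> jJ jp \<eta>x pp[OF xB])
    define W where "W = {y \<in> ?B. 0 < \<eta> y}"
    have "open W"
    proof -
      have "open (?B \<inter> \<eta> -` {0<..})" by (rule continuous_open_preimage[OF c\<eta>]) auto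
      moreover have "W = ?B \<inter> \<eta> -` {0<..}" by (auto simp: W_def)
      ultimately show ?thesis by simp
    qed
    moreover have "x \<in> W" using xB \<eta>x by (simp add: W_def)
    ultimately have "\<forall>\<^sub>F t in nhds 0. x + t *\<^sub>R e k \<in> W" by (rule eventually_line_in_open)
    then show "\<forall>\<^sub>F t in nhds 0. G (x + t *\<^sub>R e k) \<le> G x"
    proof eventually_elim
      case (elim t)
      let ?y = "x + t *\<^sub>R e k"
      have y: "?y \<in> ?B" "\<eta> ?y > 0" using elim by (auto simp: W_def)
      then have "(norm (f ?y - f x0))\<^sup>2 \<le> d\<^sup>2" by (simp add: \<eta>_def)
      then have "norm (f ?y - f x0) \<le> d" by (rule power2_le_imp_le) (use d in simp)
      then have "f ?y \<in> cball (f x0) d" by (simp add: dist_norm norm_minus_commute)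
      then have "?y \<in> P" using y(1) unfolding P_def by blast
      then have le: "\<Phi> ?y \<le> \<Phi> x" by (rule x(2))
      have GP: "G z = ln (\<Phi> z)" "\<Phi> z > 0" if "z \<in> ?B" "\<eta> z > 0" for z
      proof -
        have pos: "\<eta> z ^ 6 > 0" "(J z)\<^sup>2 > 0" "p z ^ 6 > 0" using that(2) Jn[OF that(1)] pp[OF that(1)] by simp_all
        then show "\<Phi> z > 0" unfolding \<Phi>_def by simp
        have "ln (\<Phi> z) = ln (\<eta> z ^ 6) - (ln ((J z)\<^sup>2) + ln (p z ^ 6))"
          unfolding \<Phi>_def using pos by (simp only: ln_divide_pos ln_mult_pos mult_pos_pos)
        then show "G z = ln (\<Phi> z)" by (simp only: G_def ln_realpow)
      qed
      show ?case using le GP[OF y] GP[OF xB \<eta>x] by simp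
    qed
  qed
  then have s0: "(\<Sum>k\<in>UNIV. bG k) \<le> 0" by (intro sum_nonpos) auto
  have Tsum: "(\<Sum>k\<in>UNIV. T i k) = 0" for i unfolding T_def
    by (rule harmonic_laplacian_frame[OF harmonic_dd[OF open_ball hu] open_ball xB e(1)])
  have gT: "(\<Sum>k\<in>UNIV. \<Sum>i\<in>UNIV. g i x * T i k) = 0"
    by (subst sum.swap) (simp add: sum_distrib_left[symmetric] Tsum)
  have b\<eta>sum: "(\<Sum>k\<in>UNIV. b\<eta> k) = - 2 * (\<Sum>k\<in>UNIV. (l k)\<^sup>2)"
    unfolding b\<eta>_def sum_subtractf sum_distrib_left[symmetric] gT by simp
  have gsum: "(\<Sum>k\<in>UNIV. (g k x)\<^sup>2) = d\<^sup>2 - \<eta> x" by (simp add: \<eta>eq[OF xB] power2_eq_square)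
  have xsum: "(\<Sum>k\<in>UNIV. (x \<bullet> e k)\<^sup>2) = 1 - p x" unfolding orthonormal_frame_norm_sq[OF e(1)] by (simp add: p_def)
  have l3: "(\<Sum>k\<in>UNIV. (l k)\<^sup>2) \<le> 3 * X" using sum_mono[of UNIV "\<lambda>k. (l k)\<^sup>2" "\<lambda>_. X"] lX by simp
  have agl: "(\<Sum>k\<in>UNIV. (a\<eta> k)\<^sup>2) \<le> 4 * X * (d\<^sup>2 - \<eta> x)"
  proof -
    have "(\<Sum>k\<in>UNIV. (a\<eta> k)\<^sup>2) \<le> (\<Sum>k\<in>UNIV. 4 * X * (g k x)\<^sup>2)"
    proof (rule sum_mono)
      fix k
      have "(a\<eta> k)\<^sup>2 = 4 * (l k)\<^sup>2 * (g k x)\<^sup>2" by (simp add: a\<eta>_def power_mult_distrib)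
      also have "\<dots> \<le> 4 * X * (g k x)\<^sup>2" using lX[of k] by (intro mult_right_mono) auto
      finally show "(a\<eta> k)\<^sup>2 \<le> 4 * X * (g k x)\<^sup>2" .
    qed
    also have "\<dots> = 4 * X * (d\<^sup>2 - \<eta> x)" by (simp add: sum_distrib_left[symmetric] gsum)
    finally show ?thesis .
  qed
  define E where "E = \<eta> x"
  define q where "q = p x"
  have E: "E > 0" "E \<le> d\<^sup>2" using \<eta>x by (auto simp: E_def \<eta>_def)
  have q: "q > 0" using pp[OF xB] by (simp add: q_def)
  \<comment> \<open>The Laplacian of \<open>ln \<Phi>\<close> at the maximum; the last bracket comes from \<open>- 6 ln p\<close>, where the frame turns \<open>\<bar>x\<bar>\<^sup>2\<close> into \<open>1 - p x\<close>.\<close>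
  have bGsum: "(\<Sum>k\<in>UNIV. bG k) = 6 * ((\<Sum>k\<in>UNIV. b\<eta> k) / E - (\<Sum>k\<in>UNIV. (a\<eta> k)\<^sup>2) / E\<^sup>2) - (\<Sum>k\<in>UNIV. bJ k) + (36 / q + 24 * (1 - q) / q\<^sup>2)"
    unfolding xsum[unfolded q_def[symmetric], symmetric] bG_def sum_3 E_def[symmetric] q_def[symmetric]
    by (simp add: power_mult_distrib add_divide_distrib diff_divide_distrib algebra_simps)
  have "(- 6 * X) / E \<le> (\<Sum>k\<in>UNIV. b\<eta> k) / E"
    using l3 E by (intro divide_right_mono) (auto simp: b\<eta>sum)
  moreover have "(\<Sum>k\<in>UNIV. (a\<eta> k)\<^sup>2) / E\<^sup>2 \<le> (4 * X * (d\<^sup>2 - E)) / E\<^sup>2"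
    using agl by (intro divide_right_mono) (auto simp: E_def)
  ultimately have "6 * ((- 6 * X) / E - (4 * X * (d\<^sup>2 - E)) / E\<^sup>2) + (36 / q + 24 * (1 - q) / q\<^sup>2) \<le> 0"
    using s0 bJ unfolding bGsum by argo
  moreover have "6 * ((- 6 * X) / E - (4 * X * (d\<^sup>2 - E)) / E\<^sup>2) = - ((12 * X * E + 24 * X * d\<^sup>2) / E\<^sup>2)"
    using E by (simp add: field_simps power2_eq_square)
  moreover have "36 / q + 24 * (1 - q) / q\<^sup>2 = (12 * q + 24) / q\<^sup>2"
    using q by (simp add: field_simps power2_eq_square)
  ultimately have "(12 * q + 24) / q\<^sup>2 \<le> (12 * X * E + 24 * X * d\<^sup>2) / E\<^sup>2" by argo
  moreover have "24 / q\<^sup>2 \<le> (12 * q + 24) / q\<^sup>2" using q by (intro divide_right_mono) auto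
  moreover have "(12 * X * E + 24 * X * d\<^sup>2) / E\<^sup>2 \<le> 36 * X * d\<^sup>2 / E\<^sup>2"
    using X0 E mult_left_mono[OF E(2) X0] by (intro divide_right_mono) auto
  ultimately have "24 / q\<^sup>2 \<le> 36 * X * d\<^sup>2 / E\<^sup>2" by linarith
  then have E2: "2 * E\<^sup>2 \<le> 3 * (X * q\<^sup>2 * d\<^sup>2)" using q E by (simp add: field_simps)
  have nn: "0 \<le> (K\<^sup>2 * (J x)\<^sup>2) * (q ^ 6 * d ^ 6)" using q d by simp
  have "8 * E ^ 6 = (2 * E\<^sup>2) ^ 3" by (simp add: power_mult_distrib power_mult[symmetric])
  also have "\<dots> \<le> (3 * (X * q\<^sup>2 * d\<^sup>2)) ^ 3" using E2 E by (intro power_mono) auto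
  also have "\<dots> = 27 * (X ^ 3 * (q ^ 6 * d ^ 6))" by (simp add: power_mult_distrib power_mult[symmetric])
  also have "\<dots> \<le> 27 * ((K\<^sup>2 * (J x)\<^sup>2) * (q ^ 6 * d ^ 6))"
    using X3 q d by (intro mult_left_mono mult_right_mono) auto
  finally have "E ^ 6 \<le> 4 * ((K\<^sup>2 * (J x)\<^sup>2) * (q ^ 6 * d ^ 6))"
    using nn by linarith
  then have "\<Phi> x \<le> 4 * K\<^sup>2 * d ^ 6"
    unfolding \<Phi>_def E_def[symmetric] q_def[symmetric] using Jn[OF xB] q
    by (simp add: divide_le_eq mult_ac)
  then have "d ^ 12 / ((J x0)\<^sup>2 * p x0 ^ 6) \<le> 4 * K\<^sup>2 * d ^ 6" using x(2)[OF x0P] \<Phi>0 by simp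
  then have "d ^ 6 * d ^ 6 \<le> (4 * K\<^sup>2 * (J x0)\<^sup>2 * p x0 ^ 6) * d ^ 6"
    using Jn[OF x0] pp[OF x0] by (simp add: divide_le_eq power_add[symmetric] mult_ac)
  then show ?thesis unfolding J_def p_def by (rule mult_right_le_imp_le) (use d in simp)
qed

section \<open>Lipschitz bounds\<close>

lemma harmonic_gradient_imp_harmonic_with:
  fixes f :: "real^'n \<Rightarrow> real^'n"
  assumes S: "open S" and hg: "harmonic_gradient_on S f" and C1: "C1_on S f"
  obtains u where "harmonic_with S u f (\<lambda>x. matrix (frechet_derivative f (at x)))"
proof -
  obtain u where u: "harmonic_on S u" "\<And>x. x \<in> S \<Longrightarrow> GDERIV u x :> f x"
    using hg unfolding harmonic_gradient_on_def by blast
  have du: "(u has_derivative (\<lambda>h. f x \<bullet> h)) (at x)" if "x \<in> S" for x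
    using u(2)[OF that] by (simp add: gderiv_def inner_commute)
  have df: "(f has_derivative frechet_derivative f (at x)) (at x)" if "x \<in> S" for x
    using C1 that unfolding C1_on_def by (simp add: frechet_derivative_works)
  have pu: "partial i u x = f x $ i" if "x \<in> S" for i x
    unfolding partial_def frechet_derivative_at[OF du[OF that], symmetric] by (simp add: inner_axis)
  have ppu: "partial i (partial i u) x = matrix (frechet_derivative f (at x)) $ i $ i" if x: "x \<in> S" for i x
  proof -
    have "((\<lambda>y. f y \<bullet> axis i 1) has_derivative (\<lambda>h. frechet_derivative f (at x) h \<bullet> axis i 1)) (at x)"
      by (rule has_derivative_inner_left[OF df[OF x]])
    then have "(partial i u has_derivative (\<lambda>h. frechet_derivative f (at x) h \<bullet> axis i 1)) (at x)"
      by (rule has_derivative_transform_within_open[OF _ S x]) (simp add: pu inner_axis)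
    from frechet_derivative_at[OF this] have "partial i (partial i u) x = frechet_derivative f (at x) (axis i 1) \<bullet> axis i 1"
      unfolding partial_def by metis
    then show ?thesis by (simp add: matrix_def inner_axis)
  qed
  have "harmonic_with S u f (\<lambda>x. matrix (frechet_derivative f (at x)))"
    unfolding harmonic_with_def
  proof (intro ballI conjI)
    fix x assume x: "x \<in> S"
    show "(u has_derivative (\<lambda>h. f x \<bullet> h)) (at x)" by (rule du[OF x])
    have "matrix (frechet_derivative f (at x)) *v h = frechet_derivative f (at x) h" for h
      using has_derivative_linear[OF df[OF x]] by (simp add: matrix_works linear_matrix_vector_mul_eq)
    then show "(f has_derivative (\<lambda>h. matrix (frechet_derivative f (at x)) *v h)) (at x)" using df[OF x] by simp
    show "trace (matrix (frechet_derivative f (at x))) = 0"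
      using u(1) x unfolding harmonic_on_def by (simp add: trace_def ppu)
  qed
  then show thesis using that by blast
qed

lemma bdd_above_stretch:
  assumes "linear (A :: real^'n \<Rightarrow> real^'n)"
  shows "bdd_above ((\<lambda>v. norm (A v)) ` sphere 0 1)"
proof -
  obtain B where "\<And>x. norm (A x) \<le> B * norm x" using linear_bounded[OF assms] by blast
  then have "norm (A v) \<le> B" if "v \<in> sphere 0 1" for v using that by (metis dist_0_norm mem_sphere mult.right_neutral)
  then show ?thesis by (intro bdd_aboveI2)
qed

lemma norm_linear_normalized:
  assumes "linear (A :: real^'n \<Rightarrow> real^'n)"
  shows "norm (A (v /\<^sub>R norm v)) = norm (A v) / norm v"
  by (simp only: linear_cmul[OF assms] norm_scaleR) (simp add: divide_inverse mult.commute)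

lemma norm_le_max_stretch:
  assumes "linear (A :: real^'n \<Rightarrow> real^'n)"
  shows "norm (A v) \<le> max_stretch A * norm v"
proof (cases "v = 0")
  case True then show ?thesis using linear_0[OF assms] by simp
next
  case False
  have "norm (A (v /\<^sub>R norm v)) \<le> max_stretch A"
    unfolding max_stretch_def by (rule cSUP_upper[OF _ bdd_above_stretch[OF assms]]) (use False in simp)
  then show ?thesis using False unfolding norm_linear_normalized[OF assms] by (simp add: pos_divide_le_eq)
qed

lemma min_stretch_le_norm:
  assumes "linear (A :: real^'n \<Rightarrow> real^'n)"
  shows "min_stretch A * norm v \<le> norm (A v)"
proof (cases "v = 0")
  case True then show ?thesis by simp
next
  case False
  have "min_stretch A \<le> norm (A (v /\<^sub>R norm v))"
    unfolding min_stretch_def by (rule cINF_lower) (use False in \<open>auto intro: bdd_belowI2[of _ 0]\<close>)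
  then show ?thesis using False unfolding norm_linear_normalized[OF assms] by (simp add: pos_le_divide_eq)
qed

lemma lipschitz_if_partials_extend:
  fixes f :: "real^'n \<Rightarrow> real^'n"
  assumes "C1_on (ball 0 1) f" "partials_extend (ball 0 1) f"
  shows "\<exists>L. L-lipschitz_on (ball 0 1) f"
proof -
  let ?B = "ball (0::real^'n) 1"
  have "\<exists>b\<ge>0. \<forall>x\<in>?B. norm (partial i f x) \<le> b" for i
  proof -
    obtain g where g: "continuous_on (closure ?B) g" "\<forall>x\<in>?B. g x = partial i f x"
      using assms(2) unfolding partials_extend_def by blast
    have "compact (g ` closure ?B)" by (intro compact_continuous_image g(1)) simp
    then obtain b where b: "\<forall>y\<in>g ` closure ?B. norm y \<le> b" using compact_imp_bounded bounded_iff by blast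
    have "norm (partial i f x) \<le> \<bar>b\<bar>" if "x \<in> ?B" for x
    proof -
      have "x \<in> closure ?B" using that closure_subset by blast
      then have "norm (g x) \<le> b" using b by blast
      then show ?thesis using g(2) that by auto
    qed
    then show ?thesis by (intro exI[of _ "\<bar>b\<bar>"]) auto
  qed
  then obtain b where b: "\<And>i. b i \<ge> 0" "\<And>i x. x \<in> ?B \<Longrightarrow> norm (partial i f x) \<le> b i" by metis
  define L where "L = (\<Sum>i\<in>UNIV. b i)"
  have "norm (f x - f y) \<le> L * norm (x - y)" if "x \<in> ?B" "y \<in> ?B" for x y
  proof (rule differentiable_bound[where S = ?B and f' = "\<lambda>x. frechet_derivative f (at x)"])
    fix z assume z: "z \<in> ?B"
    have df: "(f has_derivative frechet_derivative f (at z)) (at z)"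
      using assms(1) z unfolding C1_on_def by (simp add: frechet_derivative_works)
    then show "(f has_derivative frechet_derivative f (at z)) (at z within ?B)" by (rule has_derivative_at_withinI)
    have lin: "linear (frechet_derivative f (at z))" by (rule has_derivative_linear[OF df])
    show "onorm (frechet_derivative f (at z)) \<le> L"
    proof (rule onorm_le)
      fix h :: "real^'n"
      have h: "(\<Sum>i\<in>UNIV. (h $ i) *\<^sub>R axis i 1) = h" by (simp add: vec_eq_iff axis_def if_distrib cong: if_cong)
      have "frechet_derivative f (at z) (\<Sum>i\<in>UNIV. (h $ i) *\<^sub>R axis i 1) = (\<Sum>i\<in>UNIV. (h $ i) *\<^sub>R partial i f z)"
        unfolding partial_def by (simp only: linear_sum[OF lin] linear_cmul[OF lin])
      then have "frechet_derivative f (at z) h = (\<Sum>i\<in>UNIV. (h $ i) *\<^sub>R partial i f z)" unfolding h .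
      then have "norm (frechet_derivative f (at z) h) \<le> (\<Sum>i\<in>UNIV. norm ((h $ i) *\<^sub>R partial i f z))"
        by (simp only: norm_sum)
      also have "\<dots> \<le> (\<Sum>i\<in>UNIV. norm h * b i)"
        unfolding norm_scaleR by (intro sum_mono mult_mono b z) (auto simp: component_le_norm_cart)
      finally show "norm (frechet_derivative f (at z) h) \<le> L * norm h" by (simp add: L_def sum_distrib_left mult.commute)
    qed
  qed (use that in auto)
  then have "L-lipschitz_on ?B f" using b(1) by (intro lipschitz_onI) (auto simp: dist_norm L_def sum_nonneg)
  then show ?thesis by blast
qed

text \<open>By invariance of domain the inverse is continuous, hence differentiable; its derivative has norm at most
  \<open>1 / l\<close> and the mean value inequality applies on the convex image.\<close>

lemma inverse_lipschitz_if_expanding_derivative: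
  fixes f :: "real^'n \<Rightarrow> real^'n"
  assumes S: "open S" and inj: "inj_on f S" and D: "convex (f ` S)" "open (f ` S)"
    and df: "\<And>x. x \<in> S \<Longrightarrow> (f has_derivative (*v) (A x)) (at x)"
    and low: "\<And>x v. x \<in> S \<Longrightarrow> l * norm v \<le> norm (A x *v v)" and l: "l > 0"
  shows "(1 / l)-lipschitz_on (f ` S) (inv_into S f)"
proof (rule lipschitz_onI)
  let ?g = "inv_into S f"
  have cf: "continuous_on S f"
    using df by (meson has_derivative_continuous continuous_at_imp_continuous_on)
  have gf: "?g (f x) = x" if "x \<in> S" for x using inj that by simp
  have cg: "continuous_on (f ` S) ?g" by (rule continuous_on_inverse_open[OF S cf _ gf]) auto
  have "\<exists>B. B ** A x = mat 1 \<and> A x ** B = mat 1" if x: "x \<in> S" for x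
  proof -
    have "A x *v v = 0 \<longrightarrow> v = 0" for v using low[OF x, of v] l by (auto simp: mult_le_0_iff)
    then have "\<exists>B. B ** A x = mat 1" by (simp add: matrix_left_invertible_ker)
    then show ?thesis using matrix_left_right_inverse by blast
  qed
  then obtain B where inv: "\<And>x. x \<in> S \<Longrightarrow> B x ** A x = mat 1" "\<And>x. x \<in> S \<Longrightarrow> A x ** B x = mat 1"
    by metis
  fix a b assume ab: "a \<in> f ` S" "b \<in> f ` S"
  have "norm (?g a - ?g b) \<le> (1 / l) * norm (a - b)"
  proof (rule differentiable_bound[OF D(1), where f' = "\<lambda>y. (*v) (B (?g y))"])
    fix y assume y: "y \<in> f ` S"
    then obtain x where x: "x \<in> S" "y = f x" by blast
    have "(?g has_derivative (*v) (B x)) (at (f x))"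
    proof (rule has_derivative_inverse_dieudonne[OF S D(2) cf cg gf x(1) df[OF x(1)]])
      show "bounded_linear ((*v) (B x))" by (rule matrix_vector_mul_bounded_linear)
      show "(*v) (B x) \<circ> (*v) (A x) = id"
        by (simp add: fun_eq_iff matrix_vector_mul_assoc inv[OF x(1)])
    qed
    then show "(?g has_derivative (*v) (B (?g y))) (at y within f ` S)"
      unfolding x(2) gf[OF x(1)] by (rule has_derivative_at_withinI)
    show "onorm ((*v) (B (?g y))) \<le> 1 / l"
    proof (rule onorm_le)
      fix v
      have "l * norm (B x *v v) \<le> norm (A x *v (B x *v v))" by (rule low[OF x(1)])
      also have "A x *v (B x *v v) = v" by (simp add: matrix_vector_mul_assoc inv[OF x(1)])
      finally show "norm (B (?g y) *v v) \<le> 1 / l * norm v"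
        unfolding x(2) gf[OF x(1)] using l by (simp add: field_simps)
    qed
  qed (use ab in auto)
  then show "dist (?g a) (?g b) \<le> (1 / l) * dist a b" by (simp add: dist_norm)
qed (use l in simp)

text \<open>The Hopf bound supplies balls about \<open>f x\<close> of radius proportional to \<open>1 - \<bar>x\<bar>\<close> for the Schwarz estimate.
  Injectivity enters twice: it rules out an open set on which the derivative vanishes, and it makes preimages of
  compact sets compact.\<close>

lemma harmonic_qc_gradient_jacobian_lower_bound:
  fixes f :: "real^3 \<Rightarrow> real^3" and K :: real
  assumes K: "K > 0" and D: "open D" "convex D"
    and hu: "harmonic_with (ball 0 1) u f A"
    and qc: "\<And>x. x \<in> ball 0 1 \<Longrightarrow> qc_matrix K (A x)"
    and bij: "bij_betw f (ball 0 1) D"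
  shows "\<exists>\<kappa>>0. \<forall>x\<in>ball 0 1. \<kappa> \<le> (det (A x))\<^sup>2"
proof -
  let ?B = "ball (0::real^3) 1"
  have Hu: "harmonic ?B u" using hu unfolding harmonic_def by blast
  have hA: "hess u x = A x" if "x \<in> ?B" for x by (rule hess_eq[OF hu open_ball that])
  have qc': "qc_matrix K (hess u x)" if "x \<in> ?B" for x using qc[OF that] hA[OF that] by simp
  have df: "(f has_derivative (*v) (A x)) (at x)" if "x \<in> ?B" for x using hu that unfolding harmonic_with_def by blast
  have cf: "continuous_on ?B f"
    using df by (meson has_derivative_continuous continuous_at_imp_continuous_on)
  have fdd: "f x \<bullet> e = dd e u x" if "x \<in> ?B" for x e using harmonic_with_dd_eq[OF hu that] by simp
  have inj: "inj_on f ?B" and fB: "f ` ?B = D" using bij by (auto simp: bij_betw_def)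
  have nonflat: "\<not> (\<exists>\<delta>>0. \<forall>x\<in>ball z \<delta>. hess u x = 0)" if z: "z \<in> ?B" for z
  proof
    assume "\<exists>\<delta>>0. \<forall>x\<in>ball z \<delta>. hess u x = 0"
    then obtain \<delta> where \<delta>: "\<delta> > 0" "\<And>x. x \<in> ball z \<delta> \<Longrightarrow> hess u x = 0" by blast
    obtain \<delta>' where \<delta>': "\<delta>' > 0" "ball z \<delta>' \<subseteq> ?B" using openE[OF open_ball z] by blast
    define r where "r = min \<delta> \<delta>'"
    have r: "r > 0" "ball z r \<subseteq> ?B" "\<And>x. x \<in> ball z r \<Longrightarrow> hess u x = 0" using \<delta> \<delta>' by (auto simp: r_def)
    have "\<exists>c. \<forall>x\<in>ball z r. f x = c"
    proof (rule has_derivative_zero_constant)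
      fix x assume x: "x \<in> ball z r"
      then have "(*v) (A x) = (\<lambda>h. 0)" using r(2,3) hA[of x] by fastforce
      then show "(f has_derivative (\<lambda>h. 0)) (at x within ball z r)"
        using df[of x] x r(2) by (metis has_derivative_at_withinI subsetD)
    qed simp
    then obtain c where c: "\<And>x. x \<in> ball z r \<Longrightarrow> f x = c" by blast
    define w where "w = z + (r / 2) *\<^sub>R axis 1 1"
    have w: "w \<in> ball z r" "w \<noteq> z" using r(1) by (auto simp: w_def dist_norm norm_axis_1)
    then have "f w = f z" using c[of w] c[of z] r(1) by simp
    then show False using inj w r(2) z by (meson inj_onD subsetD)
  qed
  have nz: "det (hess u x) \<noteq> 0" if "x \<in> ?B" for x
    by (rule det_hess_nonzero[OF open_ball Hu that K qc' nonflat[OF that]])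
  have "\<exists>c>0. \<forall>x\<in>?B. ball (f x) (c * (1 - norm x)) \<subseteq> D"
  proof (rule Hopf_boundary_distance[OF _ cf D])
    fix n
    show "harmonic ?B (\<lambda>x. f x \<bullet> n)"
      by (rule harmonic_cong[OF harmonic_dd[OF open_ball Hu, of n] open_ball]) (simp add: fdd)
  qed (use fB in auto)
  then obtain c where c: "c > 0" "\<And>x. x \<in> ?B \<Longrightarrow> ball (f x) (c * (1 - norm x)) \<subseteq> D" by blast
  define \<kappa> where "\<kappa> = (c / 4) ^ 6 / (4 * K\<^sup>2)"
  have "\<kappa> \<le> (det (A x))\<^sup>2" if x: "x \<in> ?B" for x
  proof -
    have nx: "norm x < 1" using x by simp
    define d where "d = c / 2 * (1 - norm x)"
    have d: "d > 0" using c nx by (simp add: d_def)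
    have "d < c * (1 - norm x)" using d by (simp add: d_def)
    then have "cball (f x) d \<subseteq> ball (f x) (c * (1 - norm x))" by auto
    then have sub: "cball (f x) d \<subseteq> D" using c(2)[OF x] by blast
    have "continuous_on D (inv_into ?B f)"
      using continuous_on_inverse_open[OF open_ball cf, of "inv_into ?B f"] inj fB by simp
    then have "compact (inv_into ?B f ` cball (f x) d)"
      using sub by (intro compact_continuous_image compact_cball) (rule continuous_on_subset)
    also have "inv_into ?B f ` cball (f x) d = {y \<in> ?B. f y \<in> cball (f x) d}"
    proof (intro set_eqI iffI)
      fix y assume "y \<in> inv_into ?B f ` cball (f x) d"
      then obtain w where w: "w \<in> cball (f x) d" "y = inv_into ?B f w" by blast
      then have "w \<in> f ` ?B" using sub fB by blast
      then show "y \<in> {y \<in> ?B. f y \<in> cball (f x) d}" using w inv_into_into[of w f ?B] f_inv_into_f[of w f ?B] by auto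
    next
      fix y assume "y \<in> {y \<in> ?B. f y \<in> cball (f x) d}"
      then show "y \<in> inv_into ?B f ` cball (f x) d" using inj by (metis (mono_tags, lifting) image_eqI inv_into_f_f mem_Collect_eq)
    qed
    finally have comp: "compact {y \<in> ?B. f y \<in> cball (f x) d}" .
    have p: "1 - (norm x)\<^sup>2 \<le> 2 * (1 - norm x)" "0 \<le> 1 - (norm x)\<^sup>2"
      using zero_le_power2[of "1 - norm x"] power_le_one[of "norm x" 2] nx by (auto simp: power2_eq_square algebra_simps)
    have "c / 4 * (2 * (1 - norm x)) = d" by (simp add: d_def)
    then have d6: "(c / 4) ^ 6 * (2 * (1 - norm x)) ^ 6 = d ^ 6" by (simp only: power_mult_distrib[symmetric])
    have "d ^ 6 \<le> 4 * K\<^sup>2 * (det (hess u x))\<^sup>2 * (1 - (norm x)\<^sup>2) ^ 6"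
      by (rule Ahlfors_Schwarz_jacobian_bound[OF Hu fdd K qc' nz x d comp cf])
    also have "\<dots> \<le> 4 * K\<^sup>2 * (det (hess u x))\<^sup>2 * (2 * (1 - norm x)) ^ 6"
      using p by (intro mult_left_mono power_mono) auto
    finally have "(c / 4) ^ 6 * (2 * (1 - norm x)) ^ 6 \<le> (4 * K\<^sup>2 * (det (hess u x))\<^sup>2) * (2 * (1 - norm x)) ^ 6"
      by (simp only: d6)
    then have "(c / 4) ^ 6 \<le> 4 * K\<^sup>2 * (det (hess u x))\<^sup>2" using nx by simp
    then show ?thesis using K hA[OF x] by (simp add: \<kappa>_def divide_le_eq mult_ac)
  qed
  moreover have "\<kappa> > 0" using c K by (simp add: \<kappa>_def)
  ultimately show ?thesis by blast
qed

theorem theorem3p2: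
  fixes f :: "real^3 \<Rightarrow> real^3" and D :: "(real^3) set" and K :: real
  assumes "K > 0"
    and "open D" and "connected D" and "D \<noteq> {}" and "convex D"
    and "harmonic_gradient_on (ball 0 1) f"
    and "quasiconformal_on K (ball 0 1) f"
    and "bij_betw f (ball 0 1) D"
  shows "(continuous_on (cball 0 1) f \<and> partials_extend (ball 0 1) f \<longrightarrow>
            bi_lipschitz_on (ball 0 1) f \<and> (\<exists>L. L-lipschitz_on D (inv_into (ball 0 1) f)))
       \<and> (bounded D \<longrightarrow> co_lipschitz_on (ball 0 1) f)"
proof -
  let ?B = "ball (0::real^3) 1"
  define A where "A x = matrix (frechet_derivative f (at x))" for x
  have C1: "C1_on ?B f" using assms(7) unfolding quasiconformal_on_def by blast
  obtain u where hu: "harmonic_with ?B u f A"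
    using harmonic_gradient_imp_harmonic_with[OF open_ball assms(6) C1] unfolding A_def by metis
  have df: "(f has_derivative (*v) (A x)) (at x)" if "x \<in> ?B" for x using hu that unfolding harmonic_with_def by blast
  have fd: "frechet_derivative f (at x) = (*v) (A x)" if "x \<in> ?B" for x
    using frechet_derivative_at[OF df[OF that]] by simp
  have lin: "linear (frechet_derivative f (at x))" if "x \<in> ?B" for x
    using df[OF that] fd[OF that] has_derivative_linear by metis
  have dil: "max_stretch (frechet_derivative f (at x)) ^ 3 / K \<le> \<bar>det (A x)\<bar>"
     "\<bar>det (A x)\<bar> \<le> K * min_stretch (frechet_derivative f (at x)) ^ 3" if "x \<in> ?B" for x
    using assms(7) that unfolding quasiconformal_on_def jacobian_def A_def by auto
  have qc: "qc_matrix K (A x)" if x: "x \<in> ?B" for x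
    unfolding qc_matrix_def
  proof
    fix v
    let ?m = "max_stretch (frechet_derivative f (at x))"
    have "norm (A x *v v) ^ 3 \<le> (?m * norm v) ^ 3"
      using norm_le_max_stretch[OF lin[OF x], of v] fd[OF x] by (intro power_mono) auto
    also have "\<dots> = ?m ^ 3 * norm v ^ 3" by (rule power_mult_distrib)
    also have "\<dots> \<le> K * \<bar>det (A x)\<bar> * norm v ^ 3"
      using dil(1)[OF x] assms(1) by (intro mult_right_mono) (auto simp: field_simps)
    finally show "norm (A x *v v) ^ 3 \<le> K * \<bar>det (A x)\<bar> * norm v ^ 3" .
  qed
  obtain \<kappa> where \<kappa>: "\<kappa> > 0" "\<And>x. x \<in> ?B \<Longrightarrow> \<kappa> \<le> (det (A x))\<^sup>2"
    using harmonic_qc_gradient_jacobian_lower_bound[OF assms(1,2,5) hu qc assms(8)] by blast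
  \<comment> \<open>The minimum with \<open>1\<close> gives \<open>l ^ 3 \<le> l\<close>, which replaces a cube root.\<close>
  define l where "l = min 1 (sqrt \<kappa> / K)"
  have l: "l > 0" "l \<le> 1" "l \<le> sqrt \<kappa> / K" using \<kappa> assms(1) by (auto simp: l_def)
  have low: "l * norm v \<le> norm (A x *v v)" if x: "x \<in> ?B" for x v
  proof -
    let ?s = "min_stretch (frechet_derivative f (at x))"
    have "sqrt \<kappa> \<le> \<bar>det (A x)\<bar>" using real_sqrt_le_mono[OF \<kappa>(2)[OF x]] by simp
    also have "\<dots> \<le> K * ?s ^ 3" by (rule dil(2)[OF x])
    finally have "sqrt \<kappa> / K \<le> ?s ^ 3" using assms(1) by (simp add: field_simps)
    moreover have "l ^ 3 \<le> l" using l power_decreasing[of 1 3 l] by simp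
    ultimately have "l ^ 3 \<le> ?s ^ 3" using l(3) by linarith
    then have "l \<le> ?s" using real_root_le_mono[of 3 "l ^ 3" "?s ^ 3"] by (simp add: odd_real_root_power_cancel)
    then have "l * norm v \<le> ?s * norm v" by (rule mult_right_mono) simp
    also have "\<dots> \<le> norm (A x *v v)" using min_stretch_le_norm[OF lin[OF x], of v] fd[OF x] by simp
    finally show ?thesis .
  qed
  have inj: "inj_on f ?B" and fB: "f ` ?B = D" using assms(8) by (auto simp: bij_betw_def)
  have lipg: "(1 / l)-lipschitz_on D (inv_into ?B f)"
    using inverse_lipschitz_if_expanding_derivative[OF open_ball inj, unfolded fB, OF assms(5,2) df low l(1)] by blast
  have co: "co_lipschitz_on ?B f"
    unfolding co_lipschitz_on_def
  proof (intro exI[of _ l] conjI ballI)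
    fix x y assume xy: "x \<in> ?B" "y \<in> ?B"
    then have "dist (inv_into ?B f (f x)) (inv_into ?B f (f y)) \<le> (1 / l) * dist (f x) (f y)"
      using fB by (intro lipschitz_onD[OF lipg]) auto
    then show "l * dist x y \<le> dist (f x) (f y)" using xy inj l(1) by (simp add: field_simps)
  qed (rule l(1))
  show ?thesis using co lipg lipschitz_if_partials_extend[OF C1] unfolding bi_lipschitz_on_def by blast
qed

end
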